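(* Let $P(z)=a_0(z-\alpha_1)(z-\alpha_2)\cdots(z-\alpha_n)$ be a complex polynomial of degree $n$ (so $a_0\ne 0$) with $\alpha_i\neq\alpha_j$ for $i\ne j$, and write $$P'(z)=b_0(z-\beta_1)^{q_1}(z-\beta_2)^{q_2}\cdots(z-\beta_k)^{q_k},$$ where $\beta_1,\ldots,\beta_k$ are the distinct zeros of $P'$, with multiplicities $q_1,\ldots,q_k$. Suppose that $P$ is a uniqueness polynomial and that $P(\beta_s)\neq P(\beta_t)$ for all $1\le s<t\le k$. Let $S_1=\{\alpha_1,\alpha_2,\ldots,\alpha_n\}$ and $S_2=\{\beta_1,\beta_2,\ldots,\beta_k\}$. Moreover, assume that $k\ge 2$ and that $P'(z)$ has no simple zeros. If two non-constant meromorphic (resp. entire) functions $f$ and $g$ share the set $S_1$ with weight $3$ and the set $S_2$ IM, and if $n\ge\max\{10-2k,5\}$ (resp. $n\ge 5$), then $f\equiv g$.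
   Context: Meromorphic (resp. entire) functions are meromorphic (resp. holomorphic) in the whole complex plane $\mathbb{C}$. A non-constant polynomial $P$ is called a uniqueness polynomial if, for any two non-constant meromorphic functions $f,g$ and any non-zero constant $c$, $P(f)\equiv cP(g)$ implies $f\equiv g$. For $l$ a non-negative integer or $\infty$, $E_l(a;f)$ is the multiset of all $a$-points of $f$, where an $a$-point of multiplicity $m$ is counted $m$ times if $m\le l$ and $l+1$ times if $m>l$. For a set $S$, $E_f(S,l)=\bigcup_{a\in S}E_l(a;f)$ (as multisets). The functions $f$ and $g$ share $S$ with weight $l$ if $E_f(S,l)=E_g(S,l)$. $f$ and $g$ share $S$ IM if $\overline{E}_f(S)=\overline{E}_g(S)$, where $\overline{E}_f(S)=\{z: f(z)\in S\}$ (multiplicities ignored). The statement with "resp." is two statements: one for meromorphic functions with $n\ge\max\{10-2k,5\}$, and one for entire functions with $n\ge 5$. *)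

theory Defs
  imports
    "HOL-Complex_Analysis.Complex_Analysis"
    "HOL-Computational_Algebra.Polynomial"
    "HOL-Library.Extended_Nat"
begin

(* Meromorphic functions on the plane are represented by the total functions f with
   "f nicely_meromorphic_on UNIV": f is continuous away from its poles and takes the dummy
   value 0 at each pole.  Hence identity of two meromorphic functions is equality in HOL, but a
   pole must be excluded explicitly whenever "f z = a" is meant as "z is an a-point of f". *)

definition nonconst_meromorphic :: "(complex \<Rightarrow> complex) \<Rightarrow> bool" where
  "nonconst_meromorphic f \<longleftrightarrow> f nicely_meromorphic_on UNIV \<and> \<not> f constant_on UNIV"

definition nonconst_entire :: "(complex \<Rightarrow> complex) \<Rightarrow> bool" where
  "nonconst_entire f \<longleftrightarrow> f holomorphic_on UNIV \<and> \<not> f constant_on UNIV"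

(* The functions z |-> P (f z) and z |-> c * P (g z) need not be 0 at the poles of f and g, so
   their identity as meromorphic functions is equality outside a set without limit points. *)
definition uniqueness_polynomial :: "complex poly \<Rightarrow> bool" where
  "uniqueness_polynomial P \<longleftrightarrow> degree P > 0 \<and>
     (\<forall>f g c. nonconst_meromorphic f \<longrightarrow> nonconst_meromorphic g \<longrightarrow> c \<noteq> 0 \<longrightarrow>
        (\<forall>\<^sub>\<approx>z. poly P (f z) = c * poly P (g z)) \<longrightarrow> f = g)"

definition is_apoint :: "(complex \<Rightarrow> complex) \<Rightarrow> complex \<Rightarrow> complex \<Rightarrow> bool" where
  "is_apoint f a z \<longleftrightarrow> \<not> is_pole f z \<and> f z = a"

definition truncate_mult :: "enat \<Rightarrow> nat \<Rightarrow> nat" where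
  "truncate_mult l m = (if enat m \<le> l then m else Suc (the_enat l))"

(* A multiset of points of the plane may be infinite, so it is given by its counting function
   (in contrast to the type of finite multisets of HOL-Library).  For non-constant f the zorder
   at an a-point is its multiplicity, a positive integer. *)
definition apoints :: "enat \<Rightarrow> complex \<Rightarrow> (complex \<Rightarrow> complex) \<Rightarrow> complex \<Rightarrow> nat" where
  "apoints l a f z =
     (if is_apoint f a z then truncate_mult l (nat (zorder (\<lambda>w. f w - a) z)) else 0)"

(* For finite S.  Distinct values a have disjoint sets of a-points, so the sum of the counting
   functions is the union of the multisets under either reading of multiset union. *)
definition preimage_mset ::
    "(complex \<Rightarrow> complex) \<Rightarrow> complex set \<Rightarrow> enat \<Rightarrow> complex \<Rightarrow> nat" where
  "preimage_mset f S l z = (\<Sum>a\<in>S. apoints l a f z)"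

definition share_set_weight ::
    "(complex \<Rightarrow> complex) \<Rightarrow> (complex \<Rightarrow> complex) \<Rightarrow> complex set \<Rightarrow> enat \<Rightarrow> bool" where
  "share_set_weight f g S l \<longleftrightarrow> preimage_mset f S l = preimage_mset g S l"

definition share_set_IM ::
    "(complex \<Rightarrow> complex) \<Rightarrow> (complex \<Rightarrow> complex) \<Rightarrow> complex set \<Rightarrow> bool" where
  "share_set_IM f g S \<longleftrightarrow> {z. \<exists>a\<in>S. is_apoint f a z} = {z. \<exists>a\<in>S. is_apoint g a z}"

end

theory Submission
  imports Defs "HOL-Real_Asymp.Real_Asymp"
    "HOL-Computational_Algebra.Fundamental_Theorem_Algebra"
begin

text \<open>Write \<open>f = x / y\<close> and \<open>g = \<xi> / \<eta>\<close> as quotients of entire functions without common zeros, and let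
  \<open>T(r)\<close> be the mean of \<open>ln (\<bar>x\<bar> + \<bar>y\<bar>)\<close> (respectively \<open>ln (\<bar>\<xi>\<bar> + \<bar>\<eta>\<bar>)\<close>) over the circle of radius \<open>r\<close>.
  Dividing out zeros in a disc and applying the Schwarz formula to the logarithm of what remains
  gives arbitrarily large circles on which the logarithmic derivatives of \<open>f - a\<close> and \<open>g - a\<close> are
  bounded pointwise by a power of \<open>T(r)\<close>.

  With \<open>D f = (P \<circ> f)' / (P \<circ> f)\<close> put \<open>\<Phi> = D f - D g\<close> and let \<open>H\<close> be the difference of
  \<open>(D f)' / D f - D f\<close> and the same expression in \<open>g\<close>. The sharing hypotheses and the bound on \<open>n\<close> make
  \<open>(f' g' H)\<^sup>2 \<Phi>\<^sup>3 / (y \<eta> \<Prod> (f - \<alpha>) (g - \<alpha>) \<Prod> (f - \<beta>)\<^sup>2 (g - \<beta>)\<^sup>2)\<close> entire. On the circles above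
  it is at most a power of \<open>T(r)\<close> divided by \<open>(\<bar>x\<bar> + \<bar>y\<bar>) (\<bar>\<xi>\<bar> + \<bar>\<eta>\<bar>)\<close>, which contradicts Jensen's
  inequality unless \<open>\<Phi> = 0\<close> or \<open>H = 0\<close>. In the first case \<open>P(f) = c P(g)\<close>. In the second
  \<open>1 / P(f) = A / P(g) + B\<close>; if \<open>B \<noteq> 0\<close> then \<open>g\<close> is ramified over three values with indices at least
  2, 5 and 5, which the same decay argument excludes.\<close>

section \<open>Circle means\<close>

text \<open>Value distribution arguments usually compare counting functions. Here the bookkeeping is
  done point by point, as the order of the single function \<open>F\<close>, so the inequality
  between orders has to hold at every point rather than on average. That determines the exponents 2,
  3, 1, 2 in \<open>F\<close>: the lower bound for its order is exactly 0 at a shared simple zero of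
  P(f) and P(g), at a shared zero with multiplicities 4 and 5, at every point over
  \<open>S2\<close>, and, when \<open>n + 2 * k = 10\<close>, at a simple pole of one function where
  the other is unramified with a value outside \<open>S1\<close> and \<open>S2\<close>. Entire
  functions never meet the last case. The derivatives are controlled by \<open>K\<close> times the
  distance to the values in question: only the nearest value can make a denominator small, and the
  remaining factors supply powers of \<open>1 + norm f\<close>. The factor
  \<open>1 / (y * \<eta>)\<close> turns one such power into decay. Jensen's inequality then bounds
  \<open>T\<close> by an affine function of \<open>ln T\<close> on arbitrarily large circles,
  against the unboundedness of \<open>T\<close>.\<close>

definition cmean :: "complex \<Rightarrow> real \<Rightarrow> (complex \<Rightarrow> 'a::banach) \<Rightarrow> 'a" where
  "cmean c R u = integral {0..1} (\<lambda>t. u (circlepath c R t))"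

lemma circlepath_in_sphere: "R \<ge> 0 \<Longrightarrow> circlepath c R t \<in> sphere c R"
  by (simp add: circlepath dist_norm norm_mult)

lemma continuous_on_circlepath [continuous_intros]: "continuous_on A (circlepath c R)"
  unfolding circlepath by (intro continuous_intros)

lemma cmean_integrable:
  fixes u :: "complex \<Rightarrow> 'a::banach"
  assumes "continuous_on (sphere c R) u" "R \<ge> 0"
  shows "(\<lambda>t. u (circlepath c R t)) integrable_on {0..1}"
  using assms circlepath_in_sphere
  by (intro integrable_continuous_real continuous_on_compose2[OF assms(1)] continuous_intros) blast

lemma cmean_const [simp]: "cmean c R (\<lambda>_. a) = a"
  by (simp add: cmean_def)

lemma cmean_cong:
  assumes "\<And>z. z \<in> sphere c R \<Longrightarrow> u z = v z" "R \<ge> 0"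
  shows "cmean c R u = cmean c R v"
  unfolding cmean_def using assms circlepath_in_sphere by (intro integral_cong) blast

context
  fixes c :: complex and R :: real
  assumes R: "R \<ge> 0"
begin

lemma cmean_add:
  "continuous_on (sphere c R) u \<Longrightarrow> continuous_on (sphere c R) v \<Longrightarrow>
    cmean c R (\<lambda>z. u z + v z) = cmean c R u + cmean c R v"
  unfolding cmean_def using R by (intro integral_add cmean_integrable)

lemma cmean_diff:
  "continuous_on (sphere c R) u \<Longrightarrow> continuous_on (sphere c R) v \<Longrightarrow>
    cmean c R (\<lambda>z. u z - v z) = cmean c R u - cmean c R v"
  unfolding cmean_def using R by (intro integral_diff cmean_integrable)

lemma cmean_cmult: "cmean c R (\<lambda>z. a * u z) = a * cmean c R u" for a :: real
  unfolding cmean_def by simp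

lemma cmean_sum_list:
  "(\<And>i. i \<in> set xs \<Longrightarrow> continuous_on (sphere c R) (u i)) \<Longrightarrow>
    cmean c R (\<lambda>z. \<Sum>i\<leftarrow>xs. u i z) = (\<Sum>i\<leftarrow>xs. cmean c R (u i))"
proof (induction xs)
  case (Cons a xs)
  have "continuous_on (sphere c R) (\<lambda>z. \<Sum>i\<leftarrow>xs. u i z)"
    using Cons.prems
  proof (induction xs)
    case (Cons b xs)
    then show ?case by (auto intro!: continuous_on_add)
  qed auto
  then show ?case using Cons by (simp add: cmean_add)
qed auto

lemma cmean_mono:
  fixes u v :: "complex \<Rightarrow> real"
  assumes "continuous_on (sphere c R) u" "continuous_on (sphere c R) v"
    "\<And>z. z \<in> sphere c R \<Longrightarrow> u z \<le> v z"
  shows "cmean c R u \<le> cmean c R v"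
  unfolding cmean_def using R assms circlepath_in_sphere
  by (intro integral_le cmean_integrable) blast+

lemma cmean_norm:
  fixes u :: "complex \<Rightarrow> 'a::euclidean_space"
  assumes "continuous_on (sphere c R) u" "continuous_on (sphere c R) v"
    "\<And>z. z \<in> sphere c R \<Longrightarrow> norm (u z) \<le> v z"
  shows "norm (cmean c R u) \<le> cmean c R v"
  unfolding cmean_def using R assms circlepath_in_sphere
  by (intro integral_norm_bound_integral cmean_integrable) blast+

end

lemma cmean_Re:
  assumes "continuous_on (sphere c R) f" "R \<ge> 0"
  shows "Re (cmean c R f) = cmean c R (\<lambda>z. Re (f z))"
  unfolding cmean_def
  using integral_linear[OF cmean_integrable[OF assms] bounded_linear_Re] by (simp add: o_def)

lemma cmean_cnj:
  assumes "continuous_on (sphere c R) f" "R \<ge> 0"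
  shows "cnj (cmean c R f) = cmean c R (\<lambda>z. cnj (f z))"
  unfolding cmean_def
  using integral_linear[OF cmean_integrable[OF assms] bounded_linear_cnj] by (simp add: o_def)

text \<open>On the circle dz = 2 pi i (z - c) dt, so the extra factor \<open>z - c\<close> converts
  the mean into a contour integral and makes the Cauchy formulas available.\<close>

lemma cmean_eq_contour_integral:
  assumes "(f has_contour_integral I) (circlepath c R)" "R > 0"
  shows "cmean c R (\<lambda>z. f z * (z - c)) = I / (2 * of_real pi * \<i>)"
proof -
  have "((\<lambda>t. f (circlepath c R t) * (2 * pi * \<i> * R * exp (2 * of_real pi * \<i> * t)))
      has_integral I) {0..1}"
    using assms(1) unfolding has_contour_integral_def
    by (rule has_integral_eq[rotated]) (simp add: vector_derivative_circlepath01)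
  from has_integral_mult_left[OF this, of "1 / (2 * of_real pi * \<i>)"]
  have "((\<lambda>t. f (circlepath c R t) * (circlepath c R t - c))
      has_integral I / (2 * of_real pi * \<i>)) {0..1}"
    by (simp add: circlepath mult_ac)
  then show ?thesis unfolding cmean_def by (rule integral_unique)
qed

lemma cmean_holomorphic:
  assumes "f holomorphic_on cball c R" "R > 0"
  shows "cmean c R f = f c"
proof -
  have "cmean c R f = cmean c R (\<lambda>z. f z / (z - c) * (z - c))"
    using assms(2) by (intro cmean_cong) auto
  also have "\<dots> = f c"
    using cmean_eq_contour_integral[OF Cauchy_integral_circlepath_simple[OF assms(1), of c]] assms(2)
    by simp
  finally show ?thesis .
qed

text \<open>The derivative of the Schwarz integral formula: only the real part of \<open>f\<close> on the circle
  enters, because \<open>cnj \<circ> f\<close> is orthogonal to the kernel.\<close>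
lemma deriv_eq_cmean_Re:
  assumes "f holomorphic_on cball c R" "z \<in> ball c R"
  shows "deriv f z = cmean c R (\<lambda>w. 2 * of_real (Re (f w)) * (w - c) / (w - z)\<^sup>2)"
proof -
  have R: "R > 0" using assms(2) by (metis ball_eq_empty empty_iff not_le)
  have cont: "continuous_on (sphere c R) f"
    using assms(1) holomorphic_on_imp_continuous_on continuous_on_subset sphere_cball by blast
  have ne: "w \<noteq> z" if "w \<in> sphere c R" for w using that assms(2) by auto
  have 1: "cmean c R (\<lambda>w. f w / (w - z)\<^sup>2 * (w - c)) = deriv f z"
  proof -
    have "((\<lambda>u. f u/(u-z) ^ (Suc 1)) has_contour_integral ((2 * pi * \<i>) / (fact 1) * (deriv ^^ 1) f z))
           (circlepath c R)"
      using assms by (intro Cauchy_has_contour_integral_higher_derivative_circlepath)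
        (auto simp: holomorphic_on_imp_continuous_on intro: holomorphic_on_subset)
    from cmean_eq_contour_integral[OF this R] show ?thesis by (simp add: power2_eq_square)
  qed
  \<comment> \<open>The reflected kernel: on the circle \<open>w - c\<close> times its conjugate is
    R^2, so \<open>cnj (k w * (w - c))\<close> equals (w - c) / (w - z)^2, while \<open>k\<close> is
    regular on the closed disc because its pole is the mirror image of \<open>z\<close>.\<close>
  define k where "k = (\<lambda>w. of_real (R\<^sup>2) / (of_real (R\<^sup>2) - cnj (z - c) * (w - c))\<^sup>2)"
  have den: "of_real (R\<^sup>2) - cnj (z - c) * (w - c) \<noteq> 0" if "w \<in> cball c R" for w
  proof
    assume "of_real (R\<^sup>2) - cnj (z - c) * (w - c) = 0"
    then have "of_real (R\<^sup>2) = cnj (z - c) * (w - c)" by simp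
    then have "norm (of_real (R\<^sup>2) :: complex) = norm (cnj (z - c) * (w - c))" by simp
    then have "R\<^sup>2 = norm (z - c) * norm (w - c)"
      by (simp only: norm_mult norm_of_real complex_mod_cnj) simp
    moreover have "norm (z - c) < R" "norm (w - c) \<le> R"
      using assms(2) that by (auto simp: dist_norm norm_minus_commute)
    ultimately show False using R
      by (smt (verit) mult_strict_mono' mult_left_mono norm_ge_zero power2_eq_square mult_strict_right_mono)
  qed
  have hol: "(\<lambda>w. f w * k w * (w - c)) holomorphic_on cball c R"
    unfolding k_def using den assms(1) by (intro holomorphic_intros) auto
  then have "continuous_on (sphere c R) (\<lambda>w. f w * k w * (w - c))"
    using holomorphic_on_imp_continuous_on continuous_on_subset sphere_cball by blast
  \<comment> \<open>The mean of the holomorphic integrand is its value at \<open>c\<close>, where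
    the factor \<open>w - c\<close> vanishes.\<close>
  from cmean_cnj[OF this] have "cmean c R (\<lambda>w. cnj (f w * k w * (w - c))) = 0"
    using cmean_holomorphic[OF hol R] R by simp
  moreover have "cmean c R (\<lambda>w. cnj (f w * k w * (w - c)))
      = cmean c R (\<lambda>w. cnj (f w) * (w - c) / (w - z)\<^sup>2)"
  proof (rule cmean_cong)
    fix w assume w: "w \<in> sphere c R"
    define u v where "u = w - c" and "v = z - c"
    have "norm u = R" using w by (simp add: u_def dist_norm norm_minus_commute)
    then have uu: "u * cnj u = of_real (R\<^sup>2)" by (metis complex_norm_square)
    have u0: "u \<noteq> 0" "u \<noteq> v" using w R ne by (auto simp: u_def v_def)
    have "cnj (k w * (w - c)) = of_real (R\<^sup>2) / (of_real (R\<^sup>2) - v * cnj u)\<^sup>2 * cnj u"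
      by (simp add: k_def u_def v_def)
    also have "\<dots> = (u * cnj u) / (u * cnj u - v * cnj u)\<^sup>2 * cnj u"
      by (simp only: uu)
    also have "\<dots> = u * (cnj u)\<^sup>2 / ((u - v)\<^sup>2 * (cnj u)\<^sup>2)"
      by (simp add: power2_eq_square algebra_simps)
    also have "\<dots> = u / (u - v)\<^sup>2" using u0 by simp
    finally have "cnj (k w * (w - c)) = u / (u - v)\<^sup>2" .
    then have "cnj (f w) * cnj (k w * (w - c)) = cnj (f w) * (w - c) / (w - z)\<^sup>2"
      by (simp only:) (simp add: u_def v_def)
    then show "cnj (f w * k w * (w - c)) = cnj (f w) * (w - c) / (w - z)\<^sup>2"
      by (simp add: mult.assoc)
  qed (use R in auto)
  ultimately have 2: "cmean c R (\<lambda>w. cnj (f w) * (w - c) / (w - z)\<^sup>2) = 0" by simp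
  have "cmean c R (\<lambda>w. f w / (w - z)\<^sup>2 * (w - c) + cnj (f w) * (w - c) / (w - z)\<^sup>2)
      = deriv f z"
    by (subst cmean_add) (use R ne cont 1 2 in \<open>auto intro!: continuous_intros\<close>)
  moreover have "f w / (w - z)\<^sup>2 * (w - c) + cnj (f w) * (w - c) / (w - z)\<^sup>2
      = 2 * of_real (Re (f w)) * (w - c) / (w - z)\<^sup>2" for w
    by (simp add: complex_add_cnj add_divide_distrib[symmetric] distrib_right[symmetric])
  ultimately show ?thesis by simp
qed

lemma norm_deriv_le_cmean_Re:
  assumes f: "f holomorphic_on cball c R" and z: "dist c z \<le> r" "r < R"
  shows "norm (deriv f z) \<le> 2 * R / (R - r)\<^sup>2 * cmean c R (\<lambda>w. \<bar>Re (f w)\<bar>)"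
proof -
  have R: "R > 0" using z by (smt (verit) zero_le_dist)
  have cont: "continuous_on (sphere c R) f"
    using assms(1) holomorphic_on_imp_continuous_on continuous_on_subset sphere_cball by blast
  have ne: "w \<noteq> z" if "w \<in> sphere c R" for w using that z by auto
  have "deriv f z = cmean c R (\<lambda>w. 2 * of_real (Re (f w)) * (w - c) / (w - z)\<^sup>2)"
    using assms by (intro deriv_eq_cmean_Re) auto
  also have "norm \<dots> \<le> cmean c R (\<lambda>w. 2 * R / (R - r)\<^sup>2 * \<bar>Re (f w)\<bar>)"
  proof (rule cmean_norm)
    fix w assume w: "w \<in> sphere c R"
    have "R - r \<le> norm (w - z)" using w z
      by (smt (verit) dist_norm dist_triangle2 mem_sphere dist_commute)
    then have "(R - r)\<^sup>2 \<le> (norm (w - z))\<^sup>2" using z by (intro power_mono) auto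
    then have "2 * \<bar>Re (f w)\<bar> * R / (norm (w - z))\<^sup>2 \<le> 2 * \<bar>Re (f w)\<bar> * R / (R - r)\<^sup>2"
      using z R by (intro divide_left_mono mult_pos_pos) (auto simp: ne[OF w])
    then show "norm (2 * of_real (Re (f w)) * (w - c) / (w - z)\<^sup>2) \<le> 2 * R / (R - r)\<^sup>2 * \<bar>Re (f w)\<bar>"
      using w by (simp add: norm_mult norm_divide norm_power dist_norm norm_minus_commute mult_ac)
  qed (use ne R z in \<open>auto intro!: continuous_intros cont\<close>)
  also have "\<dots> = 2 * R / (R - r)\<^sup>2 * cmean c R (\<lambda>w. \<bar>Re (f w)\<bar>)"
    using R by (intro cmean_cmult) auto
  finally show ?thesis .
qed

section \<open>Zeros of entire functions and Jensen's inequality\<close>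

lemma factor_zero:
  assumes A: "A holomorphic_on UNIV" "\<exists>z. A z \<noteq> 0" and a: "A a = 0"
  obtains n E where "E holomorphic_on UNIV" "E a \<noteq> 0" "\<And>z. A z = (z - a) ^ n * E z"
proof -
  define n g where "n = nat (zorder A a)" and "g = zor_poly A a"
  obtain r where r: "r > 0" "g holomorphic_on cball a r"
      "\<And>w. w \<in> cball a r \<Longrightarrow> A w = g w * (w - a) ^ n \<and> g w \<noteq> 0"
    and n: "n > 0"
    using zorder_exist_zero[of A UNIV a] A a connected_UNIV[where 'a = complex]
    unfolding n_def g_def by auto
  define E where "E = (\<lambda>w. if w = a then g a else A w / (w - a) ^ n)"
  have lim: "(\<lambda>w. A w / (w - a) ^ n) \<midarrow>a\<rightarrow> g a"
  proof -
    have "isCont g a"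
      using continuous_on_interior[OF holomorphic_on_imp_continuous_on[OF r(2)]] r(1) by simp
    then have "g \<midarrow>a\<rightarrow> g a" by (simp add: isCont_def)
    moreover have "eventually (\<lambda>w. w \<in> ball a r - {a}) (at a)"
      using r(1) by (intro eventually_at_in_open) auto
    then have "eventually (\<lambda>w. A w / (w - a) ^ n = g w) (at a)"
      by eventually_elim (use r(3) in auto)
    ultimately show ?thesis using filterlim_cong by force
  qed
  have "(\<lambda>w. A w / (w - a) ^ n) holomorphic_on UNIV - {a}"
    using A by (intro holomorphic_intros) (auto intro: holomorphic_on_subset)
  from removable_singularity[OF this _ lim] have "E holomorphic_on UNIV"
    unfolding E_def by simp
  then show ?thesis
    by (rule that[of _ n]) (use r(3)[of a] r(1) n a in \<open>auto simp: E_def\<close>)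
qed

text \<open>Since \<open>E\<close> has no zero on \<open>Z\<close>, the list repeats every zero in
  \<open>Z\<close> according to its multiplicity. Its length is the zero count that
  \<open>jensen_zero_count\<close> turns into growth.\<close>

lemma factor_zeros:
  assumes "finite Z" "A holomorphic_on UNIV" "\<exists>z. A z \<noteq> 0"
  shows "\<exists>zs E. E holomorphic_on UNIV \<and> (\<forall>z\<in>Z. E z \<noteq> 0) \<and> set zs \<subseteq> Z \<and>
    (\<forall>z. A z = (\<Prod>a\<leftarrow>zs. z - a) * E z)"
  using assms(1)
proof (induction Z rule: finite_induct)
  case empty
  then show ?case using assms by (intro exI[of _ "[]"] exI[of _ A]) auto
next
  case (insert a Z)
  then obtain zs E where E: "E holomorphic_on UNIV" "\<forall>z\<in>Z. E z \<noteq> 0" "set zs \<subseteq> Z"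
    "\<forall>z. A z = (\<Prod>a\<leftarrow>zs. z - a) * E z" by blast
  show ?case
  proof (cases "E a = 0")
    case False
    then show ?thesis using E by (intro exI[of _ zs] exI[of _ E]) auto
  next
    case True
    have "\<exists>z. E z \<noteq> 0" using E(4) assms(3) by auto
    from factor_zero[OF E(1) this True] obtain n F where
      F: "F holomorphic_on UNIV" "F a \<noteq> 0" "\<And>z. E z = (z - a) ^ n * F z" by metis
    have "(\<Prod>b\<leftarrow>replicate n a @ zs. z - b) = (z - a) ^ n * (\<Prod>b\<leftarrow>zs. z - b)" for z
      by (induction n) (auto simp: mult_ac)
    then show ?thesis
      using F E insert.hyps by (intro exI[of _ "replicate n a @ zs"] exI[of _ F]) auto
  qed
qed

lemma finite_zeros_cball:
  assumes "A holomorphic_on UNIV" "\<exists>z. A z \<noteq> 0"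
  shows "finite {z \<in> cball c R. A z = 0}"
proof (cases "A constant_on UNIV")
  case True
  with assms(2) have "{z \<in> cball c R. A z = 0} = {}" by (auto simp: constant_on_def)
  then show ?thesis by (metis finite.emptyI)
next
  case False
  then show ?thesis using assms(1) by (intro holomorphic_compact_finite_zeros[of A UNIV]) auto
qed

lemma holomorphic_log_ball:
  assumes "f holomorphic_on ball c R" "\<And>z. z \<in> ball c R \<Longrightarrow> f z \<noteq> 0"
  shows "\<exists>g. g holomorphic_on ball c R \<and> (\<forall>z\<in>ball c R. f z = exp (g z))"
proof -
  have "simply_connected (ball c R)" by (intro convex_imp_simply_connected convex_ball)
  from iffD1[OF simply_connected_eq_holomorphic_log this, THEN conjunct2, rule_format, of f]
  show ?thesis using assms by blast
qed

lemma cmean_ln_nonvanishing: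
  assumes f: "f holomorphic_on ball c R'" "\<And>z. z \<in> ball c R' \<Longrightarrow> f z \<noteq> 0" and R: "0 < R" "R < R'"
  shows "cmean c R (\<lambda>z. ln (norm (f z))) = ln (norm (f c))"
proof -
  from holomorphic_log_ball[OF f] obtain g where
    g: "g holomorphic_on ball c R'" "\<And>z. z \<in> ball c R' \<Longrightarrow> f z = exp (g z)" by metis
  have sub: "cball c R \<subseteq> ball c R'" "sphere c R \<subseteq> ball c R'" using R by auto
  have hol: "g holomorphic_on cball c R" using g(1) sub(1) by (rule holomorphic_on_subset)
  have "cmean c R (\<lambda>z. ln (norm (f z))) = cmean c R (\<lambda>z. Re (g z))"
    using R sub by (intro cmean_cong) (auto simp: g(2) subset_iff)
  also have "\<dots> = Re (g c)"
    using cmean_Re[OF continuous_on_subset[OF holomorphic_on_imp_continuous_on[OF g(1)] sub(2)]]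
      cmean_holomorphic[OF hol R(1)] R by simp
  also have "\<dots> = ln (norm (f c))" using g(2)[of c] R by simp
  finally show ?thesis .
qed

text \<open>Reflection in the circle moves the zero outside: \<open>f\<close> below has the same
  modulus as \<open>z - a\<close> on the circle, no zero in a larger disc, and the value
  \<open>R\<close> at the centre.\<close>

lemma cmean_ln_diff_inside:
  assumes a: "a \<in> ball c R"
  shows "cmean c R (\<lambda>z. ln (norm (z - a))) = ln R"
proof -
  have R: "R > 0" using a by (metis ball_eq_empty empty_iff not_le)
  define f where "f = (\<lambda>z. of_real R - cnj (a - c) * (z - c) / of_real R)"
  \<comment> \<open>The distance from \<open>c\<close> to the mirror image of \<open>a\<close>. For
    \<open>a = c\<close> the function \<open>f\<close> is constant and any larger radius
    serves.\<close>
  define R' where "R' = (if a = c then R + 1 else R\<^sup>2 / norm (a - c))"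
  have ac: "norm (a - c) < R" using a by (simp add: dist_norm norm_minus_commute)
  have R': "R < R'"
    using ac R by (auto simp: R'_def power2_eq_square field_simps)
  have "f z \<noteq> 0" if "z \<in> ball c R'" for z
  proof
    assume "f z = 0"
    then have "of_real (R\<^sup>2) = cnj (a - c) * (z - c)"
      using R by (simp add: f_def field_simps power2_eq_square)
    then have "norm (of_real (R\<^sup>2) :: complex) = norm (cnj (a - c) * (z - c))" by simp
    then have eq: "R\<^sup>2 = norm (a - c) * norm (z - c)"
      by (simp only: norm_mult norm_of_real complex_mod_cnj) simp
    then have ne: "a \<noteq> c" using R by auto
    then have "norm (z - c) = R'" using eq by (simp add: R'_def)
    then show False using that by (simp add: dist_norm norm_minus_commute)
  qed
  moreover have "f holomorphic_on ball c R'"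
    unfolding f_def using R by (intro holomorphic_intros) auto
  ultimately have "cmean c R (\<lambda>z. ln (norm (f z))) = ln (norm (f c))"
    using R R' by (intro cmean_ln_nonvanishing)
  moreover have "norm (f z) = norm (z - a)" if "z \<in> sphere c R" for z
  proof -
    define u v where "u = z - c" and "v = a - c"
    have nu: "norm u = R" using that by (simp add: u_def dist_norm norm_minus_commute)
    then have uu: "u * cnj u = of_real (R\<^sup>2)" by (metis complex_norm_square)
    have "f z = cnj (u - v) * u / of_real R"
      using R uu by (simp add: f_def u_def v_def field_simps power2_eq_square)
    then have "norm (f z) = norm (u - v)"
      using R nu by (simp add: norm_divide norm_mult del: complex_cnj_diff)
    then show ?thesis by (simp add: u_def v_def)
  qed
  then have "cmean c R (\<lambda>z. ln (norm (f z))) = cmean c R (\<lambda>z. ln (norm (z - a)))"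
    using R by (intro cmean_cong) auto
  ultimately show ?thesis using R by (simp add: f_def)
qed

lemma cmean_ln_diff_ge:
  assumes "R > 0" "a \<notin> sphere c R" "a \<noteq> c"
  shows "ln (norm (c - a)) \<le> cmean c R (\<lambda>z. ln (norm (z - a)))"
proof (cases "a \<in> ball c R")
  case True
  then show ?thesis using assms cmean_ln_diff_inside[OF True] by (simp add: dist_norm)
next
  case False
  then have "R < dist c a" using assms by auto
  moreover have "(\<lambda>z. z - a) holomorphic_on ball c (dist c a)" by (intro holomorphic_intros)
  moreover have "z - a \<noteq> 0" if "z \<in> ball c (dist c a)" for z using that by auto
  ultimately have "cmean c R (\<lambda>z. ln (norm (z - a))) = ln (norm (c - a))"
    using assms(1) by (intro cmean_ln_nonvanishing)
  then show ?thesis by simp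
qed

lemma ln_norm_prod_list:
  assumes "z \<notin> set zs"
  shows "ln (norm (\<Prod>a\<leftarrow>zs. z - a)) = (\<Sum>a\<leftarrow>zs. ln (norm (z - a)))"
    and "(\<Prod>a\<leftarrow>zs. z - a) \<noteq> (0::complex)"
  using assms by (induction zs) (auto simp: norm_mult ln_mult)

lemma continuous_on_ln_norm [continuous_intros]:
  assumes "continuous_on S f" "\<And>z. z \<in> S \<Longrightarrow> f z \<noteq> 0"
  shows "continuous_on S (\<lambda>z. ln (norm (f z)))"
  using assms by (intro continuous_intros) auto

text \<open>Dividing out the zeros leaves a zero-free factor with the mean value property, and the
  mean over each removed factor is at least its value at the centre. Zeros on the circle are
  excluded to keep the integrand continuous; later radii are chosen off a countable set.\<close>

theorem jensen_inequality:
  assumes A: "A holomorphic_on UNIV" "A c \<noteq> 0" and R: "R > 0"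
    and nz: "\<And>z. z \<in> sphere c R \<Longrightarrow> A z \<noteq> 0"
  shows "ln (norm (A c)) \<le> cmean c R (\<lambda>z. ln (norm (A z)))"
proof -
  \<comment> \<open>The extra unit makes \<open>E\<close> zero-free on an open disc around the
    closed disc of radius \<open>R\<close>, as \<open>cmean_ln_nonvanishing\<close>
    requires.\<close>
  define Z where "Z = {z \<in> cball c (R + 1). A z = 0}"
  have "finite Z" unfolding Z_def using A by (intro finite_zeros_cball) auto
  from factor_zeros[OF this A(1)] obtain zs E where
    E: "E holomorphic_on UNIV" "\<And>z. z \<in> Z \<Longrightarrow> E z \<noteq> 0" "set zs \<subseteq> Z"
      "\<And>z. A z = (\<Prod>a\<leftarrow>zs. z - a) * E z" using A(2) by metis
  have Ene: "E z \<noteq> 0" if "z \<in> cball c (R + 1)" for z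
    using E(2)[of z] E(4)[of z] that by (auto simp: Z_def)
  have zs: "a \<notin> sphere c R" "a \<noteq> c" if "a \<in> set zs" for a
    using that E(3) nz A(2) by (auto simp: Z_def)
  have cont: "continuous_on (sphere c R) (\<lambda>z. ln (norm (z - a)))" if "a \<in> set zs" for a
    using zs[OF that] by (intro continuous_intros) auto
  have lnA: "ln (norm (A z)) = (\<Sum>a\<leftarrow>zs. ln (norm (z - a))) + ln (norm (E z))"
    if "z \<notin> set zs" "E z \<noteq> 0" for z
    using that ln_norm_prod_list[OF that(1)] by (simp add: E(4) norm_mult ln_mult)
  have "ln (norm (A c)) = (\<Sum>a\<leftarrow>zs. ln (norm (c - a))) + ln (norm (E c))"
    using zs R by (intro lnA) (auto intro!: Ene)
  also have "\<dots> \<le> (\<Sum>a\<leftarrow>zs. cmean c R (\<lambda>z. ln (norm (z - a)))) + cmean c R (\<lambda>z. ln (norm (E z)))"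
  proof (rule add_mono)
    show "(\<Sum>a\<leftarrow>zs. ln (norm (c - a))) \<le> (\<Sum>a\<leftarrow>zs. cmean c R (\<lambda>z. ln (norm (z - a))))"
      using zs R by (intro sum_list_mono cmean_ln_diff_ge) auto
    show "ln (norm (E c)) \<le> cmean c R (\<lambda>z. ln (norm (E z)))"
      using cmean_ln_nonvanishing[OF holomorphic_on_subset[OF E(1)], of c "R + 1" R] R Ene by simp
  qed
  also have "\<dots> = cmean c R (\<lambda>z. (\<Sum>a\<leftarrow>zs. ln (norm (z - a))) + ln (norm (E z)))"
  proof -
    have "continuous_on (sphere c R) (\<lambda>z. \<Sum>a\<leftarrow>zs. ln (norm (z - a)))"
      using cont by (induction zs) (auto intro!: continuous_on_add)
    moreover have "continuous_on (sphere c R) (\<lambda>z. ln (norm (E z)))"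
      using E(1) Ene by (intro continuous_intros)
        (auto intro: holomorphic_on_imp_continuous_on holomorphic_on_subset)
    ultimately show ?thesis
      using R cont by (subst cmean_add) (auto simp: cmean_sum_list)
  qed
  also have "\<dots> = cmean c R (\<lambda>z. ln (norm (A z)))"
    using R zs Ene by (intro cmean_cong lnA[symmetric]) auto
  finally show ?thesis .
qed

text \<open>A zero within distance \<open>R0\<close> contributes at most \<open>ln R0\<close> at the
  centre but exactly \<open>ln R\<close> to the mean, hence a surplus of at least
  \<open>ln (R / R0)\<close> per zero.\<close>

theorem jensen_zero_count:
  assumes A: "\<And>z. A z = (\<Prod>a\<leftarrow>zs. z - a) * E z" and E: "E holomorphic_on UNIV" "A c \<noteq> 0"
    and zs: "set zs \<subseteq> ball c R0" and R: "0 < R0" "R0 \<le> R"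
    and nz: "\<And>z. z \<in> sphere c R \<Longrightarrow> A z \<noteq> 0"
  shows "real (length zs) * ln (R / R0) + ln (norm (A c)) \<le> cmean c R (\<lambda>z. ln (norm (A z)))"
proof -
  have zs': "a \<in> ball c R" "a \<noteq> c" if "a \<in> set zs" for a
    using that zs R A[of c] E(2) by (auto simp: prod_list_zero_iff subset_iff)
  have Ene: "E z \<noteq> 0" if "z \<in> sphere c R \<or> z = c" for z
    using that nz[of z] E(2) A[of z] by auto
  have notin: "z \<notin> set zs" if "z \<in> sphere c R \<or> z = c" for z
    using zs' that by auto
  have lnA: "ln (norm (A z)) = (\<Sum>a\<leftarrow>zs. ln (norm (z - a))) + ln (norm (E z))"
    if "z \<in> sphere c R \<or> z = c" for z
    using Ene[OF that] ln_norm_prod_list[OF notin[OF that]] by (simp add: A norm_mult ln_mult)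
  have cont: "continuous_on (sphere c R) (\<lambda>z. ln (norm (z - a)))" if "a \<in> set zs" for a
    using zs'[OF that] by (intro continuous_intros) auto
  have "(\<Sum>a\<leftarrow>zs. ln (norm (c - a))) \<le> (\<Sum>a\<leftarrow>zs. ln R0)"
  proof (intro sum_list_mono)
    fix a assume "a \<in> set zs"
    then have "norm (c - a) > 0" "norm (c - a) \<le> R0"
      using zs'[of a] zs by (auto simp: dist_norm subset_iff less_imp_le)
    then show "ln (norm (c - a)) \<le> ln R0" using ln_mono by blast
  qed
  then have "real (length zs) * ln (R / R0) + ln (norm (A c)) \<le>
      (\<Sum>a\<leftarrow>zs. ln R) + ln (norm (E c))"
    using R by (simp add: lnA ln_div sum_list_triv algebra_simps)
  also have "(\<Sum>a\<leftarrow>zs. ln R) = (\<Sum>a\<leftarrow>zs. cmean c R (\<lambda>z. ln (norm (z - a))))"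
    using zs' by (intro arg_cong[where f = sum_list] map_cong) (auto simp: cmean_ln_diff_inside)
  also have "ln (norm (E c)) \<le> cmean c R (\<lambda>z. ln (norm (E z)))"
    using E(1) R Ene by (intro jensen_inequality) auto
  also have "(\<Sum>a\<leftarrow>zs. cmean c R (\<lambda>z. ln (norm (z - a)))) + cmean c R (\<lambda>z. ln (norm (E z)))
      = cmean c R (\<lambda>z. (\<Sum>a\<leftarrow>zs. ln (norm (z - a))) + ln (norm (E z)))"
  proof -
    have "continuous_on (sphere c R) (\<lambda>z. \<Sum>a\<leftarrow>zs. ln (norm (z - a)))"
      using cont by (induction zs) (auto intro!: continuous_on_add)
    moreover have "continuous_on (sphere c R) (\<lambda>z. ln (norm (E z)))"
      using E(1) Ene by (intro continuous_intros)
        (auto intro: holomorphic_on_imp_continuous_on holomorphic_on_subset)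
    ultimately show ?thesis
      using R cont by (subst cmean_add) (auto simp: cmean_sum_list)
  qed
  also have "\<dots> = cmean c R (\<lambda>z. ln (norm (A z)))"
    using R by (intro cmean_cong) (auto simp: lnA)
  finally show ?thesis by simp
qed

section \<open>Pointwise bounds for logarithmic derivatives\<close>

lemma has_field_derivative_prod_list_diff:
  assumes "w \<notin> set zs"
  shows "((\<lambda>z. \<Prod>a\<leftarrow>zs. z - a) has_field_derivative
    (\<Prod>a\<leftarrow>zs. w - a) * (\<Sum>a\<leftarrow>zs. 1 / (w - a))) (at w :: complex filter)"
  using assms
proof (induction zs)
  case (Cons b zs)
  have "((\<lambda>z. (z - b) * (\<Prod>a\<leftarrow>zs. z - a)) has_field_derivative
      (1 - 0) * (\<Prod>a\<leftarrow>zs. w - a) + (\<Prod>a\<leftarrow>zs. w - a) * (\<Sum>a\<leftarrow>zs. 1 / (w - a)) * (w - b)) (at w)"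
    using Cons by (intro DERIV_mult derivative_intros) auto
  moreover have "(1 - 0) * (\<Prod>a\<leftarrow>zs. w - a) + (\<Prod>a\<leftarrow>zs. w - a) * (\<Sum>a\<leftarrow>zs. 1 / (w - a)) * (w - b)
      = (\<Prod>a\<leftarrow>b # zs. w - a) * (\<Sum>a\<leftarrow>b # zs. 1 / (w - a))"
    using Cons.prems by (simp add: field_simps)
  ultimately show ?case by simp
qed auto

lemma has_field_derivative_sum_list_inverse:
  assumes "w \<notin> set zs"
  shows "((\<lambda>z. \<Sum>a\<leftarrow>zs. 1 / (z - a)) has_field_derivative
    - (\<Sum>a\<leftarrow>zs. 1 / (w - a)\<^sup>2)) (at w :: complex filter)"
  using assms
proof (induction zs)
  case (Cons b zs)
  have "((\<lambda>z. 1 / (z - b)) has_field_derivative - (1 / (w - b)\<^sup>2)) (at w)"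
    using Cons.prems by (auto intro!: derivative_eq_intros simp: power2_eq_square)
  then have "((\<lambda>z. 1 / (z - b) + (\<Sum>a\<leftarrow>zs. 1 / (z - a))) has_field_derivative
      - (1 / (w - b)\<^sup>2) + - (\<Sum>a\<leftarrow>zs. 1 / (w - a)\<^sup>2)) (at w)"
    using Cons by (intro DERIV_add) auto
  then show ?case by simp
qed auto

lemma norm_sum_list_le:
  assumes "\<And>a. a \<in> set zs \<Longrightarrow> norm (g a) \<le> C"
  shows "norm (\<Sum>a\<leftarrow>zs. g a) \<le> real (length zs) * C"
  using assms
proof (induction zs)
  case (Cons b zs)
  have "norm (\<Sum>a\<leftarrow>b # zs. g a) \<le> norm (g b) + norm (\<Sum>a\<leftarrow>zs. g a)"
    by (simp add: norm_triangle_ineq)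
  also have "\<dots> \<le> C + real (length zs) * C" using Cons by (intro add_mono) auto
  finally show ?case by (simp add: algebra_simps)
qed auto

text \<open>After division by the zeros the quotient is \<open>exp \<circ> \<phi>\<close> on the disc. The mean of \<open>\<bar>Re \<phi>\<bar>\<close> over the
  circle of radius \<open>R\<close> controls \<open>\<phi>'\<close> and \<open>\<phi>''\<close> on the circle of radius \<open>r\<close>; the zeros keep the
  distance \<open>\<delta>\<close> from both circles.\<close>
lemma log_derivative_bound:
  fixes A B :: "complex \<Rightarrow> complex"
  defines "h \<equiv> \<lambda>z. A z / B z"
  assumes A: "\<And>z. A z = (\<Prod>a\<leftarrow>zsA. z - a) * EA z" "EA holomorphic_on UNIV"
      "\<And>z. z \<in> ball c R' \<Longrightarrow> EA z \<noteq> 0"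
    and B: "\<And>z. B z = (\<Prod>a\<leftarrow>zsB. z - a) * EB z" "EB holomorphic_on UNIV"
      "\<And>z. z \<in> ball c R' \<Longrightarrow> EB z \<noteq> 0"
    and r: "0 < r" "r < R" "R < R'"
    and \<delta>: "0 < \<delta>" "\<delta> \<le> R"
      "\<And>a. a \<in> set zsA \<union> set zsB \<Longrightarrow> dist c a \<le> 2 * R \<and> \<delta> \<le> \<bar>dist c a - r\<bar> \<and> \<delta> \<le> \<bar>dist c a - R\<bar>"
    and M: "cmean c R (\<lambda>z. \<bar>ln (norm (A z)) - ln (norm (B z))\<bar>) \<le> M"
    and N: "real (length zsA + length zsB) \<le> N"
    and z: "dist c z = r"
    and K1: "K1 = 8 * R / (R - r)\<^sup>2 * (M + N * (3 * R / \<delta>))"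
    and K: "K = K1 + N / \<delta>"
    and L: "L = 2 * K1 / (R - r) + N / \<delta>\<^sup>2"
  shows "A z \<noteq> 0" "B z \<noteq> 0" "norm (deriv h z) \<le> K * norm (h z)"
    "norm (deriv (deriv h) z) \<le> (L + K\<^sup>2) * norm (h z)"
proof -
  have cA: "continuous_on X EA" and cB: "continuous_on X EB" for X
    using A(2) B(2) holomorphic_on_imp_continuous_on continuous_on_subset by blast+
  have far: "\<delta> \<le> norm (w - a)" if "a \<in> set zsA \<union> set zsB" "dist c w = r \<or> dist c w = R" for a w
  proof -
    have "\<bar>dist c a - dist c w\<bar> \<le> dist a w" by (metis abs_dist_diff_le dist_commute)
    then show ?thesis using \<delta>(3)[OF that(1)] that(2) by (auto simp: dist_norm norm_minus_commute)
  qed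
  have notin: "w \<notin> set zsA \<union> set zsB" if "dist c w = r \<or> dist c w = R" for w
    using far[of w w] that \<delta>(1) by auto
  have lnp: "ln (norm (\<Prod>a\<leftarrow>zs. w - a)) = (\<Sum>a\<leftarrow>zs. ln (norm (w - a)))"
    "(\<Prod>a\<leftarrow>zs. w - a) \<noteq> 0"
    if "dist c w = r \<or> dist c w = R" "zs = zsA \<or> zs = zsB" for w zs
    using ln_norm_prod_list[of w zs] notin[OF that(1)] that(2) by auto
  have nz: "A w \<noteq> 0" "B w \<noteq> 0" if "dist c w = r \<or> dist c w = R" for w
    using A(1,3)[of w] B(1,3)[of w] lnp(2)[OF that] that r by auto
  show "A z \<noteq> 0" "B z \<noteq> 0" using nz z by auto
  have "(\<lambda>z. EA z / EB z) holomorphic_on ball c R'"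
    using A B by (intro holomorphic_intros) (auto intro: holomorphic_on_subset)
  moreover have "EA z / EB z \<noteq> 0" if "z \<in> ball c R'" for z
    using A(3)[OF that] B(3)[OF that] by simp
  ultimately have "\<exists>g. g holomorphic_on ball c R' \<and> (\<forall>z\<in>ball c R'. EA z / EB z = exp (g z))"
    by (rule holomorphic_log_ball)
  then obtain \<phi> where
    \<phi>: "\<phi> holomorphic_on ball c R'" "\<And>z. z \<in> ball c R' \<Longrightarrow> EA z / EB z = exp (\<phi> z)"
    by blast
  \<comment> \<open>Adding this constant leaves the derivative of \<open>\<phi>\<close> unchanged
    but lets every \<open>ln (norm (w - a))\<close> be compared with \<open>ln R\<close>, so that
    the error per zero depends only on the ratio of \<open>R\<close> and
    \<open>\<delta>\<close>.\<close>
  define \<kappa> where "\<kappa> = (real (length zsA) - real (length zsB)) * ln R"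
  have sub: "cball c R \<subseteq> ball c R'" "sphere c R \<subseteq> ball c R'" using r by auto
  have hol\<psi>: "(\<lambda>w. \<phi> w + of_real \<kappa>) holomorphic_on cball c R"
    using \<phi>(1) sub by (intro holomorphic_intros) (auto intro: holomorphic_on_subset)
  have Re\<psi>: "\<bar>Re (\<phi> w + of_real \<kappa>)\<bar> \<le> \<bar>ln (norm (A w)) - ln (norm (B w))\<bar> + N * (3 * R / \<delta>)"
    if w: "w \<in> sphere c R" for w
  proof -
    have wR: "dist c w = R" using w by simp
    have wb: "w \<in> ball c R'" using w r by auto
    have one: "\<bar>ln (norm (w - a)) - ln R\<bar> \<le> 3 * R / \<delta>" if a: "a \<in> set zsA \<union> set zsB" for a
    proof -
      have 1: "\<delta> \<le> norm (w - a)" using far[OF a] wR by auto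
      have "dist w a \<le> dist c w + dist c a" by (metis dist_commute dist_triangle)
      then have 2: "norm (w - a) \<le> 3 * R" using \<delta>(3)[OF a] wR by (simp add: dist_norm)
      have pos: "norm (w - a) > 0" "R > 0" using 1 \<delta>(1) r by linarith+
      have "ln (norm (w - a)) - ln R = ln (norm (w - a) / R)" using pos by (simp add: ln_div)
      also have "\<dots> \<le> norm (w - a) / R" using pos by (intro ln_bound) auto
      also have "\<dots> \<le> 3" using 2 pos by (simp add: field_simps)
      also have "\<dots> \<le> 3 * R / \<delta>" using \<delta> by (simp add: field_simps)
      finally have u: "ln (norm (w - a)) - ln R \<le> 3 * R / \<delta>" .
      have "ln R - ln (norm (w - a)) = ln (R / norm (w - a))" using pos by (simp add: ln_div)
      also have "\<dots> \<le> R / norm (w - a)" using pos by (intro ln_bound) auto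
      also have "\<dots> \<le> R / \<delta>" using 1 \<delta> pos by (intro divide_left_mono) auto
      also have "\<dots> \<le> 3 * R / \<delta>" using \<delta> pos by (intro divide_right_mono) auto
      finally show ?thesis using u by linarith
    qed
    define SA SB where "SA = (\<Sum>a\<leftarrow>zsA. ln (norm (w - a)) - ln R)"
      and "SB = (\<Sum>a\<leftarrow>zsB. ln (norm (w - a)) - ln R)"
    have "\<bar>SA\<bar> \<le> real (length zsA) * (3 * R / \<delta>)" "\<bar>SB\<bar> \<le> real (length zsB) * (3 * R / \<delta>)"
      unfolding SA_def SB_def real_norm_def[symmetric]
      using one by (intro norm_sum_list_le; auto)+
    then have "\<bar>SA\<bar> + \<bar>SB\<bar> \<le> real (length zsA + length zsB) * (3 * R / \<delta>)"
      unfolding of_nat_add distrib_right by linarith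
    also have "\<dots> \<le> N * (3 * R / \<delta>)" using N \<delta> r by (intro mult_right_mono) auto
    finally have S: "\<bar>SA\<bar> + \<bar>SB\<bar> \<le> N * (3 * R / \<delta>)" .
    have E: "EA w \<noteq> 0" "EB w \<noteq> 0" using A(3) B(3) wb by auto
    have "exp (Re (\<phi> w)) = norm (EA w / EB w)" using \<phi>(2)[OF wb] by simp
    then have "Re (\<phi> w) = ln (norm (EA w / EB w))" by (metis ln_exp)
    also have "\<dots> = ln (norm (EA w)) - ln (norm (EB w))"
      using E by (simp add: norm_divide ln_div)
    finally have Re: "Re (\<phi> w) = ln (norm (EA w)) - ln (norm (EB w))" .
    have "ln (norm (A w)) = (\<Sum>a\<leftarrow>zsA. ln (norm (w - a))) + ln (norm (EA w))"
      "ln (norm (B w)) = (\<Sum>a\<leftarrow>zsB. ln (norm (w - a))) + ln (norm (EB w))"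
      using E lnp[of w] wR by (simp_all add: A(1) B(1) norm_mult ln_mult)
    then have "Re (\<phi> w + of_real \<kappa>) = (ln (norm (A w)) - ln (norm (B w))) - SA + SB"
      using Re by (simp add: SA_def SB_def \<kappa>_def sum_list_subtractf sum_list_triv algebra_simps)
    then show ?thesis using S by linarith
  qed
  have lnc: "continuous_on (sphere c R) (\<lambda>w. \<bar>ln (norm (A w)) - ln (norm (B w))\<bar>)"
  proof -
    have "continuous_on (sphere c R) A" "continuous_on (sphere c R) B"
      unfolding A(1)[abs_def] B(1)[abs_def]
      using has_field_derivative_prod_list_diff notin
      by (intro continuous_on_mult cA cB continuous_at_imp_continuous_on ballI;
          metis DERIV_isCont Un_iff mem_sphere)+
    then show ?thesis using nz by (intro continuous_intros) auto
  qed
  have "cmean c R (\<lambda>w. \<bar>Re (\<phi> w + of_real \<kappa>)\<bar>) \<le>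
      cmean c R (\<lambda>w. \<bar>ln (norm (A w)) - ln (norm (B w))\<bar> + N * (3 * R / \<delta>))"
  proof (rule cmean_mono)
    show "continuous_on (sphere c R) (\<lambda>w. \<bar>Re (\<phi> w + of_real \<kappa>)\<bar>)"
      by (intro continuous_on_rabs continuous_on_Re
          continuous_on_subset[OF holomorphic_on_imp_continuous_on[OF hol\<psi>]]) auto
    show "continuous_on (sphere c R)
        (\<lambda>w. \<bar>ln (norm (A w)) - ln (norm (B w))\<bar> + N * (3 * R / \<delta>))"
      by (intro continuous_on_add lnc continuous_on_const)
  qed (use r Re\<psi> in auto)
  also have "\<dots> = cmean c R (\<lambda>w. \<bar>ln (norm (A w)) - ln (norm (B w))\<bar>) + N * (3 * R / \<delta>)"
    using r lnc by (subst cmean_add) auto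
  also have "\<dots> \<le> M + N * (3 * R / \<delta>)" using M by simp
  finally have mean: "cmean c R (\<lambda>w. \<bar>Re (\<phi> w + of_real \<kappa>)\<bar>) \<le> M + N * (3 * R / \<delta>)" .
  \<comment> \<open>The first derivative is bounded beyond \<open>r\<close>, up to the midway
    radius, so that Cauchy's inequality on the disc of radius \<open>(R - r) / 2\<close> about
    \<open>z\<close> bounds the second.\<close>
  have deriv\<phi>: "norm (deriv \<phi> w) \<le> K1" if w: "dist c w \<le> (r + R) / 2" for w
  proof -
    have wb: "w \<in> ball c R'" using w r by auto
    have "deriv (\<lambda>w. \<phi> w + of_real \<kappa>) w = deriv \<phi> w"
      using \<phi>(1) wb holomorphic_on_imp_differentiable_at by (subst deriv_add) auto
    then have "norm (deriv \<phi> w) \<le> 2 * R / (R - (r + R) / 2)\<^sup>2 *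
        cmean c R (\<lambda>w. \<bar>Re (\<phi> w + of_real \<kappa>)\<bar>)"
      using norm_deriv_le_cmean_Re[OF hol\<psi> w] r by simp
    also have "\<dots> \<le> 2 * R / (R - (r + R) / 2)\<^sup>2 * (M + N * (3 * R / \<delta>))"
      using mean r by (intro mult_left_mono) auto
    also have "2 * R / (R - (r + R) / 2)\<^sup>2 = 8 * R / (R - r)\<^sup>2"
    proof -
      have "R - (r + R) / 2 = (R - r) / 2" by argo
      then show ?thesis by (simp only: power_divide) simp
    qed
    finally show ?thesis by (simp add: K1)
  qed
  define \<eta> where "\<eta> = (R - r) / 2"
  have \<eta>: "\<eta> > 0" using r by (simp add: \<eta>_def)
  have hd: "deriv \<phi> holomorphic_on ball c R'" using \<phi>(1) by (intro holomorphic_deriv) auto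
  have zsub: "cball z \<eta> \<subseteq> ball c R'"
  proof
    fix w assume "w \<in> cball z \<eta>"
    then have "dist c w \<le> r + \<eta>" using z dist_triangle[of c w z] by simp
    then show "w \<in> ball c R'" using r by (simp add: \<eta>_def field_simps)
  qed
  have deriv2\<phi>: "norm (deriv (deriv \<phi>) z) \<le> 2 * K1 / (R - r)"
  proof -
    have "norm ((deriv ^^ 1) (deriv \<phi>) z) \<le> fact 1 * K1 / \<eta> ^ 1"
    proof (rule Cauchy_inequality)
      show "deriv \<phi> holomorphic_on ball z \<eta>" "continuous_on (cball z \<eta>) (deriv \<phi>)"
        using hd zsub ball_subset_cball
        by (blast intro: holomorphic_on_subset holomorphic_on_imp_continuous_on)+
      fix w assume "norm (z - w) = \<eta>"
      then have "dist c w \<le> r + \<eta>" using z dist_triangle[of c w z] by (simp add: dist_norm)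
      then show "norm (deriv \<phi> w) \<le> K1" by (intro deriv\<phi>) (simp add: \<eta>_def field_simps)
    qed (rule \<eta>)
    then show ?thesis by (simp add: \<eta>_def mult.commute)
  qed
  define lg where "lg = (\<lambda>w. (\<Sum>a\<leftarrow>zsA. 1 / (w - a)) - (\<Sum>a\<leftarrow>zsB. 1 / (w - a)) + deriv \<phi> w)"
  define U where "U = ball c R' - (set zsA \<union> set zsB)"
  have U: "open U" "z \<in> U"
    unfolding U_def using notin[of z] z r by (auto intro!: open_Diff finite_imp_closed)
  have h: "(h has_field_derivative lg w * h w) (at w)" if w: "w \<in> U" for w
  proof -
    define pA pB where "pA = (\<lambda>w. \<Prod>a\<leftarrow>zsA. w - a)" and "pB = (\<lambda>w. \<Prod>a\<leftarrow>zsB. w - a)"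
    have pB: "pB w \<noteq> 0" using ln_norm_prod_list(2)[of w zsB] w by (simp add: U_def pB_def)
    have "(\<phi> has_field_derivative deriv \<phi> w) (at w)"
      using \<phi>(1) w by (intro holomorphic_derivI[where S = "ball c R'"]) (auto simp: U_def)
    then have "((\<lambda>w. pA w / pB w * exp (\<phi> w)) has_field_derivative
       (pA w * (\<Sum>a\<leftarrow>zsA. 1 / (w - a)) * pB w - pA w * (pB w * (\<Sum>a\<leftarrow>zsB. 1 / (w - a)))) / (pB w * pB w) * exp (\<phi> w)
         + exp (\<phi> w) * deriv \<phi> w * (pA w / pB w)) (at w)"
      using w pB has_field_derivative_prod_list_diff[of w]
      unfolding pA_def pB_def U_def
      by (intro DERIV_mult DERIV_divide DERIV_fun_exp) auto
    moreover have "(pA w * (\<Sum>a\<leftarrow>zsA. 1 / (w - a)) * pB w - pA w * (pB w * (\<Sum>a\<leftarrow>zsB. 1 / (w - a)))) / (pB w * pB w) * exp (\<phi> w)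
         + exp (\<phi> w) * deriv \<phi> w * (pA w / pB w) = lg w * (pA w / pB w * exp (\<phi> w))"
      using pB by (simp add: lg_def field_simps)
    moreover have heq: "pA w / pB w * exp (\<phi> w) = h w" if "w \<in> U" for w
      using \<phi>(2)[of w] that by (simp add: h_def A(1) B(1) pA_def pB_def U_def field_simps flip: \<phi>(2))
    ultimately have "((\<lambda>w. pA w / pB w * exp (\<phi> w)) has_field_derivative lg w * h w) (at w)"
      unfolding heq[OF w] by (simp only:)
    then show ?thesis
      by (rule has_field_derivative_transform_within_open[OF _ U(1) w]) (rule heq)
  qed
  have "deriv h z = lg z * h z" using h[OF U(2)] by (rule DERIV_imp_deriv)
  have inv: "norm (1 / (z - a)) \<le> 1 / \<delta>" "norm (1 / (z - a)\<^sup>2) \<le> 1 / \<delta>\<^sup>2"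
    if "a \<in> set zsA \<union> set zsB" for a
  proof -
    have "\<delta> \<le> norm (z - a)" using far that z by auto
    then show "norm (1 / (z - a)) \<le> 1 / \<delta>" "norm (1 / (z - a)\<^sup>2) \<le> 1 / \<delta>\<^sup>2"
      using \<delta>(1) by (auto simp: norm_divide norm_power intro!: divide_left_mono power_mono mult_pos_pos)
  qed
  have two: "norm (\<Sum>a\<leftarrow>zsA. g a) + norm (\<Sum>a\<leftarrow>zsB. g a) \<le> N * C"
    if "\<And>a. a \<in> set zsA \<union> set zsB \<Longrightarrow> norm (g a) \<le> C" "C \<ge> 0" for g :: "complex \<Rightarrow> complex" and C
  proof -
    have "norm (\<Sum>a\<leftarrow>zsA. g a) + norm (\<Sum>a\<leftarrow>zsB. g a) \<le> real (length zsA) * C + real (length zsB) * C"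
      using that(1) by (intro add_mono norm_sum_list_le) auto
    also have "\<dots> = real (length zsA + length zsB) * C" by (simp add: distrib_right)
    also have "\<dots> \<le> N * C" using N that(2) by (intro mult_right_mono)
    finally show ?thesis .
  qed
  have lgK: "norm (lg z) \<le> K"
  proof -
    have "norm (lg z) \<le> (norm (\<Sum>a\<leftarrow>zsA. 1 / (z - a)) + norm (\<Sum>a\<leftarrow>zsB. 1 / (z - a))) + norm (deriv \<phi> z)"
      unfolding lg_def by (meson add_mono norm_triangle_ineq norm_triangle_ineq4 order_refl order_trans)
    also have "\<dots> \<le> N * (1 / \<delta>) + K1"
      using inv z r \<delta> by (intro add_mono two deriv\<phi>) auto
    finally show ?thesis by (simp add: K)
  qed
  show "norm (deriv h z) \<le> K * norm (h z)"
    using \<open>deriv h z = lg z * h z\<close> lgK by (simp add: norm_mult mult_right_mono)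
  define lg' where "lg' = - (\<Sum>a\<leftarrow>zsA. 1 / (z - a)\<^sup>2) - - (\<Sum>a\<leftarrow>zsB. 1 / (z - a)\<^sup>2) + deriv (deriv \<phi>) z"
  have "(deriv \<phi> has_field_derivative deriv (deriv \<phi>) z) (at z)"
    using hd U(2) by (intro holomorphic_derivI[where S = "ball c R'"]) (auto simp: U_def)
  then have "(lg has_field_derivative lg') (at z)"
    unfolding lg_def lg'_def using U(2)
    by (intro DERIV_add DERIV_diff has_field_derivative_sum_list_inverse) (auto simp: U_def)
  then have "((\<lambda>w. lg w * h w) has_field_derivative lg' * h z + lg z * h z * lg z) (at z)"
    by (intro DERIV_mult h U)
  then have "(deriv h has_field_derivative lg' * h z + lg z * h z * lg z) (at z)"
    by (rule has_field_derivative_transform_within_open[OF _ U]) (rule DERIV_imp_deriv[OF h, symmetric])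
  then have "deriv (deriv h) z = (lg' + (lg z)\<^sup>2) * h z"
    by (simp add: DERIV_imp_deriv power2_eq_square algebra_simps)
  moreover have "norm lg' \<le> L"
  proof -
    have "norm (- x - - y + w) \<le> norm x + norm y + norm w" for x y w :: complex
      using norm_triangle_ineq[of "- x - - y" w] norm_triangle_ineq4[of "- x" "- y"] by simp
    then have "norm lg' \<le> (norm (\<Sum>a\<leftarrow>zsA. 1 / (z - a)\<^sup>2) + norm (\<Sum>a\<leftarrow>zsB. 1 / (z - a)\<^sup>2)) + norm (deriv (deriv \<phi>) z)"
      unfolding lg'_def .
    also have "\<dots> \<le> N * (1 / \<delta>\<^sup>2) + 2 * K1 / (R - r)"
      using inv deriv2\<phi> \<delta> by (intro add_mono two) auto
    finally show ?thesis by (simp add: L)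
  qed
  then have "norm (lg' + (lg z)\<^sup>2) \<le> L + K\<^sup>2"
    using lgK by (intro norm_triangle_le add_mono) (auto simp: norm_power intro!: power_mono)
  ultimately show "norm (deriv (deriv h) z) \<le> (L + K\<^sup>2) * norm (h z)"
    by (simp add: norm_mult mult_right_mono)
qed

text \<open>Pigeonhole: \<open>N + 1\<close> equally spaced centres cannot all have a point of
  \<open>Z\<close> within half the spacing \<open>h\<close>. Moving a free centre by less than
  \<open>h / 4\<close> avoids the countable set and keeps half of the clearance.\<close>

lemma select_far_point:
  fixes a b :: real and Z C :: "real set"
  assumes "finite Z" "card Z \<le> N" "a < b" "countable C"
  obtains \<rho> where "a < \<rho>" "\<rho> < b" "\<rho> \<notin> C" "\<And>m. m \<in> Z \<Longrightarrow> (b - a) / (4 * (real N + 1)) \<le> \<bar>m - \<rho>\<bar>"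
proof -
  define h where "h = (b - a) / (real N + 1)"
  have h: "h > 0" using assms(3) by (simp add: h_def)
  define p where "p = (\<lambda>i. a + h * (real i + 1/2))"
  have "\<exists>i\<in>{..N}. \<forall>m\<in>Z. h / 2 \<le> \<bar>m - p i\<bar>"
  proof (rule ccontr)
    assume "\<not> ?thesis"
    then have "\<forall>i\<in>{..N}. \<exists>m\<in>Z. \<bar>m - p i\<bar> < h / 2" by (force simp: not_le)
    then obtain m where m: "\<And>i. i \<le> N \<Longrightarrow> m i \<in> Z \<and> \<bar>m i - p i\<bar> < h / 2" by (metis atMost_iff)
    have "inj_on m {..N}"
    proof (rule inj_onI)
      fix i j assume ij: "i \<in> {..N}" "j \<in> {..N}" "m i = m j"
      then have "\<bar>p i - p j\<bar> < h" using m[of i] m[of j] by (simp add: abs_if split: if_splits)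
      then have "\<bar>h * (real i - real j)\<bar> < h" by (simp add: p_def algebra_simps)
      then have "\<bar>real i - real j\<bar> < 1" using h by (simp add: abs_mult)
      then show "i = j" by linarith
    qed
    then have "card {..N} \<le> card Z" using m assms(1) by (intro card_inj_on_le[of m]) auto
    then show False using assms(2) by simp
  qed
  then obtain i where i: "i \<le> N" "\<And>m. m \<in> Z \<Longrightarrow> h / 2 \<le> \<bar>m - p i\<bar>" by auto
  have hN: "h * (real N + 1) = b - a" by (simp add: h_def)
  have "h * (real i + 1) \<le> h * (real N + 1)" using h i by (intro mult_left_mono) auto
  then have pi: "a < p i" "p i + h / 2 \<le> b"
    using h hN by (auto simp: p_def algebra_simps intro: add_nonneg_pos)
  have "uncountable {p i<..<p i + h / 4}" using h by (simp add: uncountable_open_interval)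
  then obtain \<rho> where \<rho>: "\<rho> \<in> {p i<..<p i + h / 4}" "\<rho> \<notin> C"
    using assms(4) countable_subset by (metis subsetI)
  show thesis
  proof (rule that[of \<rho>])
    show "(b - a) / (4 * (real N + 1)) \<le> \<bar>m - \<rho>\<bar>" if "m \<in> Z" for m
    proof -
      have "(b - a) / (4 * (real N + 1)) = h / 4" by (simp add: h_def)
      also have "\<dots> \<le> \<bar>m - \<rho>\<bar>" using i(2)[OF that] \<rho> by (simp add: abs_if split: if_splits)
      finally show ?thesis .
    qed
  qed (use \<rho> pi h in auto)
qed

section \<open>Monotonicity of the characteristic in the radius\<close>

lemma integral_periodic_shift:
  fixes g :: "real \<Rightarrow> real"
  assumes g: "continuous_on UNIV g" "\<And>t. g (t + 1) = g t" and \<tau>: "0 \<le> \<tau>" "\<tau> \<le> 1"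
  shows "integral {0..1} (\<lambda>t. g (t + \<tau>)) = integral {0..1} g"
proof -
  have int: "g integrable_on {p..q}" for p q
    using g(1) by (intro integrable_continuous_real) (auto intro: continuous_on_subset)
  have sh: "integral {p..q} (\<lambda>t. g (t + m)) = integral {p + m..q + m} g" for p q m
    using integral_shift[of p m q g] g(1) continuous_on_subset by (fastforce simp: o_def)
  have "integral {0..1} (\<lambda>t. g (t + \<tau>)) = integral {\<tau>..1 + \<tau>} g" using sh[of 0 1 \<tau>] by simp
  also have "\<dots> = integral {\<tau>..1} g + integral {1..1 + \<tau>} g"
    using \<tau> int by (intro Henstock_Kurzweil_Integration.integral_combine[symmetric]) auto
  also have "integral {1..1 + \<tau>} g = integral {0..\<tau>} (\<lambda>t. g (t + 1))"
    using sh[of 0 \<tau> 1] by (simp add: add.commute)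
  also have "\<dots> = integral {0..\<tau>} g" by (simp add: g(2))
  also have "integral {\<tau>..1} g + integral {0..\<tau>} g = integral {0..1} g"
    using Henstock_Kurzweil_Integration.integral_combine[of 0 \<tau> 1 g] \<tau> int by simp
  finally show ?thesis .
qed

lemma integral_split_equal:
  fixes g :: "real \<Rightarrow> real" and N :: nat
  assumes g: "continuous_on UNIV g" and N: "N > 0"
  shows "integral {0..1} g = (\<Sum>k<N. integral {real k / real N..(real k + 1) / real N} g)"
proof -
  have int: "g integrable_on {p..q}" for p q
    using g by (intro integrable_continuous_real) (auto intro: continuous_on_subset)
  have "integral {0..real m / real N} g = (\<Sum>k<m. integral {real k / real N..(real k + 1) / real N} g)" for m
  proof (induction m)
    case (Suc m)
    have "integral {0..real m / real N} g + integral {real m / real N..real (Suc m) / real N} g =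
        integral {0..real (Suc m) / real N} g"
      using N int by (intro Henstock_Kurzweil_Integration.integral_combine) (auto intro: divide_right_mono)
    then show ?case using Suc by (simp add: add.commute)
  qed auto
  from this[of N] show ?thesis using N by simp
qed

text \<open>The point is uniformity in the starting point \<open>z\<close>: the maximum principle
  below supplies a starting point on the outer circle over which there is no control.\<close>

lemma uniform_Riemann_sum_circle:
  fixes u :: "complex \<Rightarrow> real"
  assumes u: "continuous_on (sphere c R) u" and R: "R > 0" and e: "e > 0"
  shows "\<exists>N>0. \<forall>N'\<ge>N. \<forall>z\<in>sphere c R.
    \<bar>(\<Sum>k<N'. u (c + (z - c) * cis (2 * pi * real k / real N'))) / real N' - cmean c R u\<bar> \<le> e"
proof -
  define g where "g = (\<lambda>t. u (circlepath c R t))"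
  have contg: "continuous_on UNIV g"
    unfolding g_def using R circlepath_in_sphere
    by (intro continuous_on_compose2[OF u] continuous_intros) (auto simp: less_imp_le)
  have per: "g (t + 1) = g t" for t
  proof -
    have "exp (2 * of_real pi * \<i> * of_real (t + 1)) = exp (2 * of_real pi * \<i> * of_real t)"
      unfolding of_real_add distrib_left exp_add by simp
    then show ?thesis by (simp only: g_def circlepath)
  qed
  have "uniformly_continuous_on {0..3} g"
    using contg by (intro compact_uniformly_continuous) (auto intro: continuous_on_subset)
  then obtain d where d: "d > 0" "\<And>s t. s \<in> {0..3} \<Longrightarrow> t \<in> {0..3} \<Longrightarrow> dist t s < d \<Longrightarrow> dist (g t) (g s) < e"
    using e unfolding uniformly_continuous_on_def by metis
  obtain N :: nat where N: "N > 0" "1 / real N < d"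
    using d(1) by (metis nat_approx_posE zero_less_Suc)
  show ?thesis
  proof (intro exI[of _ N] conjI allI impI ballI N(1))
    fix N' z assume N': "N' \<ge> N" and z: "z \<in> sphere c R"
    have "1 / real N' \<le> 1 / real N" using N N' by (intro divide_left_mono) auto
    then have N'0: "N' > 0" "1 / real N' < d" using N N' by linarith+
    have "path_image (circlepath c R) = sphere c R" using R by simp
    then obtain \<tau> where \<tau>: "\<tau> \<in> {0..1}" "z = circlepath c R \<tau>"
      using z unfolding path_image_def by blast
    have cp: "u (c + (z - c) * cis (2 * pi * real k / real N')) = g (real k / real N' + \<tau>)" for k
    proof -
      have "exp (2 * of_real pi * \<i> * of_real (real k / real N' + \<tau>)) =
          exp (2 * of_real pi * \<i> * of_real \<tau>) * cis (2 * pi * real k / real N')"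
        unfolding cis_conv_exp exp_add[symmetric] by (simp add: algebra_simps)
      then show ?thesis by (simp add: g_def circlepath \<tau>(2) mult.assoc)
    qed
    have contg': "continuous_on X (\<lambda>t. g (t + \<tau>))" for X
      by (intro continuous_on_compose2[OF contg] continuous_intros) auto
    have "cmean c R u = integral {0..1} (\<lambda>t. g (t + \<tau>))"
      unfolding cmean_def g_def[symmetric] using integral_periodic_shift[OF contg per, of \<tau>] \<tau>(1)
      by (simp add: g_def)
    also have "\<dots> = (\<Sum>k<N'. integral {real k / real N'..(real k + 1) / real N'} (\<lambda>t. g (t + \<tau>)))"
      by (rule integral_split_equal[OF contg' N'0(1)])
    finally have cm: "cmean c R u = \<dots>" .
    have tm: "\<bar>g (real k / real N' + \<tau>) / real N' -
        integral {real k / real N'..(real k + 1) / real N'} (\<lambda>t. g (t + \<tau>))\<bar> \<le> e / real N'"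
      if k: "k < N'" for k
    proof -
      define p q where "p = real k / real N'" and "q = (real k + 1) / real N'"
      have pq: "0 \<le> p" "p \<le> q" "q \<le> 1" "q - p = 1 / real N'"
        using k N'0 by (auto simp: p_def q_def field_simps)
      have int: "(\<lambda>t. g (t + \<tau>)) integrable_on {p..q}"
        by (intro integrable_continuous_real contg')
      have "g (p + \<tau>) / real N' - integral {p..q} (\<lambda>t. g (t + \<tau>)) = integral {p..q} (\<lambda>t. g (p + \<tau>) - g (t + \<tau>))"
        using int pq by (subst integral_diff) (auto simp: field_simps)
      also have "\<bar>\<dots>\<bar> \<le> integral {p..q} (\<lambda>t. e)"
        unfolding real_norm_def[symmetric]
      proof (intro integral_norm_bound_integral)
        show "(\<lambda>t. g (p + \<tau>) - g (t + \<tau>)) integrable_on {p..q}" using int by (intro integrable_diff) auto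
        fix t assume t: "t \<in> {p..q}"
        have "dist (p + \<tau>) (t + \<tau>) < d" using t pq N'0(2) by (auto simp: dist_real_def)
        then have "dist (g (p + \<tau>)) (g (t + \<tau>)) < e" using t pq \<tau>(1) by (intro d(2)) auto
        then show "norm (g (p + \<tau>) - g (t + \<tau>)) \<le> e" by (simp add: dist_norm)
      qed auto
      also have "\<dots> = e / real N'" using pq by simp
      finally show ?thesis by (simp add: p_def q_def)
    qed
    have "(\<Sum>k<N'. u (c + (z - c) * cis (2 * pi * real k / real N'))) / real N' - cmean c R u =
        (\<Sum>k<N'. g (real k / real N' + \<tau>) / real N' - integral {real k / real N'..(real k + 1) / real N'} (\<lambda>t. g (t + \<tau>)))"
      by (simp add: cp cm sum_divide_distrib sum_subtractf)
    also have "\<bar>\<dots>\<bar> \<le> (\<Sum>k<N'. e / real N')"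
      by (intro order_trans[OF sum_abs] sum_mono tm) auto
    also have "\<dots> = e" using N'0 by simp
    finally show "\<bar>(\<Sum>k<N'. u (c + (z - c) * cis (2 * pi * real k / real N'))) / real N' - cmean c R u\<bar> \<le> e" .
  qed
qed

text \<open>This replaces the subharmonicity of \<open>ln (\<bar>x\<bar> + \<bar>y\<bar>)\<close>: choose unimodular constants that turn
  the product at \<open>z\<close> into the modulus of a holomorphic function and apply the maximum principle.\<close>
lemma holomorphic_pair_max:
  fixes x y :: "complex \<Rightarrow> complex"
  assumes "x holomorphic_on UNIV" "y holomorphic_on UNIV" and r: "0 < r" "r \<le> R" and z: "z \<in> sphere c r"
  defines "v \<equiv> \<lambda>z. norm (x z) + norm (y z)"
  shows "\<exists>w\<in>sphere c R. (\<Prod>k<N. v (c + (z - c) * cis (2 * pi * real k / real N)))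
      \<le> (\<Prod>k<N. v (c + (w - c) * cis (2 * pi * real k / real N)))"
proof -
  define rot where "rot = (\<lambda>k w. c + (w - c) * cis (2 * pi * real k / real N))"
  define uni where "uni = (\<lambda>a::complex. if a = 0 then 1 else cnj a / of_real (norm a))"
  have uni: "norm (uni a) = 1" "uni a * a = of_real (norm a)" for a
    using complex_norm_square[of a]
    by (auto simp: uni_def norm_divide power2_eq_square mult.commute field_simps)
  define g where "g = (\<lambda>w. \<Prod>k<N. uni (x (rot k z)) * x (rot k w) + uni (y (rot k z)) * y (rot k w))"
  have hol: "g holomorphic_on UNIV"
    unfolding g_def rot_def
    by (intro holomorphic_intros holomorphic_on_compose_gen[OF _ assms(1), unfolded o_def]
        holomorphic_on_compose_gen[OF _ assms(2), unfolded o_def]) auto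
  have gz: "norm (g z) = (\<Prod>k<N. v (rot k z))"
  proof -
    have "norm (uni (x (rot k z)) * x (rot k z) + uni (y (rot k z)) * y (rot k z)) = v (rot k z)" for k
      unfolding uni(2) v_def of_real_add[symmetric] by (simp only: norm_of_real) simp
    then show ?thesis by (simp add: g_def flip: prod_norm)
  qed
  \<comment> \<open>The unimodular constants are fitted to \<open>z\<close>; at other points the
    triangle inequality still gives an upper bound.\<close>
  have gw: "norm (g w) \<le> (\<Prod>k<N. v (rot k w))" for w
    unfolding g_def prod_norm[symmetric] v_def
    by (intro prod_mono conjI norm_ge_zero norm_triangle_le) (auto simp: norm_mult uni(1))
  have "compact (sphere c R)" "sphere c R \<noteq> {}" using r by auto
  moreover have "continuous_on (sphere c R) (\<lambda>w. norm (g w))"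
    using hol by (intro continuous_on_norm holomorphic_on_imp_continuous_on) (auto intro: holomorphic_on_subset)
  ultimately obtain w where w: "w \<in> sphere c R" "\<And>w'. w' \<in> sphere c R \<Longrightarrow> norm (g w') \<le> norm (g w)"
    using continuous_attains_sup[of "sphere c R" "\<lambda>w. norm (g w)"] by blast
  have "norm (g z) \<le> norm (g w)"
  proof (rule maximum_modulus_frontier[of g "cball c R"])
    show "g holomorphic_on interior (cball c R)" "continuous_on (closure (cball c R)) g"
      using hol by (auto intro: holomorphic_on_subset holomorphic_on_imp_continuous_on)
    show "z \<in> cball c R" using z r by auto
  qed (use w(2) r in auto)
  then show ?thesis using gz gw[of w] w(1) unfolding rot_def by (intro bexI[of _ w]) auto
qed

text \<open>The logarithm of the product over \<open>N\<close> equally spaced points, divided by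
  \<open>N\<close>, is a Riemann sum for the mean, so the inequality of
  \<open>holomorphic_pair_max\<close> between products passes to the means as \<open>N\<close>
  grows.\<close>

theorem characteristic_mono:
  fixes x y :: "complex \<Rightarrow> complex"
  assumes hol: "x holomorphic_on UNIV" "y holomorphic_on UNIV" and nz: "\<And>z. x z \<noteq> 0 \<or> y z \<noteq> 0"
    and r: "0 < r" "r \<le> R"
  shows "cmean c r (\<lambda>z. ln (norm (x z) + norm (y z))) \<le> cmean c R (\<lambda>z. ln (norm (x z) + norm (y z)))"
proof (rule field_le_epsilon)
  fix e :: real assume e: "e > 0"
  define v where "v = (\<lambda>z. norm (x z) + norm (y z))"
  have v: "v z > 0" for z using nz[of z] by (auto simp: v_def add_pos_nonneg add_nonneg_pos)
  have cont: "continuous_on X (\<lambda>z. ln (v z))" for X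
    using hol v unfolding v_def
    by (intro continuous_intros) (auto intro!: holomorphic_on_imp_continuous_on intro: holomorphic_on_subset simp: less_imp_neq[symmetric])
  define S where "S = (\<lambda>N z. (\<Sum>k<(N::nat). ln (v (c + (z - c) * cis (2 * pi * real k / real N)))) / real N)"
  have e2: "e / 2 > 0" using e by simp
  from uniform_Riemann_sum_circle[OF cont r(1) e2] obtain N1 where
    N1: "N1 > 0" "\<And>N z. N \<ge> N1 \<Longrightarrow> z \<in> sphere c r \<Longrightarrow> \<bar>S N z - cmean c r (\<lambda>z. ln (v z))\<bar> \<le> e/2"
    unfolding S_def by blast
  have "R > 0" using r by simp
  from uniform_Riemann_sum_circle[OF cont this e2] obtain N2 where
    N2: "N2 > 0" "\<And>N z. N \<ge> N2 \<Longrightarrow> z \<in> sphere c R \<Longrightarrow> \<bar>S N z - cmean c R (\<lambda>z. ln (v z))\<bar> \<le> e/2"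
    unfolding S_def by blast
  define N where "N = max N1 N2"
  have N: "N > 0" "N \<ge> N1" "N \<ge> N2" using N1 by (auto simp: N_def)
  define z where "z = c + of_real r"
  have z: "z \<in> sphere c r" using r by (simp add: z_def dist_norm)
  from holomorphic_pair_max[OF hol r z] obtain w where w: "w \<in> sphere c R"
    "(\<Prod>k<N. v (c + (z - c) * cis (2 * pi * real k / real N))) \<le> (\<Prod>k<N. v (c + (w - c) * cis (2 * pi * real k / real N)))"
    unfolding v_def by blast
  have "(\<Prod>k<N. v (c + (z - c) * cis (2 * pi * real k / real N))) > 0" using v by (intro prod_pos) auto
  then have "ln (\<Prod>k<N. v (c + (z - c) * cis (2 * pi * real k / real N))) \<le> ln (\<Prod>k<N. v (c + (w - c) * cis (2 * pi * real k / real N)))"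
    using w(2) ln_mono by blast
  then have "S N z \<le> S N w"
    using v unfolding S_def
    by (subst (asm) (1 2) ln_prod) (auto intro!: divide_right_mono simp: less_imp_neq[symmetric])
  then show "cmean c r (\<lambda>z. ln (norm (x z) + norm (y z))) \<le> cmean c R (\<lambda>z. ln (norm (x z) + norm (y z))) + e"
    using N1(2)[OF N(2) z] N2(2)[OF N(3) w(1)] unfolding v_def by linarith
qed

text \<open>Otherwise iterating \<open>s + 1 / T s\<close> at least doubles \<open>T\<close> in each
  step while the steps sum to at most 2, so \<open>T\<close> would be unbounded below a fixed
  radius.\<close>

lemma borel_growth:
  fixes T :: "real \<Rightarrow> real"
  assumes mono: "\<And>r s. 1 \<le> r \<Longrightarrow> r \<le> s \<Longrightarrow> T r \<le> T s" and T1: "\<And>r. 1 \<le> r \<Longrightarrow> 1 \<le> T r"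
  shows "\<exists>s\<ge>S. s \<ge> 1 \<and> T (s + 1 / T s) \<le> 2 * T s"
proof (rule ccontr)
  assume "\<not> ?thesis"
  then have big: "T (s + 1 / T s) > 2 * T s" if "s \<ge> max S 1" for s
    using that by force
  define q where "q = rec_nat (max S 1) (\<lambda>_ s. s + 1 / T s)"
  have q: "q 0 = max S 1" "q (Suc n) = q n + 1 / T (q n)" for n by (simp_all add: q_def)
  have ge: "q n \<ge> max S 1" for n
  proof (induction n)
    case (Suc n)
    then have "T (q n) \<ge> 1" by (intro T1) auto
    then have "1 / T (q n) \<ge> 0" by simp
    then show ?case using Suc unfolding q by linarith
  qed (simp add: q)
  have pow: "T (q n) \<ge> 2 ^ n" for n
  proof (induction n)
    case 0
    then show ?case using T1[of "q 0"] ge[of 0] by simp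
  next
    case (Suc n)
    then show ?case using big[OF ge[of n]] by (simp add: q)
  qed
  have bd: "q n \<le> max S 1 + 2 - 2 / 2 ^ n" for n
  proof (induction n)
    case (Suc n)
    have "1 / T (q n) \<le> 1 / 2 ^ n" using pow[of n] by (intro divide_left_mono mult_pos_pos) (auto intro: less_le_trans[OF _ pow[of n]])
    then show ?case using Suc by (simp add: q field_simps)
  qed (simp add: q)
  obtain n where n: "T (max S 1 + 2) < 2 ^ n" using real_arch_pow[of 2 "T (max S 1 + 2)"] by auto
  have "q n \<le> max S 1 + 2" using bd[of n] by (smt (verit) divide_nonneg_nonneg zero_le_power)
  then have "T (q n) \<le> T (max S 1 + 2)" using ge[of n] by (intro mono) auto
  then show False using pow[of n] n by linarith
qed

text \<open>Either \<open>T (2 * s) ^ a \<le> s\<close> for arbitrarily large \<open>s\<close>, and \<open>d = s\<close> works, or \<open>s\<close> is bounded by a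
  power of \<open>T s\<close>, and Borel's lemma allows \<open>d = 1 / T s\<close>.\<close>
lemma growth_radius:
  fixes T :: "real \<Rightarrow> real"
  assumes mono: "\<And>r s. 1 \<le> r \<Longrightarrow> r \<le> s \<Longrightarrow> T r \<le> T s" and T1: "\<And>r. 1 \<le> r \<Longrightarrow> 1 \<le> T r"
  shows "\<exists>C\<ge>1. \<exists>\<kappa>. \<forall>S. \<exists>s d. S \<le> s \<and> 1 \<le> s \<and> 0 < d \<and> d \<le> s \<and>
    (T (s + d) * (s / d) * (1 + 1 / d)) ^ a / d \<le> C * T s ^ \<kappa>"
proof (cases "\<forall>S. \<exists>s\<ge>S. s \<ge> 1 \<and> T (2 * s) ^ a \<le> s")
  case True
  show ?thesis
  proof (rule exI[of _ "2 ^ a"], intro conjI exI[of _ "0::nat"] allI)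
    fix S
    from True obtain s where s: "s \<ge> S" "s \<ge> 1" "T (2 * s) ^ a \<le> s" by blast
    have T: "T (2 * s) \<ge> 1" using s by (intro T1) auto
    have "(T (s + s) * (s / s) * (1 + 1 / s)) ^ a \<le> (T (2 * s) * 2) ^ a"
      using s T by (intro power_mono) (auto simp: field_simps)
    also have "\<dots> \<le> s * 2 ^ a" using s by (simp add: power_mult_distrib)
    finally have "(T (s + s) * (s / s) * (1 + 1 / s)) ^ a / s \<le> 2 ^ a * T s ^ 0"
      using s by (simp add: field_simps)
    then show "\<exists>s d. S \<le> s \<and> 1 \<le> s \<and> 0 < d \<and> d \<le> s \<and>
        (T (s + d) * (s / d) * (1 + 1 / d)) ^ a / d \<le> 2 ^ a * T s ^ 0"
      using s by (intro exI[of _ s]) auto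
  qed simp
next
  case False
  then obtain S0 where S0: "\<And>s. s \<ge> S0 \<Longrightarrow> s \<ge> 1 \<Longrightarrow> s < T (2 * s) ^ a" by (force simp: not_le)
  show ?thesis
  proof (rule exI[of _ "8 ^ a"], intro conjI exI[of _ "4 * a + a * a + 1"] allI)
    fix S
    \<comment> \<open>Doubling the threshold allows \<open>S0\<close> to be applied at
      \<open>s / 2\<close>, where \<open>T (2 * (s / 2))\<close> is \<open>T s\<close>; this bounds
      \<open>s\<close> by \<open>2 * T s ^ a\<close>.\<close>
    from borel_growth[of T "max S (2 * max S0 1)", OF mono T1] obtain s where
      s: "s \<ge> S" "s \<ge> 2 * max S0 1" "s \<ge> 1" "T (s + 1 / T s) \<le> 2 * T s" by force
    define t where "t = T s"
    have t: "t \<ge> 1" using s T1 by (simp add: t_def)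
    have "s / 2 < t ^ a" using S0[of "s / 2"] s by (simp add: t_def)
    then have st: "s \<le> 2 * t ^ a" by simp
    have "T (s + 1 / t) \<ge> 1" using s t by (intro T1) (smt (verit) divide_nonneg_nonneg)
    then have "(T (s + 1 / t) * (s / (1 / t)) * (1 + 1 / (1 / t))) ^ a \<le> (2 * t * (2 * t ^ a * t) * (2 * t)) ^ a"
      using s st t unfolding t_def[symmetric]
      by (intro power_mono mult_mono mult_nonneg_nonneg) auto
    also have "\<dots> = 8 ^ a * t ^ (3 * a + a * a)"
    proof -
      have "2 * t * (2 * t ^ a * t) * (2 * t) = 8 * t ^ (3 + a)"
        by (simp add: power_add power3_eq_cube)
      then show ?thesis by (simp add: power_mult_distrib power_mult[symmetric] distrib_right)
    qed
    also have "\<dots> \<le> 8 ^ a * t ^ (4 * a + a * a)"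
      using t by (intro mult_left_mono power_increasing) auto
    finally have "(T (s + 1 / t) * (s / (1 / t)) * (1 + 1 / (1 / t))) ^ a / (1 / t) \<le> 8 ^ a * t ^ (4 * a + a * a) * t"
      using t by (simp add: mult_right_mono)
    then have "(T (s + 1 / t) * (s / (1 / t)) * (1 + 1 / (1 / t))) ^ a / (1 / t) \<le> 8 ^ a * T s ^ (4 * a + a * a + 1)"
      by (simp add: t_def mult_ac)
    moreover have "1 / t \<le> s" using t s by (smt (verit) divide_le_eq_1)
    ultimately show "\<exists>s d. S \<le> s \<and> 1 \<le> s \<and> 0 < d \<and> d \<le> s \<and>
        (T (s + d) * (s / d) * (1 + 1 / d)) ^ a / d \<le> 8 ^ a * T s ^ (4 * a + a * a + 1)"
      using s t by (rule_tac x = s in exI, rule_tac x = "1 / t" in exI) auto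
  qed simp
qed

section \<open>One circle for all logarithmic derivatives\<close>

lemma countable_zeros:
  assumes "A holomorphic_on UNIV" "\<exists>z. A z \<noteq> 0"
  shows "countable {z. A z = 0}"
proof -
  have "{z. A z = 0} = (\<Union>n::nat. {z \<in> cball 0 (real n). A z = 0})"
    by (auto simp: dist_norm) (meson real_arch_simple)
  also have "countable \<dots>" by (intro countable_UN[OF countableI_type] countable_finite finite_zeros_cball assms)
  finally show ?thesis .
qed

text \<open>\<open>jensen_zero_count\<close> bounds the number of zeros in terms of
  \<open>T (s + d)\<close>. The pigeonhole lemma then finds an inner and an outer circle away from
  the zeros of all functions at once, and \<open>log_derivative_bound\<close> applies to every pair
  on the same inner circle.\<close>

lemma good_circle:
  fixes T :: "real \<Rightarrow> real"
  assumes fin: "finite FF" and PP: "PP \<subseteq> FF \<times> FF"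
    and ent: "\<And>A. A \<in> FF \<Longrightarrow> A holomorphic_on UNIV \<and> A c \<noteq> 0"
    and mono: "\<And>r s. 1 \<le> r \<Longrightarrow> r \<le> s \<Longrightarrow> T r \<le> T s" and T1: "\<And>r. 1 \<le> r \<Longrightarrow> 1 \<le> T r"
    and low: "\<And>A. A \<in> FF \<Longrightarrow> - ln (norm (A c)) \<le> T 1"
    and mean: "\<And>A \<rho>. A \<in> FF \<Longrightarrow> 1 \<le> \<rho> \<Longrightarrow> (\<forall>z\<in>sphere c \<rho>. A z \<noteq> 0) \<Longrightarrow>
      cmean c \<rho> (\<lambda>z. ln (norm (A z))) \<le> T \<rho>"
    and pair: "\<And>A B \<rho>. (A, B) \<in> PP \<Longrightarrow> 1 \<le> \<rho> \<Longrightarrow> (\<forall>z\<in>sphere c \<rho>. A z \<noteq> 0 \<and> B z \<noteq> 0) \<Longrightarrow>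
      cmean c \<rho> (\<lambda>z. \<bar>ln (norm (A z)) - ln (norm (B z))\<bar>) \<le> 4 * T \<rho>"
  shows "\<exists>C\<ge>1. \<forall>s d X. 1 \<le> s \<longrightarrow> 0 < d \<longrightarrow> d \<le> s \<longrightarrow> countable X \<longrightarrow>
    (\<exists>r. s < r \<and> r < s + d \<and> r \<notin> X \<and> (\<forall>z\<in>sphere c r. \<forall>(A, B)\<in>PP.
      A z \<noteq> 0 \<and> B z \<noteq> 0 \<and>
      norm (deriv (\<lambda>z. A z / B z) z)
        \<le> C * (T (s + d) * (s / d) * (1 + 1 / d)) ^ 8 / d * norm (A z / B z) \<and>
      norm (deriv (deriv (\<lambda>z. A z / B z)) z)
        \<le> C * (T (s + d) * (s / d) * (1 + 1 / d)) ^ 8 / d * norm (A z / B z)))"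
proof -
  define m where "m = real (card FF) + 1"
  have m: "m \<ge> 1" by (simp add: m_def)
  \<comment> \<open>A rounded constant: the squared first-order bound contributes 7169^2 = 51394561
    and the second-order terms 114688 + 1. The exponent 8 is twice the exponent 4 of
    \<open>G\<close> in the bound for \<open>K\<close>.\<close>
  show ?thesis
  proof (rule exI[of _ "100000000 * (600 * m) ^ 8"], intro conjI allI impI)
    show "1 \<le> 100000000 * (600 * m) ^ 8" using m by (intro mult_ge1_I one_le_power) auto
  next
    fix s d :: real and X :: "real set"
    assume s: "1 \<le> s" and d: "0 < d" "d \<le> s" and X: "countable X"
    \<comment> \<open>The radii in increasing order are \<open>s\<close>, \<open>r\<close>,
      \<open>s + d / 8\<close>, \<open>s + d / 4\<close>, \<open>R\<close>, \<open>Rs\<close>,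
      \<open>s + 3 * d / 4\<close>, \<open>\<rho>\<close>, \<open>s + d\<close>. Zeros inside
      \<open>Rs\<close> are removed and are counted by Jensen's inequality at radius
      \<open>\<rho>\<close>; the gaps \<open>R - r\<close> and \<open>\<rho> - Rs\<close> are at
      least fixed fractions of \<open>d\<close>.\<close>
    define Rs where "Rs = s + d / 2"
    define W where "W = (\<Union>A\<in>FF. dist c ` {z. A z = 0})"
    have W: "countable W" unfolding W_def using fin ent
      by (intro countable_UN countable_image countable_zeros countable_finite) auto
    have "s + 3 * d / 4 < s + d" using d by simp
    from select_far_point[of "{}" 0, OF _ _ this W] obtain \<rho> where
      \<rho>: "s + 3 * d / 4 < \<rho>" "\<rho> < s + d" "\<rho> \<notin> W" by auto
    have nz\<rho>: "A z \<noteq> 0" if "A \<in> FF" "z \<in> sphere c \<rho>" for A z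
      using \<rho>(3) that by (auto simp: W_def)
    define TT where "TT = T (s + d)"
    have TT: "TT \<ge> 1" using s d by (simp add: TT_def T1)
    define Q where "Q = TT * (s / d)"
    have sd: "1 \<le> s / d" using d by simp
    have Q: "1 \<le> Q" "s / d \<le> Q" "TT \<le> Q"
      using TT sd mult_mono[of 1 TT "s/d" "s/d"] mult_mono[of TT TT 1 "s/d"]
        mult_mono[of 1 TT 1 "s/d"] by (auto simp: Q_def)
    have "\<forall>A\<in>FF. \<exists>zs E. E holomorphic_on UNIV \<and> (\<forall>z\<in>ball c Rs. E z \<noteq> 0) \<and> set zs \<subseteq> ball c Rs \<and>
        (\<forall>z. A z = (\<Prod>a\<leftarrow>zs. z - a) * E z)"
    proof
      fix A assume A: "A \<in> FF"
      have "finite {z \<in> cball c Rs. A z = 0}" using ent[OF A] by (intro finite_zeros_cball) auto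
      then have "finite {z \<in> ball c Rs. A z = 0}" by (rule rev_finite_subset) auto
      from factor_zeros[OF this, of A] ent[OF A] obtain zs E where
        E: "E holomorphic_on UNIV" "\<forall>z\<in>{z \<in> ball c Rs. A z = 0}. E z \<noteq> 0"
        "set zs \<subseteq> {z \<in> ball c Rs. A z = 0}" "\<forall>z. A z = (\<Prod>a\<leftarrow>zs. z - a) * E z" by blast
      moreover have "\<forall>z\<in>ball c Rs. E z \<noteq> 0"
      proof
        fix z assume "z \<in> ball c Rs"
        then show "E z \<noteq> 0" using E(2) E(4)[rule_format, of z] by (cases "A z = 0") auto
      qed
      ultimately show "\<exists>zs E. E holomorphic_on UNIV \<and> (\<forall>z\<in>ball c Rs. E z \<noteq> 0) \<and> set zs \<subseteq> ball c Rs \<and>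
        (\<forall>z. A z = (\<Prod>a\<leftarrow>zs. z - a) * E z)"
        by (intro exI[of _ zs] exI[of _ E]) blast
    qed
    then obtain zs E where zsE: "\<And>A. A \<in> FF \<Longrightarrow> E A holomorphic_on UNIV"
      "\<And>A z. A \<in> FF \<Longrightarrow> z \<in> ball c Rs \<Longrightarrow> E A z \<noteq> 0"
      "\<And>A. A \<in> FF \<Longrightarrow> set (zs A) \<subseteq> ball c Rs"
      "\<And>A z. A \<in> FF \<Longrightarrow> A z = (\<Prod>a\<leftarrow>zs A. z - a) * E A z" by metis
    have len: "real (length (zs A)) \<le> 16 * Q" if A: "A \<in> FF" for A
    proof -
      have "real (length (zs A)) * ln (\<rho> / Rs) + ln (norm (A c)) \<le> cmean c \<rho> (\<lambda>z. ln (norm (A z)))"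
        using zsE[OF A] ent[OF A] nz\<rho>[OF A] s d \<rho>
        by (intro jensen_zero_count[where E = "E A"]) (auto simp: Rs_def)
      also have "\<dots> \<le> T \<rho>" using s d \<rho> nz\<rho> A by (intro mean) auto
      also have "\<dots> \<le> TT" unfolding TT_def using s d \<rho> by (intro mono) auto
      finally have 1: "real (length (zs A)) * ln (\<rho> / Rs) \<le> TT - ln (norm (A c))" by simp
      have "- ln (norm (A c)) \<le> TT" unfolding TT_def using low[OF A] mono[of 1 "s + d"] s d by simp
      with 1 have 1: "real (length (zs A)) * ln (\<rho> / Rs) \<le> 2 * TT" by simp
      have pos: "\<rho> > 0" "Rs > 0" using s d \<rho> by (auto simp: Rs_def)
      have "d / (8 * s) = (d / 4) / (2 * s)" by simp
      also have "\<dots> \<le> (\<rho> - Rs) / \<rho>" using s d \<rho> by (intro frac_le) (auto simp: Rs_def)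
      also have "\<dots> = 1 - Rs / \<rho>" using pos by (simp add: diff_divide_distrib)
      also have "\<dots> \<le> - ln (Rs / \<rho>)" using ln_le_minus_one[of "Rs / \<rho>"] pos by simp
      also have "\<dots> = ln (\<rho> / Rs)" using pos by (simp add: ln_div)
      finally have "real (length (zs A)) * (d / (8 * s)) \<le> 2 * TT"
        using 1 by (meson mult_left_mono of_nat_0_le_iff order_trans)
      then show ?thesis using s d by (simp add: Q_def field_simps)
    qed
    define Z where "Z = (\<Union>A\<in>FF. dist c ` set (zs A))"
    define N where "N = (\<Sum>A\<in>FF. length (zs A))"
    have Z: "finite Z" "card Z \<le> N"
    proof -
      show "finite Z" using fin by (auto simp: Z_def)
      have "card Z \<le> (\<Sum>A\<in>FF. card (dist c ` set (zs A)))" unfolding Z_def using fin by (rule card_UN_le)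
      also have "\<dots> \<le> N" unfolding N_def
        by (intro sum_mono) (metis card_image_le card_length finite_set order_trans)
      finally show "card Z \<le> N" .
    qed
    \<comment> \<open>\<open>G\<close> dominates every quantity to come. The factor 600 exceeds 32 *
      17, which is what \<open>32 * (real N + 1)\<close> requires when \<open>N\<close> is at most
      \<open>16 * (m * Q)\<close>.\<close>
    define G where "G = 600 * (m * Q)"
    have "real N \<le> (\<Sum>A\<in>FF. 16 * Q)" unfolding N_def of_nat_sum by (intro sum_mono len)
    also have "\<dots> \<le> 16 * (m * Q)" using Q by (simp add: m_def algebra_simps)
    finally have N: "real N \<le> 16 * (m * Q)" .
    have mQ: "1 \<le> m * Q" "Q \<le> m * Q" using m Q mult_mono[of 1 m 1 Q] mult_mono[of 1 m Q Q] by auto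
    have G: "G \<ge> 600" "Q \<le> G" "32 * (real N + 1) \<le> G" "32 * Q \<le> G" "4 * TT \<le> G" "s / d \<le> G"
    proof -
      define p where "p = m * Q"
      have p: "1 \<le> p" "Q \<le> p" "real N \<le> 16 * p" and Gp: "G = 600 * p"
        using mQ N by (auto simp: p_def G_def)
      show "G \<ge> 600" "Q \<le> G" using p(1,2) unfolding Gp by simp_all
      have "32 * (real N + 1) \<le> 32 * (16 * p + p)" using p(1,3) by (intro mult_left_mono add_mono) auto
      also have "\<dots> \<le> 600 * p" using p(1) by simp
      finally show "32 * (real N + 1) \<le> G" by (simp only: Gp)
      show "32 * Q \<le> G" using p(1,2) unfolding Gp by simp
      have "TT \<le> p" "s / d \<le> p" using Q p(2) by (blast intro: order_trans)+
      then show "4 * TT \<le> G" "s / d \<le> G" using p(1) unfolding Gp by simp_all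
    qed
    \<comment> \<open>At most the clearance that \<open>select_far_point\<close> gives for
      \<open>r\<close>, and hence for \<open>R\<close>, whose interval is twice as long.\<close>
    define \<delta> where "\<delta> = d / G"
    have \<delta>: "\<delta> > 0" "\<delta> \<le> d / 2"
    proof -
      show "\<delta> > 0" using d G by (simp add: \<delta>_def)
      show "\<delta> \<le> d / 2" unfolding \<delta>_def using d G(1) by (intro divide_left_mono) auto
    qed
    have \<delta>N: "\<delta> \<le> d / (32 * (real N + 1))" unfolding \<delta>_def using d G by (intro divide_left_mono) auto
    have "s + d / 4 < Rs" using d by (simp add: Rs_def)
    from select_far_point[OF Z this, of "{}"] obtain R where
      R: "s + d / 4 < R" "R < Rs" "\<And>m. m \<in> Z \<Longrightarrow> (Rs - (s + d / 4)) / (4 * (real N + 1)) \<le> \<bar>m - R\<bar>" by auto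
    have R': "\<delta> \<le> \<bar>m - R\<bar>" if "m \<in> Z" for m
    proof -
      have "d / (32 * (real N + 1)) \<le> (d / 4) / (4 * (real N + 1))" using d by (simp add: field_simps)
      also have "d / 4 = Rs - (s + d / 4)" by (simp add: Rs_def)
      finally show ?thesis using \<delta>N R(3)[OF that] by linarith
    qed
    have "s < s + d / 8" using d by simp
    from select_far_point[OF Z this X] obtain r where
      r: "s < r" "r < s + d / 8" "r \<notin> X" "\<And>m. m \<in> Z \<Longrightarrow> (s + d / 8 - s) / (4 * (real N + 1)) \<le> \<bar>m - r\<bar>" by auto
    have r': "\<delta> \<le> \<bar>m - r\<bar>" if "m \<in> Z" for m
      using \<delta>N r(4)[OF that] by simp
    define Kt where "Kt = 100000000 * (600 * m) ^ 8 * (TT * (s / d) * (1 + 1 / d)) ^ 8 / d"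
    have main: "A z \<noteq> 0 \<and> B z \<noteq> 0 \<and> norm (deriv (\<lambda>z. A z / B z) z) \<le> Kt * norm (A z / B z) \<and>
      norm (deriv (deriv (\<lambda>z. A z / B z)) z) \<le> Kt * norm (A z / B z)"
      if z: "z \<in> sphere c r" and AB: "(A, B) \<in> PP" for z A B
    proof -
      have A: "A \<in> FF" and B: "B \<in> FF" using AB PP by auto
      define K1 where "K1 = 8 * R / (R - r)\<^sup>2 * (4 * TT + 32 * Q * (3 * R / \<delta>))"
      define K where "K = K1 + 32 * Q / \<delta>"
      define L where "L = 2 * K1 / (R - r) + 32 * Q / \<delta>\<^sup>2"
      have nzR: "F w \<noteq> 0" if "F \<in> FF" "w \<in> sphere c R" for F w
      proof
        assume "F w = 0"
        have wb: "w \<in> ball c Rs" using that(2) R by auto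
        then have "w \<in> set (zs F)"
          using zsE(2,4)[OF that(1)] \<open>F w = 0\<close> ln_norm_prod_list(2)[of w "zs F"] by force
        then have "dist c w \<in> Z" using that(1) by (auto simp: Z_def)
        from R'[OF this] show False using \<delta>(1) that(2) by auto
      qed
      have M: "cmean c R (\<lambda>z. \<bar>ln (norm (A z)) - ln (norm (B z))\<bar>) \<le> 4 * TT"
      proof -
        have "cmean c R (\<lambda>z. \<bar>ln (norm (A z)) - ln (norm (B z))\<bar>) \<le> 4 * T R"
          using AB s d R nzR A B by (intro pair) auto
        also have "T R \<le> TT" unfolding TT_def using s d R by (intro mono) (auto simp: Rs_def)
        finally show ?thesis by simp
      qed
      have far: "dist c a \<le> 2 * R \<and> \<delta> \<le> \<bar>dist c a - r\<bar> \<and> \<delta> \<le> \<bar>dist c a - R\<bar>"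
        if "a \<in> set (zs A) \<union> set (zs B)" for a
      proof -
        have "dist c a \<in> Z" using that A B by (auto simp: Z_def)
        moreover have "dist c a < Rs" using that zsE(3)[OF A] zsE(3)[OF B] by auto
        ultimately show ?thesis using R' r' R s d by (auto simp: Rs_def)
      qed
      have lenAB: "real (length (zs A) + length (zs B)) \<le> 32 * Q" using len[OF A] len[OF B] by simp
      have rR: "0 < r" "r < R" "\<delta> \<le> R" using r R s d \<delta> by auto
      have z': "dist c z = r" using z by simp
      note LD = log_derivative_bound[OF zsE(4)[OF A] zsE(1)[OF A] zsE(2)[OF A] zsE(4)[OF B] zsE(1)[OF B] zsE(2)[OF B]
          rR(1,2) R(2) \<delta>(1) rR(3) far M lenAB z' K1_def K_def L_def]
      define H where "H = 1 / d"
      have H: "H > 0" "H * d = 1" using d by (auto simp: H_def)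
      have Rr: "d / 8 \<le> R - r" using r R by simp
      have s_le: "s \<le> G * d" using G(6) d by (simp add: field_simps)
      have "8 * R / (R - r)\<^sup>2 \<le> 8 * (2 * s) / (d / 8)\<^sup>2"
        using s d R Rr by (intro frac_le power_mono mult_left_mono) (auto simp: Rs_def)
      also have "\<dots> = 1024 * s * H\<^sup>2" by (simp add: H_def field_simps power2_eq_square)
      also have "\<dots> \<le> 1024 * (G * d) * H\<^sup>2" using s_le by (intro mult_right_mono mult_left_mono) auto
      also have "\<dots> = 1024 * G * H" using H(2) by (simp add: power2_eq_square mult_ac)
      finally have e1: "8 * R / (R - r)\<^sup>2 \<le> 1024 * G * H" .
      have inv\<delta>: "1 / \<delta> = G * H" by (simp add: \<delta>_def H_def)
      have "3 * R / \<delta> = 3 * R * (G * H)" using inv\<delta> by (metis mult.right_neutral times_divide_eq_right)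
      also have "\<dots> \<le> 6 * (G * d) * (G * H)"
        using R s_le s d G H by (intro mult_right_mono) (auto simp: Rs_def)
      also have "\<dots> = 6 * G\<^sup>2" using H(2) by (simp add: power2_eq_square mult_ac)
      finally have e2: "3 * R / \<delta> \<le> 6 * G\<^sup>2" .
      have "4 * TT + 32 * Q * (3 * R / \<delta>) \<le> G + G * (6 * G\<^sup>2)"
        using e2 G Q R s d \<delta> by (intro add_mono mult_mono) auto
      also have "\<dots> = G * 1 + 6 * G ^ 3" by (simp add: power2_eq_square power3_eq_cube)
      also have "\<dots> \<le> G * G\<^sup>2 + 6 * G ^ 3" using G(1) by (intro add_mono mult_left_mono one_le_power) auto
      also have "\<dots> = 7 * G ^ 3" by (simp add: power2_eq_square power3_eq_cube)
      finally have e3: "4 * TT + 32 * Q * (3 * R / \<delta>) \<le> 7 * G ^ 3" .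
      have "0 \<le> 4 * TT + 32 * Q * (3 * R / \<delta>)" using TT Q R s d \<delta> by (intro add_nonneg_nonneg mult_nonneg_nonneg divide_nonneg_nonneg) auto
      then have K1: "K1 \<le> 1024 * G * H * (7 * G ^ 3)" "0 \<le> K1"
        unfolding K1_def using e1 e3 G H R s d by (intro mult_mono mult_nonneg_nonneg; simp)+
      have G34: "G ^ 2 \<le> G ^ 4" "G ^ 3 \<le> G ^ 4" "G ^ 4 \<le> G ^ 8"
        using G(1) by (intro power_increasing; simp)+
      have "32 * Q / \<delta> = 32 * Q * (G * H)" using inv\<delta> by (metis mult.right_neutral times_divide_eq_right)
      also have "\<dots> \<le> G * (G * H)" using G H by (intro mult_right_mono) auto
      also have "\<dots> = G\<^sup>2 * H" by (simp add: power2_eq_square)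
      also have "\<dots> \<le> G ^ 4 * H" using G34 H by (intro mult_right_mono) auto
      finally have e4: "32 * Q / \<delta> \<le> G ^ 4 * H" .
      have K1': "K1 \<le> 7168 * (G ^ 4 * H)" using K1(1) by (simp add: power4_eq_xxxx power3_eq_cube mult_ac)
      have K: "K \<le> 7169 * (G ^ 4 * H)" "0 \<le> K"
        using K1' e4 K1(2) Q \<delta> by (auto simp: K_def)
      have "2 * K1 / (R - r) \<le> 2 * K1 / (d / 8)" using Rr d K1(2) by (intro divide_left_mono) auto
      also have "\<dots> = 16 * K1 * H" by (simp add: H_def)
      also have "\<dots> \<le> 16 * (7168 * (G ^ 4 * H)) * H" using K1' H by (intro mult_right_mono mult_left_mono) auto
      also have "\<dots> \<le> 16 * (7168 * (G ^ 8 * H)) * H" using G34 H by (intro mult_right_mono mult_left_mono) auto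
      finally have e5: "2 * K1 / (R - r) \<le> 114688 * (G ^ 8 * H\<^sup>2)" by (simp add: power2_eq_square mult_ac)
      have "32 * Q / \<delta>\<^sup>2 = 32 * Q * (1 / \<delta>)\<^sup>2" by (simp add: power_one_over field_simps)
      also have "\<dots> \<le> G * (G * H)\<^sup>2" unfolding inv\<delta> using G by (intro mult_right_mono) auto
      also have "\<dots> = G ^ 3 * H\<^sup>2" by (simp add: power2_eq_square power3_eq_cube mult_ac)
      also have "\<dots> \<le> G ^ 8 * H\<^sup>2" using G34 by (intro mult_right_mono) auto
      finally have e6: "32 * Q / \<delta>\<^sup>2 \<le> G ^ 8 * H\<^sup>2" .
      have "K\<^sup>2 \<le> (7169 * (G ^ 4 * H))\<^sup>2" using K by (intro power_mono) auto
      also have "\<dots> = 51394561 * (G ^ 8 * H\<^sup>2)" by (simp add: power_mult_distrib flip: power_mult)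
      finally have LK: "L + K\<^sup>2 \<le> 100000000 * (G ^ 8 * H\<^sup>2)"
      proof -
        define P where "P = G ^ 8 * H\<^sup>2"
        assume "K\<^sup>2 \<le> 51394561 * (G ^ 8 * H\<^sup>2)"
        moreover have "0 \<le> P" using G by (simp add: P_def)
        ultimately show ?thesis using e5 e6 unfolding L_def P_def[symmetric] by linarith
      qed
      have K': "K \<le> 100000000 * (G ^ 8 * H)"
      proof -
        have "G ^ 4 * H \<le> G ^ 8 * H" using G34 H by (intro mult_right_mono) auto
        moreover have "0 \<le> G ^ 8 * H" using G H by simp
        ultimately show ?thesis using K(1) by linarith
      qed
      have Kt: "Kt = 100000000 * (G ^ 8 * (1 + H) ^ 8 * H)"
      proof -
        have "Kt = 100000000 * ((600 * m) ^ 8 * (Q * (1 + H)) ^ 8) * H"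
          by (simp add: Kt_def Q_def H_def)
        also have "(600 * m) ^ 8 * (Q * (1 + H)) ^ 8 = (600 * (m * Q)) ^ 8 * (1 + H) ^ 8"
          unfolding power_mult_distrib[symmetric] by (simp only: mult_ac)
        finally show ?thesis by (simp only: G_def mult_ac)
      qed
      have "G ^ 8 * H * 1 \<le> G ^ 8 * H * (1 + H) ^ 8" using G H by (intro mult_left_mono one_le_power) auto
      then have KKt: "K \<le> Kt" using K' Kt by (simp add: mult_ac)
      \<comment> \<open>The bound for the second derivative carries \<open>1 / d\<close> twice; the
        factor \<open>(1 + 1 / d) ^ 8\<close> of the statement absorbs one of them.\<close>
      have "H \<le> (1 + H) ^ 8" using H by (intro order_trans[OF _ self_le_power]) auto
      then have "G ^ 8 * H * H \<le> G ^ 8 * H * (1 + H) ^ 8" using G H by (intro mult_left_mono) auto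
      then have LKt: "L + K\<^sup>2 \<le> Kt" using LK Kt by (simp add: mult_ac power2_eq_square)
      show ?thesis using LD KKt LKt by (meson mult_right_mono norm_ge_zero order_trans)
    qed
    show "\<exists>r. s < r \<and> r < s + d \<and> r \<notin> X \<and> (\<forall>z\<in>sphere c r. \<forall>(A, B)\<in>PP.
      A z \<noteq> 0 \<and> B z \<noteq> 0 \<and>
      norm (deriv (\<lambda>z. A z / B z) z)
        \<le> 100000000 * (600 * m) ^ 8 * (T (s + d) * (s / d) * (1 + 1 / d)) ^ 8 / d * norm (A z / B z) \<and>
      norm (deriv (deriv (\<lambda>z. A z / B z)) z)
        \<le> 100000000 * (600 * m) ^ 8 * (T (s + d) * (s / d) * (1 + 1 / d)) ^ 8 / d * norm (A z / B z))"
      using r d main unfolding Kt_def TT_def by (intro exI[of _ r]) auto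
  qed
qed

section \<open>The characteristic of a quotient of entire functions\<close>

text \<open>Up to a bounded term this is the Nevanlinna characteristic of \<open>x / y\<close> in
  Cartan's form, for entire \<open>x\<close> and \<open>y\<close> without common zeros.\<close>

definition characteristic :: "complex \<Rightarrow> (complex \<Rightarrow> complex) \<Rightarrow> (complex \<Rightarrow> complex) \<Rightarrow> real \<Rightarrow> real" where
  "characteristic c x y r = cmean c r (\<lambda>z. ln (norm (x z) + norm (y z)))"

locale entire_pair =
  fixes x y :: "complex \<Rightarrow> complex"
  assumes x: "x holomorphic_on UNIV" and y: "y holomorphic_on UNIV"
    and no_common_zero: "x z \<noteq> 0 \<or> y z \<noteq> 0"
begin

lemma norm_pos: "norm (x z) + norm (y z) > 0"
  using no_common_zero[of z] by (auto simp: add_pos_nonneg add_nonneg_pos)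

lemma continuous_on_ln_pair: "continuous_on X (\<lambda>z. ln (norm (x z) + norm (y z)))"
proof -
  have "continuous_on X x" "continuous_on X y"
    using x y by (auto intro: holomorphic_on_imp_continuous_on holomorphic_on_subset)
  then show ?thesis using norm_pos by (intro continuous_intros) (auto simp: less_imp_neq[symmetric])
qed

lemma characteristic_mono': "0 < r \<Longrightarrow> r \<le> R \<Longrightarrow> characteristic c x y r \<le> characteristic c x y R"
  unfolding characteristic_def using x y no_common_zero by (rule characteristic_mono)

context
  fixes A :: "complex \<Rightarrow> complex" and c :: complex and \<beta> \<rho> :: real
  assumes A: "A holomorphic_on UNIV" and A_le: "\<And>z. norm (A z) \<le> exp \<beta> * (norm (x z) + norm (y z))"
    and \<rho>: "0 < \<rho>" and nz: "\<And>z. z \<in> sphere c \<rho> \<Longrightarrow> A z \<noteq> 0"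
begin

lemma ln_form_le: "z \<in> sphere c \<rho> \<Longrightarrow> ln (norm (A z)) \<le> ln (norm (x z) + norm (y z)) + \<beta>"
proof -
  assume z: "z \<in> sphere c \<rho>"
  have "ln (norm (A z)) \<le> ln (exp \<beta> * (norm (x z) + norm (y z)))"
    using nz[OF z] A_le[of z] by (intro ln_mono) auto
  then show ?thesis using norm_pos[of z] by (simp add: ln_mult)
qed

lemma continuous_on_ln_form: "continuous_on (sphere c \<rho>) (\<lambda>z. ln (norm (A z)))"
  using nz A by (intro continuous_on_ln_norm)
    (auto intro: holomorphic_on_imp_continuous_on holomorphic_on_subset)

lemma cmean_ln_form_le: "cmean c \<rho> (\<lambda>z. ln (norm (A z))) \<le> characteristic c x y \<rho> + \<beta>"
proof -
  have "cmean c \<rho> (\<lambda>z. ln (norm (A z))) \<le> cmean c \<rho> (\<lambda>z. ln (norm (x z) + norm (y z)) + \<beta>)"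
    using \<rho> by (intro cmean_mono continuous_on_ln_form continuous_on_add continuous_on_ln_pair
        continuous_on_const ln_form_le) auto
  also have "\<dots> = characteristic c x y \<rho> + \<beta>"
    unfolding characteristic_def using \<rho> by (subst cmean_add) (auto intro: continuous_on_ln_pair)
  finally show ?thesis .
qed

end

text \<open>Two numbers that are at most M differ by at most 2 M minus their sum. Jensen's
  inequality bounds the means of the subtracted logarithms from below.\<close>

lemma cmean_ln_quotient_le:
  assumes A: "A holomorphic_on UNIV" "\<And>z. norm (A z) \<le> exp \<beta> * (norm (x z) + norm (y z))" "A c \<noteq> 0"
    and B: "B holomorphic_on UNIV" "\<And>z. norm (B z) \<le> exp \<beta> * (norm (x z) + norm (y z))" "B c \<noteq> 0"
    and \<rho>: "0 < \<rho>" and nz: "\<And>z. z \<in> sphere c \<rho> \<Longrightarrow> A z \<noteq> 0" "\<And>z. z \<in> sphere c \<rho> \<Longrightarrow> B z \<noteq> 0"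
  shows "cmean c \<rho> (\<lambda>z. \<bar>ln (norm (A z)) - ln (norm (B z))\<bar>) \<le>
    2 * characteristic c x y \<rho> + 2 * \<beta> - ln (norm (A c)) - ln (norm (B c))"
proof -
  note cA = continuous_on_ln_form[OF A(1,2) \<rho> nz(1)] and cB = continuous_on_ln_form[OF B(1,2) \<rho> nz(2)]
  have "cmean c \<rho> (\<lambda>z. \<bar>ln (norm (A z)) - ln (norm (B z))\<bar>) \<le>
      cmean c \<rho> (\<lambda>z. 2 * (ln (norm (x z) + norm (y z)) + \<beta>) - ln (norm (A z)) - ln (norm (B z)))"
  proof (rule cmean_mono)
    fix z assume z: "z \<in> sphere c \<rho>"
    show "\<bar>ln (norm (A z)) - ln (norm (B z))\<bar> \<le>
        2 * (ln (norm (x z) + norm (y z)) + \<beta>) - ln (norm (A z)) - ln (norm (B z))"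
    proof -
      have "ln (norm (A z)) \<le> ln (norm (x z) + norm (y z)) + \<beta>"
        by (rule ln_form_le[OF A(1,2) \<rho> nz(1) z])
      moreover have "ln (norm (B z)) \<le> ln (norm (x z) + norm (y z)) + \<beta>"
        by (rule ln_form_le[OF B(1,2) \<rho> nz(2) z])
      ultimately show ?thesis unfolding abs_le_iff by (intro conjI) (simp_all add: algebra_simps)
    qed
  qed (use \<rho> in \<open>auto intro!: continuous_on_rabs continuous_on_diff continuous_on_mult continuous_on_add
      cA cB continuous_on_ln_pair\<close>)
  also have "\<dots> = 2 * (characteristic c x y \<rho> + \<beta>) - cmean c \<rho> (\<lambda>z. ln (norm (A z)))
      - cmean c \<rho> (\<lambda>z. ln (norm (B z)))"
    unfolding characteristic_def using \<rho>
    by (subst cmean_diff cmean_cmult cmean_add;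
        auto intro!: continuous_on_diff continuous_on_mult continuous_on_add cA cB continuous_on_ln_pair)+
  also have "\<dots> \<le> 2 * (characteristic c x y \<rho> + \<beta>) - ln (norm (A c)) - ln (norm (B c))"
    using jensen_inequality[OF A(1,3) \<rho> nz(1)] jensen_inequality[OF B(1,3) \<rho> nz(2)] by simp
  finally show ?thesis by simp
qed

lemma norm_form_le:
  "norm (x z - a * y z) \<le> (1 + norm a) * (norm (x z) + norm (y z))"
  "norm (y z) \<le> norm (x z) + norm (y z)"
proof -
  have "norm (x z - a * y z) \<le> norm (x z) + norm a * norm (y z)"
    by (metis norm_mult norm_triangle_ineq4)
  also have "\<dots> \<le> (1 + norm a) * (norm (x z) + norm (y z))"
    by (simp add: algebra_simps)
  finally show "norm (x z - a * y z) \<le> (1 + norm a) * (norm (x z) + norm (y z))" .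
qed simp

text \<open>By \<open>jensen_zero_count\<close>, a single zero of \<open>x - a * y\<close> forces
  the characteristic to grow at least like the logarithm of the radius.\<close>

lemma characteristic_unbounded:
  assumes a: "A0 = (\<lambda>z. x z - a * y z)" "A0 z1 = 0" "A0 c \<noteq> 0"
  shows "\<exists>S\<ge>1. \<forall>r\<ge>S. B \<le> characteristic c x y r"
proof -
  have A0: "A0 holomorphic_on UNIV" unfolding a(1) using x y by (intro holomorphic_intros)
  have nz: "\<exists>z. A0 z \<noteq> 0" using a(3) by blast
  from factor_zeros[of "{z1}", OF _ A0 nz] obtain zs E where
    E: "E holomorphic_on UNIV" "E z1 \<noteq> 0" "set zs \<subseteq> {z1}" "\<And>z. A0 z = (\<Prod>a\<leftarrow>zs. z - a) * E z" by auto
  have "zs \<noteq> []" using E(2) E(4)[of z1] a(2) by auto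
  then have len: "real (length zs) \<ge> 1" by (cases zs) auto
  define \<beta> where "\<beta> = ln (1 + norm a)"
  have A0_le: "norm (A0 z) \<le> exp \<beta> * (norm (x z) + norm (y z))" for z
    using norm_form_le(1)[of z a] by (simp add: a(1) \<beta>_def add_pos_nonneg)
  define R0 where "R0 = dist c z1 + 1"
  have R0: "R0 > 0" by (simp add: R0_def add_nonneg_pos)
  \<comment> \<open>Beyond this radius \<open>ln (\<rho> / R0)\<close> exceeds the prescribed bound
    together with the constants \<open>\<beta>\<close> and \<open>ln (norm (A0 c))\<close>.\<close>
  define S0 where "S0 = max 1 (R0 * exp (\<bar>B + \<beta> - ln (norm (A0 c))\<bar>))"
  have S0: "S0 > 0" by (simp add: S0_def)
  define W where "W = dist c ` {z. A0 z = 0}"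
  have W: "countable W" unfolding W_def by (intro countable_image countable_zeros A0 nz)
  have "S0 < S0 + 1" by simp
  from select_far_point[of "{}" 0, OF _ _ this W] obtain \<rho> where \<rho>: "S0 < \<rho>" "\<rho> \<notin> W" by auto
  have nz\<rho>: "A0 z \<noteq> 0" if "z \<in> sphere c \<rho>" for z using \<rho>(2) that by (auto simp: W_def)
  have R\<rho>: "R0 \<le> \<rho>" "exp (\<bar>B + \<beta> - ln (norm (A0 c))\<bar>) \<le> \<rho> / R0"
  proof -
    have *: "R0 * exp (\<bar>B + \<beta> - ln (norm (A0 c))\<bar>) \<le> \<rho>" using \<rho>(1) by (simp add: S0_def)
    then show "exp (\<bar>B + \<beta> - ln (norm (A0 c))\<bar>) \<le> \<rho> / R0" using R0 by (simp add: field_simps)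
    have "R0 * 1 \<le> R0 * exp (\<bar>B + \<beta> - ln (norm (A0 c))\<bar>)" using R0 by (intro mult_left_mono) auto
    then show "R0 \<le> \<rho>" using * by simp
  qed
  have "\<bar>B + \<beta> - ln (norm (A0 c))\<bar> \<le> ln (\<rho> / R0)"
    using R\<rho>(2) R0 S0 \<rho>(1) by (subst ln_ge_iff) auto
  also have "\<dots> \<le> real (length zs) * ln (\<rho> / R0)"
    using len R\<rho>(1) R0 mult_right_mono[OF len, of "ln (\<rho> / R0)"] by simp
  finally have "\<bar>B + \<beta> - ln (norm (A0 c))\<bar> \<le> real (length zs) * ln (\<rho> / R0)" .
  moreover have "real (length zs) * ln (\<rho> / R0) + ln (norm (A0 c)) \<le> cmean c \<rho> (\<lambda>z. ln (norm (A0 z)))"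
    using E a(3) R0 R\<rho>(1) nz\<rho> by (intro jensen_zero_count[OF E(4,1)]) (auto simp: R0_def)
  moreover have "\<dots> \<le> characteristic c x y \<rho> + \<beta>"
    using S0 \<rho>(1) nz\<rho> by (intro cmean_ln_form_le A0 A0_le) auto
  ultimately have "B \<le> characteristic c x y \<rho>" by linarith
  then have "\<forall>r\<ge>\<rho>. B \<le> characteristic c x y r"
    using characteristic_mono'[of \<rho> _ c] S0 \<rho>(1) by (meson le_less_trans less_imp_le order_trans)
  moreover have "\<rho> \<ge> 1" using \<rho>(1) by (simp add: S0_def)
  ultimately show ?thesis by blast
qed

text \<open>Near \<open>z\<close> the two quotients differ by the constant \<open>a\<close>. Bounds
  for quotients of entire functions thereby compare the derivatives of \<open>x / y\<close> with
  \<open>x / y - a\<close>.\<close>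

lemma deriv_form_quotient:
  assumes "y z \<noteq> 0"
  shows "deriv (\<lambda>z. (x z - a * y z) / y z) z = deriv (\<lambda>z. x z / y z) z"
    and "deriv (deriv (\<lambda>z. (x z - a * y z) / y z)) z = deriv (deriv (\<lambda>z. x z / y z)) z"
    and "(x z - a * y z) / y z = x z / y z - a"
proof -
  define U where "U = {z. y z \<noteq> 0}"
  have "continuous_on UNIV y" using y by (rule holomorphic_on_imp_continuous_on)
  then have U: "open U" unfolding U_def by (intro open_Collect_neq) auto
  have hol: "(\<lambda>z. x z / y z) holomorphic_on U"
    using x y by (intro holomorphic_intros) (auto simp: U_def intro: holomorphic_on_subset)
  have eq: "(x w - a * y w) / y w = x w / y w - a" if "w \<in> U" for w
    using that by (simp add: U_def field_simps)
  have d: "deriv (\<lambda>z. (x z - a * y z) / y z) w = deriv (\<lambda>z. x z / y z) w" if w: "w \<in> U" for w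
  proof -
    have ev: "eventually (\<lambda>z. (x z - a * y z) / y z = x z / y z - a) (nhds w)"
      using eventually_nhds_in_open[OF U w] by eventually_elim (rule eq)
    have "deriv (\<lambda>z. (x z - a * y z) / y z) w = deriv (\<lambda>z. x z / y z - a) w"
      using ev by (rule deriv_cong_ev) simp
    also have "\<dots> = deriv (\<lambda>z. x z / y z) w"
      using holomorphic_on_imp_differentiable_at[OF hol U w] by (subst deriv_diff) auto
    finally show ?thesis .
  qed
  have z: "z \<in> U" using assms by (simp add: U_def)
  show "deriv (\<lambda>z. (x z - a * y z) / y z) z = deriv (\<lambda>z. x z / y z) z" by (rule d[OF z])
  show "(x z - a * y z) / y z = x z / y z - a" by (rule eq[OF z])
  have "eventually (\<lambda>w. deriv (\<lambda>z. (x z - a * y z) / y z) w = deriv (\<lambda>z. x z / y z) w) (nhds z)"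
    using eventually_nhds_in_open[OF U z] by eventually_elim (rule d)
  then show "deriv (deriv (\<lambda>z. (x z - a * y z) / y z)) z = deriv (deriv (\<lambda>z. x z / y z)) z"
    by (rule deriv_cong_ev) simp
qed

end

section \<open>Jensen's inequality against decay\<close>

lemma affine_ln_less_self: "\<exists>t0\<ge>1. \<forall>t\<ge>t0. a + b * ln t < t" for a b :: real
proof -
  have "eventually (\<lambda>t::real. a + b * ln t < t) at_top" by real_asymp
  then obtain t0 where "\<forall>t\<ge>t0. a + b * ln t < t" by (auto simp: eventually_at_top_linorder)
  then show ?thesis by (intro exI[of _ "max t0 1"]) auto
qed

text \<open>This replaces both main theorems of Nevanlinna theory: a combination of logarithmic derivatives
  which is entire cannot decay along all circles on which these derivatives are of polynomial
  size in the characteristic.\<close>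
theorem no_decaying_entire_function:
  assumes v: "entire_pair x y" and w: "entire_pair \<xi> \<eta>"
    and V: "finite V" and nv: "\<And>a. \<exists>z. x z \<noteq> a * y z" "\<exists>z. y z \<noteq> 0"
    and nw: "\<And>a. \<exists>z. \<xi> z \<noteq> a * \<eta> z" "\<exists>z. \<eta> z \<noteq> 0"
    and \<Theta>: "\<Theta> holomorphic_on UNIV" "\<exists>z. \<Theta> z \<noteq> 0" and X: "countable X" and j: "j \<ge> 1"
    and bound: "\<And>z K. z \<notin> X \<Longrightarrow> K \<ge> 1 \<Longrightarrow> y z \<noteq> 0 \<Longrightarrow> \<eta> z \<noteq> 0 \<Longrightarrow>
      (\<And>a. a \<in> V \<Longrightarrow> norm (deriv (\<lambda>z. x z / y z) z) \<le> K * norm (x z / y z - a) \<and>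
        norm (deriv (deriv (\<lambda>z. x z / y z)) z) \<le> K * norm (x z / y z - a) \<and>
        norm (deriv (\<lambda>z. \<xi> z / \<eta> z) z) \<le> K * norm (\<xi> z / \<eta> z - a) \<and>
        norm (deriv (deriv (\<lambda>z. \<xi> z / \<eta> z)) z) \<le> K * norm (\<xi> z / \<eta> z - a)) \<Longrightarrow>
      norm (\<Theta> z) * ((norm (x z) + norm (y z)) * (norm (\<xi> z) + norm (\<eta> z))) ^ j \<le> D * K ^ \<kappa>"
  shows False
proof -
  interpret v: entire_pair x y by fact
  interpret w: entire_pair \<xi> \<eta> by fact
  obtain z1 where z1: "y z1 \<noteq> 0" using nv(2) by blast
  \<comment> \<open>The value of \<open>x / y\<close> at \<open>z1\<close> is certainly attained, so
    this form has the zero that \<open>characteristic_unbounded\<close> asks for.\<close>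
  define A0 where "A0 = (\<lambda>z. x z - (x z1 / y z1) * y z)"
  define Fv where "Fv = insert y ((\<lambda>a z. x z - a * y z) ` V)"
  define Fw where "Fw = insert \<eta> ((\<lambda>a z. \<xi> z - a * \<eta> z) ` V)"
  define FF where "FF = Fv \<union> Fw"
  have fin: "finite FF" using V by (simp add: FF_def Fv_def Fw_def)
  have nvA: "\<exists>z. A0 z \<noteq> 0" using nv(1)[of "x z1 / y z1"] by (auto simp: A0_def)
  have nvw: "\<exists>z. x z - a * y z \<noteq> 0" "\<exists>z. \<xi> z - a * \<eta> z \<noteq> 0" for a
    using nv(1)[of a] nw(1)[of a] by auto
  have holv: "A holomorphic_on UNIV" "\<exists>z. A z \<noteq> 0" if "A \<in> insert A0 Fv" for A
  proof -
    have "A0 holomorphic_on UNIV" unfolding A0_def using v.x v.y by (intro holomorphic_intros)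
    then show "A holomorphic_on UNIV" "\<exists>z. A z \<noteq> 0"
      using that v.x v.y nv(2) nvw(1) nvA unfolding Fv_def by (auto intro!: holomorphic_intros)
  qed
  have holw: "A holomorphic_on UNIV" "\<exists>z. A z \<noteq> 0" if "A \<in> Fw" for A
    using that w.x w.y nw(2) nvw(2) unfolding Fw_def by (auto intro!: holomorphic_intros)
  have "countable (\<Union>A\<in>insert \<Theta> (insert A0 FF). {z. A z = 0})"
  proof (intro countable_UN)
    fix A assume "A \<in> insert \<Theta> (insert A0 FF)"
    then have "A holomorphic_on UNIV \<and> (\<exists>z. A z \<noteq> 0)"
      using holv holw \<Theta> unfolding FF_def by blast
    then show "countable {z. A z = 0}" using countable_zeros by blast
  qed (use fin in \<open>auto intro: countable_finite\<close>)
  \<comment> \<open>A common centre for all uses of Jensen's inequality, off the zeros of every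
    function involved.\<close>
  then obtain c where "c \<notin> (\<Union>A\<in>insert \<Theta> (insert A0 FF). {z. A z = 0})"
    using uncountable_UNIV_complex by (metis UNIV_eq_I)
  then have c: "\<Theta> c \<noteq> 0" "A0 c \<noteq> 0" "\<And>A. A \<in> FF \<Longrightarrow> A c \<noteq> 0" by auto
  define \<beta> where "\<beta> = (\<Sum>a\<in>V. ln (1 + norm a))"
  have \<beta>0: "\<beta> \<ge> 0" unfolding \<beta>_def by (intro sum_nonneg) auto
  have ln\<beta>: "ln (1 + norm a) \<le> \<beta>" if "a \<in> V" for a
    unfolding \<beta>_def using V that by (intro member_le_sum) auto
  have \<beta>: "1 + norm a \<le> exp \<beta>" if "a \<in> V" for a
  proof -
    have "1 + norm a = exp (ln (1 + norm a))" by (simp add: add_pos_nonneg)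
    also have "\<dots> \<le> exp \<beta>" using ln\<beta>[OF that] by simp
    finally show ?thesis .
  qed
  have lev: "norm (A z) \<le> exp \<beta> * (norm (x z) + norm (y z))" if A: "A \<in> Fv" for A z
  proof -
    consider "A = y" | a where "a \<in> V" "A = (\<lambda>z. x z - a * y z)" using A unfolding Fv_def by blast
    then show ?thesis
    proof cases
      case 1
      have "1 * (norm (x z) + norm (y z)) \<le> exp \<beta> * (norm (x z) + norm (y z))"
        using \<beta>0 by (intro mult_right_mono) auto
      then show ?thesis unfolding 1 mult_1 by (rule order_trans[OF v.norm_form_le(2)])
    next
      case 2
      then show ?thesis
        using v.norm_form_le(1)[of z a] mult_right_mono[OF \<beta>[OF 2(1)], of "norm (x z) + norm (y z)"] by simp
    qed
  qed
  have lew: "norm (A z) \<le> exp \<beta> * (norm (\<xi> z) + norm (\<eta> z))" if A: "A \<in> Fw" for A z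
  proof -
    consider "A = \<eta>" | a where "a \<in> V" "A = (\<lambda>z. \<xi> z - a * \<eta> z)" using A unfolding Fw_def by blast
    then show ?thesis
    proof cases
      case 1
      have "1 * (norm (\<xi> z) + norm (\<eta> z)) \<le> exp \<beta> * (norm (\<xi> z) + norm (\<eta> z))"
        using \<beta>0 by (intro mult_right_mono) auto
      then show ?thesis unfolding 1 mult_1 by (rule order_trans[OF w.norm_form_le(2)])
    next
      case 2
      then show ?thesis
        using w.norm_form_le(1)[of z a] mult_right_mono[OF \<beta>[OF 2(1)], of "norm (\<xi> z) + norm (\<eta> z)"] by simp
    qed
  qed
  define Tv Tw where "Tv = characteristic c x y" and "Tw = characteristic c \<xi> \<eta>"
  have Tv: "Tv r \<le> Tv s" and Tw: "Tw r \<le> Tw s" if "1 \<le> r" "r \<le> s" for r s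
    using that v.characteristic_mono'[of r s c] w.characteristic_mono'[of r s c] by (auto simp: Tv_def Tw_def)
  define L where "L = (\<Sum>A\<in>FF. \<bar>ln (norm (A c))\<bar>)"
  have L: "\<bar>ln (norm (A c))\<bar> \<le> L" if "A \<in> FF" for A
    unfolding L_def using fin that by (intro member_le_sum) auto
  have L0: "L \<ge> 0" unfolding L_def by (intro sum_nonneg) auto
  \<comment> \<open>This constant makes \<open>T\<close> at least 1 and lets it dominate each
    characteristic together with \<open>\<beta>\<close> and the logarithms at \<open>c\<close>, even
    if \<open>Tv\<close> or \<open>Tw\<close> is negative at small radii.\<close>
  define H where "H = 1 + \<bar>Tv 1\<bar> + \<bar>Tw 1\<bar> + \<beta> + L"
  define T where "T = (\<lambda>r. Tv r + Tw r + H)"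
  have monoT: "T r \<le> T s" if "1 \<le> r" "r \<le> s" for r s using Tv[OF that] Tw[OF that] by (simp add: T_def)
  have T_ge: "Tv r + 1 + \<beta> + L \<le> T r" "Tw r + 1 + \<beta> + L \<le> T r" "1 + \<beta> + L \<le> T r" if "1 \<le> r" for r
    using Tv[OF order_refl that] Tw[OF order_refl that] by (auto simp: T_def H_def)
  have T1: "1 \<le> T r" if "1 \<le> r" for r using T_ge(3)[OF that] \<beta>0 L0 by linarith
  define PP where "PP = (\<lambda>a. ((\<lambda>z. x z - a * y z), y)) ` V \<union> (\<lambda>a. ((\<lambda>z. \<xi> z - a * \<eta> z), \<eta>)) ` V"
  have "\<exists>C\<ge>1. \<forall>s d Y. 1 \<le> s \<longrightarrow> 0 < d \<longrightarrow> d \<le> s \<longrightarrow> countable Y \<longrightarrow>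
    (\<exists>r. s < r \<and> r < s + d \<and> r \<notin> Y \<and> (\<forall>z\<in>sphere c r. \<forall>(A, B)\<in>PP.
      A z \<noteq> 0 \<and> B z \<noteq> 0 \<and>
      norm (deriv (\<lambda>z. A z / B z) z)
        \<le> C * (T (s + d) * (s / d) * (1 + 1 / d)) ^ 8 / d * norm (A z / B z) \<and>
      norm (deriv (deriv (\<lambda>z. A z / B z)) z)
        \<le> C * (T (s + d) * (s / d) * (1 + 1 / d)) ^ 8 / d * norm (A z / B z)))"
  proof (rule good_circle[OF fin _ _ monoT T1])
    show "PP \<subseteq> FF \<times> FF" by (auto simp: PP_def FF_def Fv_def Fw_def)
    show "A holomorphic_on UNIV \<and> A c \<noteq> 0" if "A \<in> FF" for A
      using that holv(1) holw(1) c(3) unfolding FF_def by blast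
    show "- ln (norm (A c)) \<le> T 1" if "A \<in> FF" for A
      using L[OF that] T_ge(3)[of 1] \<beta>0 by linarith
  next
    fix A \<rho> assume A: "A \<in> FF" and \<rho>: "1 \<le> \<rho>" "\<forall>z\<in>sphere c \<rho>. A z \<noteq> 0"
    show "cmean c \<rho> (\<lambda>z. ln (norm (A z))) \<le> T \<rho>"
    proof (cases "A \<in> Fv")
      case True
      then have "cmean c \<rho> (\<lambda>z. ln (norm (A z))) \<le> Tv \<rho> + \<beta>"
        unfolding Tv_def using \<rho> holv(1) lev by (intro v.cmean_ln_form_le) auto
      then show ?thesis using T_ge(1)[OF \<rho>(1)] L0 by linarith
    next
      case False
      then have "A \<in> Fw" using A by (simp add: FF_def)
      then have "cmean c \<rho> (\<lambda>z. ln (norm (A z))) \<le> Tw \<rho> + \<beta>"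
        unfolding Tw_def using \<rho> holw(1) lew by (intro w.cmean_ln_form_le) auto
      then show ?thesis using T_ge(2)[OF \<rho>(1)] L0 by linarith
    qed
  next
    fix A B \<rho> assume AB: "(A, B) \<in> PP" and \<rho>: "1 \<le> \<rho>" "\<forall>z\<in>sphere c \<rho>. A z \<noteq> 0 \<and> B z \<noteq> 0"
    have AB': "A \<in> FF" "B \<in> FF" using AB by (auto simp: PP_def FF_def Fv_def Fw_def)
    have LAB: "- ln (norm (A c)) \<le> L" "- ln (norm (B c)) \<le> L" using L[OF AB'(1)] L[OF AB'(2)] by auto
    consider "A \<in> Fv" "B \<in> Fv" | "A \<in> Fw" "B \<in> Fw" using AB by (auto simp: PP_def Fv_def Fw_def)
    then show "cmean c \<rho> (\<lambda>z. \<bar>ln (norm (A z)) - ln (norm (B z))\<bar>) \<le> 4 * T \<rho>"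
    proof cases
      case 1
      then have "cmean c \<rho> (\<lambda>z. \<bar>ln (norm (A z)) - ln (norm (B z))\<bar>) \<le>
          2 * Tv \<rho> + 2 * \<beta> - ln (norm (A c)) - ln (norm (B c))"
        unfolding Tv_def using \<rho> holv(1) lev c(3) AB' by (intro v.cmean_ln_quotient_le) auto
      then show ?thesis using T_ge(1)[OF \<rho>(1)] T1[OF \<rho>(1)] LAB by linarith
    next
      case 2
      then have "cmean c \<rho> (\<lambda>z. \<bar>ln (norm (A z)) - ln (norm (B z))\<bar>) \<le>
          2 * Tw \<rho> + 2 * \<beta> - ln (norm (A c)) - ln (norm (B c))"
        unfolding Tw_def using \<rho> holw(1) lew c(3) AB' by (intro w.cmean_ln_quotient_le) auto
      then show ?thesis using T_ge(2)[OF \<rho>(1)] T1[OF \<rho>(1)] LAB by linarith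
    qed
  qed
  then obtain C where C: "C \<ge> 1" and circ: "\<And>s d Y. 1 \<le> s \<Longrightarrow> 0 < d \<Longrightarrow> d \<le> s \<Longrightarrow> countable Y \<Longrightarrow>
    \<exists>r. s < r \<and> r < s + d \<and> r \<notin> Y \<and> (\<forall>z\<in>sphere c r. \<forall>(A, B)\<in>PP.
      A z \<noteq> 0 \<and> B z \<noteq> 0 \<and>
      norm (deriv (\<lambda>z. A z / B z) z)
        \<le> C * (T (s + d) * (s / d) * (1 + 1 / d)) ^ 8 / d * norm (A z / B z) \<and>
      norm (deriv (deriv (\<lambda>z. A z / B z)) z)
        \<le> C * (T (s + d) * (s / d) * (1 + 1 / d)) ^ 8 / d * norm (A z / B z))" by blast
  from growth_radius[of T 8, OF monoT T1] obtain C' \<kappa>' where C': "C' \<ge> 1" and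
    gr: "\<And>S. \<exists>s d. S \<le> s \<and> 1 \<le> s \<and> 0 < d \<and> d \<le> s \<and>
      (T (s + d) * (s / d) * (1 + 1 / d)) ^ 8 / d \<le> C' * T s ^ \<kappa>'" by auto
  define D' where "D' = max D 1"
  \<comment> \<open>The proof ends with a bound of \<open>T s\<close> by an affine function of
    \<open>ln (T s)\<close>; beyond \<open>t0\<close> such a bound is impossible.\<close>
  obtain t0 where t0: "t0 \<ge> 1" "\<And>t. t \<ge> t0 \<Longrightarrow>
      (H + (ln D' + real \<kappa> * ln (C * C') - ln (norm (\<Theta> c)))) + (real \<kappa> * real \<kappa>') * ln t < t"
    using affine_ln_less_self by blast
  obtain S where S: "S \<ge> 1" "\<And>r. r \<ge> S \<Longrightarrow> max t0 H \<le> Tv r + 0"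
    using v.characteristic_unbounded[of A0 "x z1 / y z1" z1 c "max t0 H"] c(2) z1
    unfolding Tv_def A0_def by auto
  define Y where "Y = dist c ` (X \<union> {z. \<Theta> z = 0} \<union> {z. y z = 0} \<union> {z. \<eta> z = 0})"
  have Y: "countable Y" unfolding Y_def
    by (intro countable_image countable_Un X countable_zeros \<Theta> v.y w.y nv nw)
  from gr[of S] obtain s d where s: "S \<le> s" "1 \<le> s" and d: "0 < d" "d \<le> s"
    and gsd: "(T (s + d) * (s / d) * (1 + 1 / d)) ^ 8 / d \<le> C' * T s ^ \<kappa>'" by blast
  from circ[OF s(2) d Y] obtain r where r: "s < r" "r \<notin> Y" and
    rc: "\<And>z A B. z \<in> sphere c r \<Longrightarrow> (A, B) \<in> PP \<Longrightarrow> A z \<noteq> 0 \<and> B z \<noteq> 0 \<and>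
      norm (deriv (\<lambda>z. A z / B z) z)
        \<le> C * (T (s + d) * (s / d) * (1 + 1 / d)) ^ 8 / d * norm (A z / B z) \<and>
      norm (deriv (deriv (\<lambda>z. A z / B z)) z)
        \<le> C * (T (s + d) * (s / d) * (1 + 1 / d)) ^ 8 / d * norm (A z / B z)" by blast
  define K where "K = C * C' * T s ^ \<kappa>'"
  have Ts: "T s \<ge> 1" using s T1 by simp
  have K1: "K \<ge> 1" unfolding K_def using C C' Ts by (intro mult_ge1_I one_le_power) auto
  have "C * ((T (s + d) * (s / d) * (1 + 1 / d)) ^ 8 / d) \<le> C * (C' * T s ^ \<kappa>')"
    using C gsd by (intro mult_left_mono) auto
  then have leK: "C * (T (s + d) * (s / d) * (1 + 1 / d)) ^ 8 / d \<le> K" by (simp add: K_def)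
  have off: "z \<notin> X" "\<Theta> z \<noteq> 0" "y z \<noteq> 0" "\<eta> z \<noteq> 0" if "z \<in> sphere c r" for z
    using r(2) that by (auto simp: Y_def)
  have \<Theta>le: "ln (norm (\<Theta> z)) \<le> (ln D' + real \<kappa> * ln K) -
      real j * (ln (norm (x z) + norm (y z)) + ln (norm (\<xi> z) + norm (\<eta> z)))"
    if z: "z \<in> sphere c r" for z
  proof -
    have "norm (deriv (\<lambda>z. x z / y z) z) \<le> K * norm (x z / y z - a) \<and>
        norm (deriv (deriv (\<lambda>z. x z / y z)) z) \<le> K * norm (x z / y z - a) \<and>
        norm (deriv (\<lambda>z. \<xi> z / \<eta> z) z) \<le> K * norm (\<xi> z / \<eta> z - a) \<and>
        norm (deriv (deriv (\<lambda>z. \<xi> z / \<eta> z)) z) \<le> K * norm (\<xi> z / \<eta> z - a)" if a: "a \<in> V" for a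
    proof -
      have "((\<lambda>z. x z - a * y z), y) \<in> PP" "((\<lambda>z. \<xi> z - a * \<eta> z), \<eta>) \<in> PP" using a by (auto simp: PP_def)
      from rc[OF z this(1)] rc[OF z this(2)] show ?thesis
        unfolding v.deriv_form_quotient[OF off(3)[OF z]] w.deriv_form_quotient[OF off(4)[OF z]]
        using leK by (meson mult_right_mono norm_ge_zero order_trans)
    qed
    from bound[OF off(1)[OF z] K1 off(3,4)[OF z] this]
    have "norm (\<Theta> z) * ((norm (x z) + norm (y z)) * (norm (\<xi> z) + norm (\<eta> z))) ^ j \<le> D * K ^ \<kappa>" .
    also have "\<dots> \<le> D' * K ^ \<kappa>" using K1 by (intro mult_right_mono) (auto simp: D'_def)
    finally have le: "norm (\<Theta> z) * ((norm (x z) + norm (y z)) * (norm (\<xi> z) + norm (\<eta> z))) ^ j \<le> D' * K ^ \<kappa>" .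
    have p: "norm (\<Theta> z) > 0" "norm (x z) + norm (y z) > 0" "norm (\<xi> z) + norm (\<eta> z) > 0" "D' > 0"
      using off(2)[OF z] v.norm_pos w.norm_pos by (auto simp: D'_def)
    have "ln (norm (\<Theta> z) * ((norm (x z) + norm (y z)) * (norm (\<xi> z) + norm (\<eta> z))) ^ j) \<le> ln (D' * K ^ \<kappa>)"
      using le p by (intro ln_mono) auto
    moreover have "ln (norm (\<Theta> z) * ((norm (x z) + norm (y z)) * (norm (\<xi> z) + norm (\<eta> z))) ^ j)
        = ln (norm (\<Theta> z)) + real j * (ln (norm (x z) + norm (y z)) + ln (norm (\<xi> z) + norm (\<eta> z)))"
      using p by (simp add: ln_mult ln_realpow)
    moreover have "ln (D' * K ^ \<kappa>) = ln D' + real \<kappa> * ln K" using p K1 by (simp add: ln_mult ln_realpow)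
    ultimately show ?thesis by linarith
  qed
  have r0: "r > 0" using s r by simp
  have "ln (norm (\<Theta> c)) \<le> cmean c r (\<lambda>z. ln (norm (\<Theta> z)))"
    using \<Theta>(1) c(1) r0 off(2) by (intro jensen_inequality) auto
  also have "\<dots> \<le> cmean c r (\<lambda>z. (ln D' + real \<kappa> * ln K) -
      real j * (ln (norm (x z) + norm (y z)) + ln (norm (\<xi> z) + norm (\<eta> z))))"
    using r0 off(2) \<Theta>(1) \<Theta>le
    by (intro cmean_mono continuous_on_ln_norm continuous_on_diff continuous_on_mult continuous_on_add
        continuous_on_const v.continuous_on_ln_pair w.continuous_on_ln_pair)
      (auto intro: holomorphic_on_imp_continuous_on holomorphic_on_subset)
  also have "\<dots> = (ln D' + real \<kappa> * ln K) - real j * (Tv r + Tw r)"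
  proof -
    have "cmean c r (\<lambda>z. ln (norm (x z) + norm (y z)) + ln (norm (\<xi> z) + norm (\<eta> z))) = Tv r + Tw r"
      unfolding Tv_def Tw_def characteristic_def using r0
      by (intro cmean_add v.continuous_on_ln_pair w.continuous_on_ln_pair) auto
    then show ?thesis using r0
      by (subst cmean_diff) (auto simp: cmean_cmult intro!: continuous_on_mult continuous_on_add
          v.continuous_on_ln_pair w.continuous_on_ln_pair)
  qed
  finally have fin1: "real j * (Tv r + Tw r) \<le> ln D' + real \<kappa> * ln K - ln (norm (\<Theta> c))" by simp
  have "max t0 H \<le> Tv s" "Tv s \<le> Tv r" "Tw s \<le> Tw r" "- \<bar>Tw 1\<bar> \<le> Tw s"
    using S(2)[OF s(1)] Tv[OF s(2)] Tw[OF s(2)] Tw[OF order_refl s(2)] r(1) by auto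
  then have big: "T s - H \<le> Tv r + Tw r" "0 \<le> T s - H" "t0 \<le> T s"
    using \<beta>0 L0 by (auto simp: T_def H_def)
  have "T s - H \<le> real j * (Tv r + Tw r)"
  proof -
    have "0 \<le> Tv r + Tw r" using big(1,2) by linarith
    then have "1 * (Tv r + Tw r) \<le> real j * (Tv r + Tw r)" using j by (intro mult_right_mono) auto
    then show ?thesis using big(1) unfolding mult_1 by (rule order_trans[rotated])
  qed
  also have "\<dots> \<le> ln D' + real \<kappa> * ln K - ln (norm (\<Theta> c))" by (rule fin1)
  also have "ln K = ln (C * C') + real \<kappa>' * ln (T s)"
    unfolding K_def using C C' Ts by (simp add: ln_mult ln_realpow)
  finally show False using t0(2)[OF big(3)] by (simp add: algebra_simps)
qed

section \<open>Orders at a point\<close>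

text \<open>A lower bound for the order on a punctured neighbourhood, so that dummy values at poles
  do not interfere. A function vanishing identically near \<open>z\<close> satisfies every such
  bound, hence sums and differences require no case distinction.\<close>

definition ordge :: "(complex \<Rightarrow> complex) \<Rightarrow> complex \<Rightarrow> int \<Rightarrow> bool" where
  "ordge h z i \<longleftrightarrow> (\<exists>k. k analytic_on {z} \<and> (\<forall>\<^sub>F w in at z. h w = k w * (w - z) powi i))"

definition ordeq :: "(complex \<Rightarrow> complex) \<Rightarrow> complex \<Rightarrow> int \<Rightarrow> bool" where
  "ordeq h z i \<longleftrightarrow> (\<exists>k. k analytic_on {z} \<and> k z \<noteq> 0 \<and> (\<forall>\<^sub>F w in at z. h w = k w * (w - z) powi i))"

lemma eventually_neq: "\<forall>\<^sub>F w in at z. w \<noteq> (z::complex)"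
  by (simp add: eventually_at_filter)

lemma analytic_eventually_neq_0:
  assumes "k analytic_on {z}" "k z \<noteq> 0"
  shows "\<forall>\<^sub>F w in at z. k w \<noteq> 0"
proof -
  have "k \<midarrow>z\<rightarrow> k z" using assms(1) by (simp add: analytic_at_imp_isCont isContD)
  then show ?thesis using assms(2) by (rule tendsto_imp_eventually_ne)
qed

lemma ordeq_imp_ordge: "ordeq h z i \<Longrightarrow> ordge h z i"
  by (auto simp: ordeq_def ordge_def)

lemma ordge_cong:
  assumes "\<forall>\<^sub>F w in at z. h w = h' w" "ordge h' z i"
  shows "ordge h z i"
proof -
  from assms(2) obtain k where k: "k analytic_on {z}" "\<forall>\<^sub>F w in at z. h' w = k w * (w - z) powi i"
    by (auto simp: ordge_def)
  from assms(1) k(2) have "\<forall>\<^sub>F w in at z. h w = k w * (w - z) powi i" by eventually_elim simp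
  with k(1) show ?thesis unfolding ordge_def by blast
qed

lemma ordeq_cong:
  assumes "\<forall>\<^sub>F w in at z. h w = h' w" "ordeq h' z i"
  shows "ordeq h z i"
proof -
  from assms(2) obtain k where k: "k analytic_on {z}" "k z \<noteq> 0" "\<forall>\<^sub>F w in at z. h' w = k w * (w - z) powi i"
    by (auto simp: ordeq_def)
  from assms(1) k(3) have "\<forall>\<^sub>F w in at z. h w = k w * (w - z) powi i" by eventually_elim simp
  with k(1,2) show ?thesis unfolding ordeq_def by blast
qed

lemma ordge_mult:
  assumes "ordge f z i" "ordge g z j"
  shows "ordge (\<lambda>w. f w * g w) z (i + j)"
proof -
  from assms obtain k l where "k analytic_on {z}" "\<forall>\<^sub>F w in at z. f w = k w * (w - z) powi i"
    "l analytic_on {z}" "\<forall>\<^sub>F w in at z. g w = l w * (w - z) powi j"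
    by (auto simp: ordge_def)
  moreover from this(2,4) eventually_neq have "\<forall>\<^sub>F w in at z. f w * g w = (k w * l w) * (w - z) powi (i + j)"
    by eventually_elim (simp add: power_int_add)
  ultimately show ?thesis unfolding ordge_def by (intro exI[of _ "\<lambda>w. k w * l w"]) (auto intro: analytic_intros)
qed

lemma ordeq_mult:
  assumes "ordeq f z i" "ordeq g z j"
  shows "ordeq (\<lambda>w. f w * g w) z (i + j)"
proof -
  from assms obtain k l where "k analytic_on {z}" "k z \<noteq> 0" "\<forall>\<^sub>F w in at z. f w = k w * (w - z) powi i"
    "l analytic_on {z}" "l z \<noteq> 0" "\<forall>\<^sub>F w in at z. g w = l w * (w - z) powi j"
    by (auto simp: ordeq_def)
  moreover from this(3,6) eventually_neq have "\<forall>\<^sub>F w in at z. f w * g w = (k w * l w) * (w - z) powi (i + j)"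
    by eventually_elim (simp add: power_int_add)
  ultimately show ?thesis unfolding ordeq_def by (intro exI[of _ "\<lambda>w. k w * l w"]) (auto intro: analytic_intros)
qed

lemma ordeq_inverse:
  assumes "ordeq f z i"
  shows "ordeq (\<lambda>w. 1 / f w) z (- i)"
proof -
  from assms obtain k where k: "k analytic_on {z}" "k z \<noteq> 0" "\<forall>\<^sub>F w in at z. f w = k w * (w - z) powi i"
    by (auto simp: ordeq_def)
  from k(3) have "\<forall>\<^sub>F w in at z. 1 / f w = (1 / k w) * (w - z) powi (- i)"
    by eventually_elim (simp add: power_int_minus field_simps)
  then show ?thesis unfolding ordeq_def using k
    by (intro exI[of _ "\<lambda>w. 1 / k w"]) (auto intro!: analytic_intros)
qed

lemma ordge_mono:
  assumes "ordge f z i" "j \<le> i"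
  shows "ordge f z j"
proof -
  from assms obtain k where k: "k analytic_on {z}" "\<forall>\<^sub>F w in at z. f w = k w * (w - z) powi i"
    by (auto simp: ordge_def)
  obtain n where n: "i = int n + j" using assms(2) by (metis add.commute zle_iff_zadd)
  from k(2) eventually_neq have "\<forall>\<^sub>F w in at z. f w = (k w * (w - z) ^ n) * (w - z) powi j"
    by eventually_elim (simp add: n power_int_add)
  then show ?thesis unfolding ordge_def using k(1)
    by (intro exI[of _ "\<lambda>w. k w * (w - z) ^ n"]) (auto intro!: analytic_intros)
qed

lemma ordge_add:
  assumes "ordge f z i" "ordge g z i"
  shows "ordge (\<lambda>w. f w + g w) z i" and "ordge (\<lambda>w. f w - g w) z i"
proof -
  from assms obtain k l where kl: "k analytic_on {z}" "\<forall>\<^sub>F w in at z. f w = k w * (w - z) powi i"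
    "l analytic_on {z}" "\<forall>\<^sub>F w in at z. g w = l w * (w - z) powi i"
    by (auto simp: ordge_def)
  from kl(2,4) have "\<forall>\<^sub>F w in at z. f w + g w = (k w + l w) * (w - z) powi i"
    by eventually_elim (simp add: algebra_simps)
  then show "ordge (\<lambda>w. f w + g w) z i" unfolding ordge_def using kl
    by (intro exI[of _ "\<lambda>w. k w + l w"]) (auto intro: analytic_intros)
  from kl(2,4) have "\<forall>\<^sub>F w in at z. f w - g w = (k w - l w) * (w - z) powi i"
    by eventually_elim (simp add: algebra_simps)
  then show "ordge (\<lambda>w. f w - g w) z i" unfolding ordge_def using kl
    by (intro exI[of _ "\<lambda>w. k w - l w"]) (auto intro: analytic_intros)
qed

lemma ordge_const: "ordge (\<lambda>_. a) z 0"
  unfolding ordge_def by (intro exI[of _ "\<lambda>_. a"]) auto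

lemma ordge_power:
  assumes "ordge f z i"
  shows "ordge (\<lambda>w. f w ^ n) z (int n * i)"
proof (induction n)
  case (Suc n)
  from ordge_mult[OF assms Suc] show ?case by (simp add: algebra_simps)
qed (simp add: ordge_const)

lemma ordge_analytic: "f analytic_on {z} \<Longrightarrow> ordge f z 0"
  unfolding ordge_def by auto

lemma ordeq_analytic: "f analytic_on {z} \<Longrightarrow> f z \<noteq> 0 \<Longrightarrow> ordeq f z 0"
  unfolding ordeq_def by auto

lemma ordeq_zorder:
  assumes "f meromorphic_on {z}" "\<forall>\<^sub>F w in at z. f w \<noteq> 0"
  shows "ordeq f z (zorder f z)"
proof -
  have "\<exists>\<^sub>F w in at z. f w \<noteq> 0" using assms(2) by (simp add: eventually_frequently)
  from zorder_exist[OF _ _ this] assms(1) obtain r where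
    r: "zor_poly f z z \<noteq> 0" "r > 0" "zor_poly f z holomorphic_on cball z r"
    "\<forall>w\<in>cball z r - {z}. f w = zor_poly f z w * (w - z) powi zorder f z \<and> zor_poly f z w \<noteq> 0"
    unfolding meromorphic_at_iff by blast
  have "zor_poly f z analytic_on {z}"
    using r(2,3) by (auto simp: analytic_at intro!: exI[of _ "ball z r"] intro: holomorphic_on_subset)
  moreover have "\<forall>\<^sub>F w in at z. w \<in> ball z r - {z}" using r(2) by (intro eventually_at_in_open) auto
  then have "\<forall>\<^sub>F w in at z. f w = zor_poly f z w * (w - z) powi zorder f z"
    by eventually_elim (use r(4) in auto)
  ultimately show ?thesis using r(1) unfolding ordeq_def by blast
qed

lemma ordge_analytic_zero:
  assumes "f analytic_on {z}" "f z = 0"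
  shows "ordge f z 1"
proof (cases "\<forall>\<^sub>F w in at z. f w \<noteq> 0")
  case True
  have "f meromorphic_on {z}" using assms(1) by (rule analytic_on_imp_meromorphic_on)
  from ordeq_zorder[OF this True] have "ordge f z (zorder f z)" by (rule ordeq_imp_ordge)
  moreover have "zorder f z > 0"
    using zorder_pos_iff'[OF assms(1)] assms(2) True by (simp add: eventually_frequently)
  ultimately show ?thesis by (auto intro: ordge_mono)
next
  case False
  then have "\<exists>\<^sub>F w in at z. f w = 0" by (simp add: not_eventually)
  then have "\<forall>\<^sub>F w in at z. f w = 0"
    using assms(1) by (intro not_essential_frequently_0_imp_eventually_0)
      (auto simp: not_essential_analytic isolated_singularity_at_analytic)
  then show ?thesis unfolding ordge_def by (intro exI[of _ "\<lambda>_. 0"]) auto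
qed

text \<open>By the product rule. The bracket takes the value \<open>of_int i * k z\<close> at
  \<open>z\<close>, so the order drops by exactly one when \<open>i\<close> and \<open>k z\<close>
  are nonzero.\<close>

lemma deriv_local_form:
  assumes k: "k analytic_on {z}" "\<forall>\<^sub>F w in at z. h w = k w * (w - z) powi i"
  shows "deriv k analytic_on {z}"
    and "\<forall>\<^sub>F w in at z. deriv h w = (deriv k w * (w - z) + of_int i * k w) * (w - z) powi (i - 1)"
proof -
  from k(1) obtain A where A: "open A" "z \<in> A" "k holomorphic_on A" by (auto simp: analytic_at)
  from k(2) obtain B where B: "open B" "z \<in> B" "\<And>w. w \<in> B \<Longrightarrow> w \<noteq> z \<Longrightarrow> h w = k w * (w - z) powi i"
    unfolding eventually_at_topological by blast
  define U where "U = A \<inter> B - {z}"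
  have U: "open U" using A B by (auto simp: U_def)
  have d: "deriv h w = (deriv k w * (w - z) + of_int i * k w) * (w - z) powi (i - 1)" if w: "w \<in> U" for w
  proof -
    have wz: "w - z \<noteq> 0" using w by (auto simp: U_def)
    have "(k has_field_derivative deriv k w) (at w)"
      using A w by (intro holomorphic_derivI[of k A]) (auto simp: U_def)
    moreover have "((\<lambda>w. (w - z) powi i) has_field_derivative of_int i * (w - z) powi (i - 1) * 1) (at w)"
      using wz by (auto intro!: derivative_eq_intros)
    ultimately have "((\<lambda>w. k w * (w - z) powi i) has_field_derivative
        deriv k w * (w - z) powi i + of_int i * (w - z) powi (i - 1) * 1 * k w) (at w)"
      by (rule DERIV_mult)
    then have "(h has_field_derivative
        deriv k w * (w - z) powi i + of_int i * (w - z) powi (i - 1) * 1 * k w) (at w)"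
      by (rule has_field_derivative_transform_within_open[OF _ U w]) (use B in \<open>auto simp: U_def\<close>)
    moreover have "(w - z) powi i = (w - z) * (w - z) powi (i - 1)"
      using wz by (simp add: power_int_diff)
    ultimately show ?thesis by (simp add: DERIV_imp_deriv algebra_simps)
  qed
  have "\<forall>\<^sub>F w in at z. w \<in> U"
    using eventually_at_in_open[of "A \<inter> B" z] A B by (auto simp: U_def)
  then show "\<forall>\<^sub>F w in at z. deriv h w = (deriv k w * (w - z) + of_int i * k w) * (w - z) powi (i - 1)"
    by eventually_elim (rule d)
  show "deriv k analytic_on {z}" using A by (auto simp: analytic_at intro: holomorphic_deriv)
qed

lemma ordge_deriv:
  assumes "ordge h z i"
  shows "ordge (deriv h) z (i - 1)"
proof -
  from assms obtain k where k: "k analytic_on {z}" "\<forall>\<^sub>F w in at z. h w = k w * (w - z) powi i"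
    by (auto simp: ordge_def)
  note deriv_local_form[OF k]
  then show ?thesis unfolding ordge_def using k(1)
    by (intro exI[of _ "\<lambda>w. deriv k w * (w - z) + of_int i * k w"]) (auto intro!: analytic_intros)
qed

text \<open>The value of \<open>k\<close> at \<open>z\<close> is the residue. At a point over
  \<open>S1\<close> it is the multiplicity, so the poles of \<open>D f\<close> and
  \<open>D g\<close> cancel where the multiplicities agree.\<close>

lemma log_deriv_expansion:
  assumes "ordeq h z i"
  shows "\<exists>k. k analytic_on {z} \<and> k z = of_int i \<and> (\<forall>\<^sub>F w in at z. deriv h w / h w = k w / (w - z))"
proof -
  from assms obtain k where k: "k analytic_on {z}" "k z \<noteq> 0" "\<forall>\<^sub>F w in at z. h w = k w * (w - z) powi i"
    by (auto simp: ordeq_def)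
  define l where "l = (\<lambda>w. deriv k w / k w * (w - z) + of_int i)"
  note d = deriv_local_form[OF k(1,3)]
  from d(2) k(3) analytic_eventually_neq_0[OF k(1,2)] eventually_neq
  have "\<forall>\<^sub>F w in at z. deriv h w / h w = l w / (w - z)"
  proof eventually_elim
    case (elim w)
    then have wz: "w - z \<noteq> 0" "(w - z) powi (i - 1) \<noteq> 0" "h w = k w * ((w - z) * (w - z) powi (i - 1))"
      by (auto simp: power_int_diff)
    show ?case unfolding elim(1) wz(3) l_def using wz(1,2) elim(3) by (simp add: field_simps)
  qed
  moreover have "l analytic_on {z}" unfolding l_def using k d by (intro analytic_intros) auto
  ultimately show ?thesis by (intro exI[of _ l]) (auto simp: l_def)
qed

lemma ordge_log_deriv:
  assumes "ordeq h z i"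
  shows "ordge (\<lambda>w. deriv h w / h w) z (-1)"
  using log_deriv_expansion[OF assms] unfolding ordge_def
  by (auto simp: power_int_minus divide_inverse)

text \<open>The regular part \<open>deriv k w / k w\<close> is kept because the vanishing of
  \<open>H\<close> at simple shared zeros depends on it.\<close>

lemma log_deriv_simple_pole:
  assumes k: "k analytic_on {z}" "k z \<noteq> 0" and D: "\<forall>\<^sub>F w in at z. D w = k w / (w - z)"
  shows "\<forall>\<^sub>F w in at z. deriv D w / D w = deriv k w / k w - 1 / (w - z)"
proof -
  from D have "\<forall>\<^sub>F w in at z. D w = k w * (w - z) powi (-1)"
    by eventually_elim (simp add: power_int_minus divide_inverse)
  from deriv_local_form(2)[OF k(1) this] D analytic_eventually_neq_0[OF k] eventually_neq
  show ?thesis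
  proof eventually_elim
    case (elim w)
    have alg: "((k' * u - l) * inverse (u ^ 2)) / (l / u) = k' / l - 1 / u" if "u \<noteq> 0" "l \<noteq> 0" for k' u l :: complex
      using that by (simp add: field_simps power2_eq_square)
    have "(w - z) powi (-1 - 1) = inverse ((w - z) ^ 2)" by (simp add: power_int_minus)
    then show ?case unfolding elim(1,2) using alg[of "w - z" "k w" "deriv k w"] elim(3,4) by simp
  qed
qed

lemma ordge_prod:
  assumes "finite S" "\<And>a. a \<in> S \<Longrightarrow> ordge (F a) z (e a)"
  shows "ordge (\<lambda>w. \<Prod>a\<in>S. F a w) z (\<Sum>a\<in>S. e a)"
  using assms
proof (induction S rule: finite_induct)
  case (insert a S)
  then show ?case using ordge_mult[of "F a" z "e a" "\<lambda>w. \<Prod>a\<in>S. F a w"] by simp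
qed (simp add: ordge_const)

lemma ordge_0_everywhere_imp_entire:
  assumes "\<Theta> meromorphic_on UNIV" "\<And>z. ordge \<Theta> z 0"
  shows "remove_sings \<Theta> holomorphic_on UNIV"
proof -
  have "remove_sings \<Theta> analytic_on {z}" for z
  proof -
    from assms(2)[of z] obtain k where k: "k analytic_on {z}" "\<forall>\<^sub>F w in at z. \<Theta> w = k w"
      by (auto simp: ordge_def)
    have "k \<midarrow>z\<rightarrow> k z" using k(1) by (simp add: analytic_at_imp_isCont isContD)
    then have "\<Theta> \<midarrow>z\<rightarrow> k z" using k(2) by (simp add: filterlim_cong)
    moreover have "isolated_singularity_at \<Theta> z" using assms(1) by (auto simp: meromorphic_on_altdef)
    ultimately show ?thesis by (intro remove_sings_analytic_at)
  qed
  then show ?thesis by (metis analytic_imp_holomorphic analytic_on_analytic_at)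
qed

definition invprod :: "complex set \<Rightarrow> (complex \<Rightarrow> complex) \<Rightarrow> complex \<Rightarrow> complex" where
  "invprod S f w = (\<Prod>a\<in>S. 1 / (f w - a))"

lemma ordeq_diff_const_pole:
  assumes "ordeq f z (- int p)" "p \<ge> 1"
  shows "ordeq (\<lambda>w. f w - a) z (- int p)"
proof -
  from assms obtain k where k: "k analytic_on {z}" "k z \<noteq> 0" "\<forall>\<^sub>F w in at z. f w = k w * (w - z) powi (- int p)"
    by (auto simp: ordeq_def)
  from k(3) eventually_neq have "\<forall>\<^sub>F w in at z. f w - a = (k w - a * (w - z) ^ p) * (w - z) powi (- int p)"
    by eventually_elim (simp add: power_int_minus field_simps)
  then show ?thesis unfolding ordeq_def using k assms(2)
    by (intro exI[of _ "\<lambda>w. k w - a * (w - z) ^ p"]) (auto intro!: analytic_intros)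
qed

lemma ordge_invprod_pole:
  assumes "ordeq f z (- int p)" "p \<ge> 1" "finite S"
  shows "ordge (invprod S f) z (int (card S) * int p)"
proof -
  have "ordge (\<lambda>w. 1 / (f w - a)) z (int p)" for a
    using ordeq_imp_ordge[OF ordeq_inverse[OF ordeq_diff_const_pole[OF assms(1,2), of a]]] by simp
  from ordge_prod[OF assms(3) this] show ?thesis unfolding invprod_def[abs_def] by simp
qed

lemma ordge_invprod_value:
  assumes f: "f analytic_on {z}" and m: "ordeq (\<lambda>w. f w - f z) z m" and S: "finite S"
  shows "ordge (invprod S f) z (if f z \<in> S then - m else 0)"
proof -
  have "ordge (\<lambda>w. 1 / (f w - a)) z (if a = f z then - m else 0)" for a
  proof (cases "a = f z")
    case True
    then show ?thesis using ordeq_imp_ordge[OF ordeq_inverse[OF m]] by simp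
  next
    case False
    then have "(\<lambda>w. 1 / (f w - a)) analytic_on {z}" using f by (intro analytic_intros) auto
    then show ?thesis using False by (simp add: ordge_analytic)
  qed
  then have "ordge (\<lambda>w. \<Prod>a\<in>S. 1 / (f w - a)) z (\<Sum>a\<in>S. if a = f z then - m else 0)"
    by (intro ordge_prod[OF S, where F = "\<lambda>a w. 1 / (f w - a)"])
  also have "(\<Sum>a\<in>S. if a = f z then - m else 0) = (if f z \<in> S then - m else 0)"
    using S by (simp add: sum.delta)
  finally show ?thesis unfolding invprod_def[abs_def] .
qed

lemma ordeq_eventually_neq_0:
  assumes "ordeq h z i"
  shows "\<forall>\<^sub>F w in at z. h w \<noteq> 0"
proof -
  from assms obtain k where k: "k analytic_on {z}" "k z \<noteq> 0" "\<forall>\<^sub>F w in at z. h w = k w * (w - z) powi i"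
    by (auto simp: ordeq_def)
  from k(3) analytic_eventually_neq_0[OF k(1,2)] eventually_neq show ?thesis
    by eventually_elim simp
qed

lemma ordeq_deriv:
  assumes "ordeq h z i" "i \<noteq> 0"
  shows "ordeq (deriv h) z (i - 1)"
proof -
  from assms obtain k where k: "k analytic_on {z}" "k z \<noteq> 0" "\<forall>\<^sub>F w in at z. h w = k w * (w - z) powi i"
    by (auto simp: ordeq_def)
  note deriv_local_form[OF k(1,3)]
  then show ?thesis unfolding ordeq_def using k assms(2)
    by (intro exI[of _ "\<lambda>w. deriv k w * (w - z) + of_int i * k w"]) (auto intro!: analytic_intros)
qed

text \<open>Differentiability is not assumed: \<open>deriv\<close> is defined by choice, and both
  functions have the same candidates for a derivative.\<close>

lemma deriv_minus_const: "deriv (\<lambda>w. f w - c) = deriv f" for f :: "complex \<Rightarrow> complex"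
proof
  fix z
  have "((\<lambda>w. f w - c) has_field_derivative D) (at z) \<longleftrightarrow> (f has_field_derivative D) (at z)" for D
    using DERIV_diff[OF _ DERIV_const, of f D z UNIV c] DERIV_add[OF _ DERIV_const, of "\<lambda>w. f w - c" D z UNIV c]
    by auto
  then show "deriv (\<lambda>w. f w - c) z = deriv f z" by (simp add: deriv_def)
qed

lemma eventually_cosparse_countable:
  assumes "eventually P (cosparse (UNIV :: complex set))"
  shows "countable {z. \<not> P z}"
  using assms by (intro no_limpt_imp_countable) (auto simp: eventually_cosparse sparse_in_def)

lemma eventually_cosparse_UNIV_iff: "eventually P (cosparse UNIV) \<longleftrightarrow> (\<forall>z. eventually P (at z))"
  by (simp add: eventually_cosparse_open_eq)

section \<open>Meromorphic functions as quotients\<close>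

text \<open>The equation \<open>quot\<close> holds even at the poles, since the dummy value 0 there
  agrees with division by \<open>y z = 0\<close>. By \<open>y_order\<close> the zeros of
  \<open>y\<close> carry the pole orders of \<open>f\<close>.\<close>

locale mero_quotient =
  fixes f x y :: "complex \<Rightarrow> complex"
  assumes f: "nonconst_meromorphic f" and pair: "entire_pair x y" and quot: "f = (\<lambda>z. x z / y z)"
    and y_zero: "y z = 0 \<longleftrightarrow> is_pole f z"
    and y_order: "is_pole f z \<Longrightarrow> zorder y z = - zorder f z"
begin

lemma mero: "f meromorphic_on A"
  using f unfolding nonconst_meromorphic_def nicely_meromorphic_on_def by (auto intro: meromorphic_on_subset)

lemma cosparse_neq: "eventually (\<lambda>z. f z \<noteq> a) (cosparse UNIV)"
  using f nicely_meromorphic_imp_constant_or_avoid[of f UNIV a]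
  unfolding nonconst_meromorphic_def constant_on_def by auto

lemma eventually_neq_at: "\<forall>\<^sub>F w in at z. f w \<noteq> a"
  using cosparse_neq[of a] by (simp add: eventually_cosparse_UNIV_iff)

lemma y_nonzero: "\<exists>z. y z \<noteq> 0"
proof -
  have "eventually (\<lambda>z. \<not> is_pole f z) (cosparse UNIV)"
    using mero by (rule meromorphic_on_imp_not_pole_cosparse)
  then have "\<forall>\<^sub>F z in at 0. \<not> is_pole f z" by (simp add: eventually_cosparse_UNIV_iff)
  then obtain z where "\<not> is_pole f z" using eventually_happens'[OF at_neq_bot] by blast
  then show ?thesis using y_zero by blast
qed

lemma x_neq: "\<exists>z. x z \<noteq> a * y z"
proof (rule ccontr)
  assume "\<not> ?thesis"
  then have eq: "x z = a * y z" for z by auto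
  have "eventually (\<lambda>z. \<not> is_pole f z) (cosparse UNIV)"
    using mero by (rule meromorphic_on_imp_not_pole_cosparse)
  then have "\<forall>\<^sub>F z in at 0. \<not> is_pole f z" by (simp add: eventually_cosparse_UNIV_iff)
  with eventually_neq_at[of a 0] have "\<forall>\<^sub>F z in at (0::complex). False"
  proof eventually_elim
    case (elim z)
    then have "y z \<noteq> 0" using y_zero by blast
    moreover have "f z = x z / y z" by (rule fun_cong[OF quot])
    ultimately show ?case using eq[of z] elim by simp
  qed
  then show False by simp
qed

lemma pole_order:
  assumes "is_pole f z"
  obtains p where "p \<ge> 1" "ordeq f z (- int p)" "ordeq y z (int p)"
proof -
  define p where "p = nat (- zorder f z)"
  have "isolated_singularity_at f z" using mero[of "{z}"] by (simp add: meromorphic_at_iff)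
  then have neg: "zorder f z < 0" using assms isolated_pole_imp_neg_zorder by blast
  interpret entire_pair x y by (rule pair)
  have "ordeq f z (zorder f z)" using mero eventually_neq_at by (rule ordeq_zorder)
  moreover have "ordeq y z (zorder y z)"
  proof (rule ordeq_zorder)
    have ya: "y analytic_on {z}" using y by (simp add: analytic_on_holomorphic) blast
    then show "y meromorphic_on {z}" by (rule analytic_on_imp_meromorphic_on)
    show "\<forall>\<^sub>F w in at z. y w \<noteq> 0"
      using non_zero_neighbour_alt[OF y, of z] y_nonzero connected_UNIV by auto
  qed
  ultimately show thesis
    using that[of p] neg y_order[OF assms] by (simp add: p_def)
qed

lemma value_order:
  assumes "\<not> is_pole f z"
  shows "f analytic_on {z}" "nat (zorder (\<lambda>w. f w - f z) z) \<ge> 1"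
    "ordeq (\<lambda>w. f w - f z) z (int (nat (zorder (\<lambda>w. f w - f z) z)))"
proof -
  show an: "f analytic_on {z}"
    using f assms unfolding nonconst_meromorphic_def by (auto intro: nicely_meromorphic_on_imp_analytic_at)
  then have an': "(\<lambda>w. f w - f z) analytic_on {z}" by (intro analytic_intros) auto
  have ev: "\<forall>\<^sub>F w in at z. f w - f z \<noteq> 0" using eventually_neq_at[of "f z" z] by simp
  have pos: "zorder (\<lambda>w. f w - f z) z > 0"
    using zorder_pos_iff'[OF an'] ev by (simp add: eventually_frequently)
  then show "nat (zorder (\<lambda>w. f w - f z) z) \<ge> 1" by simp
  show "ordeq (\<lambda>w. f w - f z) z (int (nat (zorder (\<lambda>w. f w - f z) z)))"
    using ordeq_zorder[OF analytic_on_imp_meromorphic_on[OF an'] ev] pos by simp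
qed

lemma deriv_order_value:
  assumes "ordeq (\<lambda>w. f w - f z) z m"
  shows "ordge (deriv f) z (m - 1)"
  using ordge_deriv[OF ordeq_imp_ordge[OF assms]] by (simp add: deriv_minus_const)

lemma deriv_eventually_neq_0: "\<forall>\<^sub>F w in at z. deriv f w \<noteq> 0"
proof (cases "is_pole f z")
  case True
  from pole_order[OF this] obtain p where "p \<ge> 1" "ordeq f z (- int p)" by blast
  then show ?thesis using ordeq_eventually_neq_0[OF ordeq_deriv] by simp
next
  case False
  have "int (nat (zorder (\<lambda>w. f w - f z) z)) \<noteq> 0" using value_order(2)[OF False] by linarith
  from ordeq_eventually_neq_0[OF ordeq_deriv[OF value_order(3)[OF False] this]]
  show ?thesis by (simp only: deriv_minus_const)
qed

lemma inverse_y_order: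
  assumes "\<not> is_pole f z"
  shows "ordge (\<lambda>w. 1 / y w) z 0"
proof -
  interpret entire_pair x y by (rule pair)
  have "y analytic_on {z}" using y by (simp add: analytic_on_holomorphic) blast
  then show ?thesis using y_zero[of z] assms
    by (intro ordge_analytic analytic_intros) auto
qed

text \<open>Turns the factor \<open>1 / y\<close> of an auxiliary function into
  \<open>1 + norm (f z)\<close> divided by the norm of the pair; the decay comes from here.\<close>

lemma norm_pair:
  assumes "y z \<noteq> 0"
  shows "norm (x z) + norm (y z) = norm (y z) * (1 + norm (f z))"
  using assms by (simp add: quot norm_divide field_simps)

end

lemma mero_quotient_exists:
  assumes f: "nonconst_meromorphic f"
  shows "\<exists>x y. mero_quotient f x y"
proof -
  have "f nicely_meromorphic_on UNIV" using f by (simp add: nonconst_meromorphic_def)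
  from weierstrass_factorization_meromorphic_UNIV[OF this] obtain h f1 f2 where
    W: "h holomorphic_on UNIV" "f1 holomorphic_on UNIV" "f2 holomorphic_on UNIV"
    "\<forall>z. f1 z = 0 \<longleftrightarrow> \<not>is_pole f z \<and> f z = 0"
    "\<forall>z. f2 z = 0 \<longleftrightarrow> is_pole f z"
    "\<forall>z. is_pole f z \<longrightarrow> zorder f2 z = -zorder f z"
    "\<forall>z. h z \<noteq> 0" "\<forall>z. f z = h z * f1 z / f2 z" by metis
  have "mero_quotient f (\<lambda>z. h z * f1 z) f2"
  proof
    show "(\<lambda>z. h z * f1 z) holomorphic_on UNIV" using W by (intro holomorphic_intros)
    show "h z * f1 z \<noteq> 0 \<or> f2 z \<noteq> 0" for z using W(4,5,7) by auto
  qed (use f W in auto)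
  then show ?thesis by blast
qed

lemma mero_quotient_entire:
  assumes "nonconst_entire f"
  shows "mero_quotient f f (\<lambda>_. 1)"
proof
  have an: "f analytic_on {z}" for z
    using assms by (auto simp: nonconst_entire_def analytic_on_holomorphic)
  have "f analytic_on UNIV" using assms by (simp add: nonconst_entire_def analytic_on_open)
  then show "nonconst_meromorphic f"
    using assms by (simp add: nonconst_entire_def nonconst_meromorphic_def analytic_on_imp_nicely_meromorphic_on)
  show "f holomorphic_on UNIV" using assms by (simp add: nonconst_entire_def)
  have np: "\<not> is_pole f z" for z using an analytic_at_imp_no_pole by blast
  then show "((1::complex) = 0) = is_pole f z" for z by simp
  show "is_pole f z \<Longrightarrow> zorder (\<lambda>_. 1) z = - zorder f z" for z using np by blast
qed auto

text \<open>Only the point of \<open>V\<close> nearest to \<open>z\<close> can be close to it, and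
  its factor is at least \<open>t\<close>. All other factors are bounded below by a multiple of
  \<open>1 + norm z\<close>.\<close>

lemma norm_prod_diff_ge:
  fixes V :: "complex set"
  assumes "finite V" "V \<noteq> {}"
  shows "\<exists>C\<ge>1. \<forall>z t. 0 \<le> t \<longrightarrow> (\<forall>a\<in>V. t \<le> norm (z - a)) \<longrightarrow>
    (1 + norm z) ^ (card V - 1) * t \<le> C * (\<Prod>a\<in>V. norm (z - a))"
proof -
  define D where "D = (\<lambda>(a, b). norm (a - b)) ` ((V \<times> V) - Id)"
  have finD: "finite D" unfolding D_def using assms(1) by auto
  have posD: "d > 0" if "d \<in> D" for d using that by (auto simp: D_def)
  \<comment> \<open>Half the minimal separation of \<open>V\<close>; inserting 1 keeps the minimum
    defined when \<open>V\<close> is a singleton.\<close>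
  define \<sigma> where "\<sigma> = Min (insert 1 D) / 2"
  have \<sigma>: "\<sigma> > 0" using finD posD by (simp add: \<sigma>_def)
  have sep: "2 * \<sigma> \<le> norm (a - b)" if "a \<in> V" "b \<in> V" "a \<noteq> b" for a b
  proof -
    have "norm (a - b) \<in> D" using that by (force simp: D_def)
    then show ?thesis using finD by (simp add: \<sigma>_def)
  qed
  define B where "B = Max (norm ` V)"
  have B: "norm a \<le> B" if "a \<in> V" for a using that assms(1) by (simp add: B_def)
  have B0: "B \<ge> 0" using assms B norm_ge_zero order_trans by (metis ex_in_conv)
  define M where "M = 1 + (1 + B) / \<sigma>"
  have M: "M \<ge> 1" using \<sigma> B0 by (simp add: M_def)
  show ?thesis
  proof (intro exI[of _ "M ^ (card V - 1)"] conjI allI impI)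
    show "1 \<le> M ^ (card V - 1)" using M by simp
    fix z t assume t: "0 \<le> t" "\<forall>a\<in>V. t \<le> norm (z - a)"
    obtain a0 where a0: "a0 \<in> V" "\<And>a. a \<in> V \<Longrightarrow> norm (z - a0) \<le> norm (z - a)"
      using assms ex_is_arg_min_if_finite[of V "\<lambda>a. norm (z - a)"]
      by (metis is_arg_min_linorder)
    have far: "1 + norm z \<le> M * norm (z - a)" if a: "a \<in> V - {a0}" for a
    proof -
      have "norm (a - a0) \<le> norm (z - a) + norm (z - a0)"
        by (metis norm_minus_commute norm_triangle_sub norm_diff_triangle_le order_refl)
      then have \<sigma>le: "\<sigma> \<le> norm (z - a)" using sep[of a a0] a0 a by force
      have "norm z \<le> norm a + norm (z - a)" by (metis add.commute norm_triangle_sub)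
      then have "1 + norm z \<le> (1 + B) + norm (z - a)" using B[of a] a by simp
      also have "1 + B \<le> (1 + B) / \<sigma> * norm (z - a)"
        using \<sigma>le \<sigma> B0 mult_left_mono[OF \<sigma>le, of "(1 + B) / \<sigma>"] by simp
      finally show ?thesis by (simp add: M_def algebra_simps)
    qed
    have "(1 + norm z) ^ (card V - 1) = (\<Prod>a\<in>V - {a0}. 1 + norm z)"
      using assms a0 by simp
    also have "\<dots> \<le> (\<Prod>a\<in>V - {a0}. M * norm (z - a))"
      using far by (intro prod_mono) auto
    also have "\<dots> = M ^ (card V - 1) * (\<Prod>a\<in>V - {a0}. norm (z - a))"
      using assms a0 by (simp add: prod.distrib)
    finally have "(1 + norm z) ^ (card V - 1) * t \<le> M ^ (card V - 1) * (\<Prod>a\<in>V - {a0}. norm (z - a)) * norm (z - a0)"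
      using t a0 M by (intro mult_mono mult_nonneg_nonneg prod_nonneg) auto
    also have "\<dots> = M ^ (card V - 1) * (\<Prod>a\<in>V. norm (z - a))"
      using prod.remove[OF assms(1) a0(1), of "\<lambda>a. norm (z - a)"] by (simp add: mult_ac)
    finally show "(1 + norm z) ^ (card V - 1) * t \<le> M ^ (card V - 1) * (\<Prod>a\<in>V. norm (z - a))" .
  qed
qed

lemma norm_diff_le: "norm (z - a) \<le> (1 + norm a) * (1 + norm z)" for z a :: complex
proof -
  have "norm (z - a) \<le> norm z + norm a" by (rule norm_triangle_ineq4)
  also have "\<dots> \<le> (1 + norm a) * (1 + norm z)" by (simp add: algebra_simps)
  finally show ?thesis .
qed

text \<open>The triangle with angles \<open>\<pi>/2\<close>, \<open>\<pi>/5\<close>, \<open>\<pi>/5\<close> is hyperbolic. In the proof,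
  ramification over the three values gives \<open>10 (m - 1)\<close> at least \<open>5 m\<close>, \<open>8 m\<close>, \<open>8 m\<close>, and
  \<open>5 + 8 + 8\<close> exceeds the order \<open>20\<close> of \<open>g'\<^sup>1\<^sup>0\<close> at a simple pole; the excess pays for \<open>1 / y\<close>.\<close>
lemma no_2_5_5_ramification:
  assumes g: "nonconst_meromorphic g" and \<omega>: "\<omega>0 \<noteq> \<omega>1" "\<omega>0 \<noteq> \<omega>2" "\<omega>1 \<noteq> \<omega>2"
    and ram: "\<And>z. \<not> is_pole g z \<Longrightarrow> g z = \<omega>0 \<Longrightarrow> zorder (\<lambda>w. g w - \<omega>0) z \<ge> 2"
      "\<And>z. \<not> is_pole g z \<Longrightarrow> g z = \<omega>1 \<Longrightarrow> zorder (\<lambda>w. g w - \<omega>1) z \<ge> 5"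
      "\<And>z. \<not> is_pole g z \<Longrightarrow> g z = \<omega>2 \<Longrightarrow> zorder (\<lambda>w. g w - \<omega>2) z \<ge> 5"
  shows False
proof -
  from mero_quotient_exists[OF g] obtain x y where "mero_quotient g x y" by blast
  then interpret mero_quotient g x y .
  interpret entire_pair x y by (rule pair)
  define I where "I = (\<lambda>\<omega>. invprod {\<omega>} g)"
  have I: "I \<omega> w = 1 / (g w - \<omega>)" for \<omega> w by (simp add: I_def invprod_def)
  define F where "F = (\<lambda>w. deriv g w ^ 10 * (I \<omega>0 w ^ 5 * (I \<omega>1 w ^ 8 * (I \<omega>2 w ^ 8 * (1 / y w)))))"
  \<comment> \<open>The square matches the product of two pair norms in
    \<open>no_decaying_entire_function\<close>, which is applied with both pairs equal to
    \<open>x\<close>, \<open>y\<close>.\<close>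
  define \<Theta> where "\<Theta> = remove_sings (\<lambda>w. F w ^ 2)"
  have y_mero: "y meromorphic_on UNIV"
    using y by (intro analytic_on_imp_meromorphic_on) (simp add: analytic_on_open)
  have F_mero: "(\<lambda>w. F w ^ 2) meromorphic_on UNIV"
    unfolding F_def I by (intro meromorphic_intros mero y_mero)
  have F_ord: "ordge F z 0" for z
  proof (cases "is_pole g z")
    case True
    from pole_order[OF this] obtain p where p: "p \<ge> 1" "ordeq g z (- int p)" "ordeq y z (int p)" by blast
    have Ip: "ordge (I \<omega>) z (int p)" for \<omega>
      unfolding I_def using ordge_invprod_pole[OF p(2,1), of "{\<omega>}"] by simp
    have "ordge (deriv g) z (- int p - 1)" using ordge_deriv[OF ordeq_imp_ordge[OF p(2)]] .
    \<comment> \<open>The sum is \<open>10 * (p - 1)\<close>, still nonnegative at a simple pole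
      after \<open>1 / y\<close> has been paid for.\<close>
    then have "ordge F z (int 10 * (- int p - 1) + (int 5 * int p + (int 8 * int p + (int 8 * int p + - int p))))"
      unfolding F_def using ordeq_imp_ordge[OF ordeq_inverse[OF p(3)]]
      by (intro ordge_mult ordge_power Ip) auto
    then show ?thesis by (rule ordge_mono) (use p(1) in auto)
  next
    case False
    define m where "m = int (nat (zorder (\<lambda>w. g w - g z) z))"
    note v = value_order[OF False, folded m_def]
    have m: "m \<ge> 1" unfolding m_def using value_order(2)[OF False] by linarith
    have "ordge (I \<omega>) z (if g z = \<omega> then - m else 0)" for \<omega>
      unfolding I_def using ordge_invprod_value[OF v(1,3), of "{\<omega>}"] by simp
    then have "ordge F z (int 10 * (m - 1) + (int 5 * (if g z = \<omega>0 then - m else 0) +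
        (int 8 * (if g z = \<omega>1 then - m else 0) + (int 8 * (if g z = \<omega>2 then - m else 0) + 0))))"
      unfolding F_def using deriv_order_value[OF v(3)] inverse_y_order[OF False]
      by (intro ordge_mult ordge_power) auto
    moreover have "g z = \<omega>0 \<Longrightarrow> m \<ge> 2" "g z = \<omega>1 \<Longrightarrow> m \<ge> 5" "g z = \<omega>2 \<Longrightarrow> m \<ge> 5"
      using ram[OF False] by (auto simp: m_def)
    ultimately show ?thesis using m \<omega> by (elim ordge_mono) auto
  qed
  have F2_ord: "ordge (\<lambda>w. F w ^ 2) z 0" for z using ordge_power[OF F_ord, of 2] by simp
  have hol: "\<Theta> holomorphic_on UNIV"
    unfolding \<Theta>_def using F_mero F2_ord by (rule ordge_0_everywhere_imp_entire)
  have cos: "\<forall>\<^sub>\<approx>z. \<Theta> z = F z ^ 2" unfolding \<Theta>_def using F_mero by (rule eventually_remove_sings_eq)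
  define X where "X = {z. \<not> (\<Theta> z = F z ^ 2 \<and> g z \<noteq> \<omega>0 \<and> g z \<noteq> \<omega>1 \<and> g z \<noteq> \<omega>2)}"
  have X: "countable X" unfolding X_def
    by (intro eventually_cosparse_countable eventually_conj cos cosparse_neq)
  have nz: "\<exists>z. \<Theta> z \<noteq> 0"
  proof -
    have "\<forall>\<^sub>F z in at 0. \<Theta> z = F z ^ 2" using cos by (simp add: eventually_cosparse_UNIV_iff)
    moreover have "\<forall>\<^sub>F z in at 0. y z \<noteq> 0"
      using non_zero_neighbour_alt[OF y, of 0] y_nonzero connected_UNIV by auto
    ultimately have "\<forall>\<^sub>F z in at 0. \<Theta> z \<noteq> 0"
      using eventually_neq_at[of \<omega>0 0] eventually_neq_at[of \<omega>1 0] eventually_neq_at[of \<omega>2 0]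
        deriv_eventually_neq_0[of 0]
      by eventually_elim (simp add: F_def I)
    then show ?thesis using eventually_happens'[OF at_neq_bot] by blast
  qed
  define V where "V = {\<omega>0, \<omega>1, \<omega>2}"
  have V: "finite V" "V \<noteq> {}" "card V = 3" using \<omega> by (auto simp: V_def)
  from norm_prod_diff_ge[OF V(1,2)] obtain C where C: "C \<ge> 1" and
    low: "\<And>z t. 0 \<le> t \<Longrightarrow> (\<forall>a\<in>V. t \<le> norm (z - a)) \<Longrightarrow>
      (1 + norm z) ^ 2 * t \<le> C * (\<Prod>a\<in>V. norm (z - a))"
    using V(3) by auto
  define B where "B = (1 + norm \<omega>0) ^ 5 * (1 + norm \<omega>1)\<^sup>2 * (1 + norm \<omega>2)\<^sup>2"
  show False
  proof (rule no_decaying_entire_function[OF pair pair V(1) x_neq y_nonzero x_neq y_nonzero hol nz X,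
        where j = 1 and D = "(C ^ 10 * B)\<^sup>2" and \<kappa> = 20])
    fix z K assume z: "z \<notin> X" and K: "K \<ge> 1" and yz: "y z \<noteq> 0"
      and small: "\<And>a. a \<in> V \<Longrightarrow> norm (deriv (\<lambda>z. x z / y z) z) \<le> K * norm (x z / y z - a) \<and>
        norm (deriv (deriv (\<lambda>z. x z / y z)) z) \<le> K * norm (x z / y z - a) \<and>
        norm (deriv (\<lambda>z. x z / y z) z) \<le> K * norm (x z / y z - a) \<and>
        norm (deriv (deriv (\<lambda>z. x z / y z)) z) \<le> K * norm (x z / y z - a)"
    define u where "u = 1 + norm (g z)"
    define d0 d1 d2 where "d0 = norm (g z - \<omega>0)" and "d1 = norm (g z - \<omega>1)" and "d2 = norm (g z - \<omega>2)"
    have d: "d0 > 0" "d1 > 0" "d2 > 0" and \<Theta>F: "\<Theta> z = F z ^ 2"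
      using z by (auto simp: X_def d0_def d1_def d2_def)
    have u: "u \<ge> 1" by (simp add: u_def)
    define t where "t = norm (deriv g z)"
    have t0: "t \<ge> 0" by (simp add: t_def)
    have "t \<le> K * norm (g z - a)" if "a \<in> V" for a
      using small[OF that] by (simp add: quot t_def)
    then have "\<forall>a\<in>V. t / K \<le> norm (g z - a)" using K by (auto simp: field_simps)
    from low[OF _ this] t0 K have "u\<^sup>2 * (t / K) \<le> C * (d0 * d1 * d2)"
      using \<omega> by (simp add: u_def V_def d0_def d1_def d2_def mult.assoc)
    then have t: "u\<^sup>2 * t \<le> C * K * (d0 * d1 * d2)" using K by (simp add: field_simps)
    have dl: "d0 \<le> (1 + norm \<omega>0) * u" "d1 \<le> (1 + norm \<omega>1) * u" "d2 \<le> (1 + norm \<omega>2) * u"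
      unfolding d0_def d1_def d2_def u_def by (rule norm_diff_le)+
    define N where "N = t ^ 10 / (d0 ^ 5 * d1 ^ 8 * d2 ^ 8)"
    have "(u\<^sup>2 * t) ^ 10 \<le> (C * K * (d0 * d1 * d2)) ^ 10"
      using t t0 u by (intro power_mono) auto
    then have "u ^ 20 * t ^ 10 \<le> (C * K) ^ 10 * (d0 ^ 10 * d1 ^ 10 * d2 ^ 10)"
      by (simp add: power_mult_distrib flip: power_mult)
    also have "\<dots> = (C * K) ^ 10 * (d0 ^ 5 * d1\<^sup>2 * d2\<^sup>2) * (d0 ^ 5 * d1 ^ 8 * d2 ^ 8)"
    proof -
      have e: "d0 ^ 10 = d0 ^ 5 * d0 ^ 5" "d1 ^ 10 = d1\<^sup>2 * d1 ^ 8" "d2 ^ 10 = d2\<^sup>2 * d2 ^ 8"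
        by (simp_all flip: power_add)
      show ?thesis unfolding e by (simp only: mult_ac)
    qed
    finally have N1: "u ^ 20 * N \<le> (C * K) ^ 10 * (d0 ^ 5 * d1\<^sup>2 * d2\<^sup>2)"
      using d by (simp add: N_def field_simps)
    have "d0 ^ 5 * d1\<^sup>2 * d2\<^sup>2 \<le> ((1 + norm \<omega>0) * u) ^ 5 * ((1 + norm \<omega>1) * u)\<^sup>2 * ((1 + norm \<omega>2) * u)\<^sup>2"
      using dl d u by (intro mult_mono power_mono mult_nonneg_nonneg zero_le_power) auto
    also have "\<dots> = B * u ^ 9"
      unfolding B_def power_mult_distrib by (simp add: power_add[symmetric] mult_ac)
    finally have "u ^ 20 * N \<le> (C * K) ^ 10 * (B * u ^ 9)"
      using N1 C K by (meson mult_left_mono order_trans zero_le_power mult_nonneg_nonneg zero_le_one)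
    \<comment> \<open>Of the 20 powers of \<open>u\<close>, 9 are used up by the remaining
      numerators. One of the other 11 is required for the pair norm.\<close>
    moreover have "u ^ 20 = u ^ 9 * (u ^ 10 * u)" by (simp add: eval_nat_numeral mult_ac)
    ultimately have "u ^ 9 * (u ^ 10 * u * N) \<le> u ^ 9 * ((C * K) ^ 10 * B)" by (simp add: mult_ac)
    moreover have "u ^ 9 > 0" using u by simp
    ultimately have "u ^ 10 * u * N \<le> (C * K) ^ 10 * B" by (rule mult_left_le_imp_le)
    then have N2: "u ^ 10 * (u * N) \<le> (C * K) ^ 10 * B" by (simp only: mult.assoc)
    have N0: "N \<ge> 0" unfolding N_def using t0 d by simp
    have "1 * (u * N) \<le> u ^ 10 * (u * N)" using u N0 by (intro mult_right_mono one_le_power mult_nonneg_nonneg) auto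
    then have N3: "u * N \<le> (C * K) ^ 10 * B" using N2 by simp
    have "norm (F z) = N / norm (y z)"
      by (simp add: F_def I N_def norm_mult norm_divide norm_power power_divide t_def d0_def d1_def d2_def mult.assoc)
    moreover have "norm (x z) + norm (y z) = norm (y z) * u" using norm_pair[OF yz] by (simp add: u_def)
    ultimately have uN: "norm (F z) * (norm (x z) + norm (y z)) = u * N" using yz by simp
    have "norm (\<Theta> z) * ((norm (x z) + norm (y z)) * (norm (x z) + norm (y z))) ^ 1 = (u * N)\<^sup>2"
      unfolding uN[symmetric] \<Theta>F norm_power power_one_right power2_eq_square by (simp only: norm_mult mult_ac)
    also have "\<dots> \<le> ((C * K) ^ 10 * B)\<^sup>2" using N3 u N0 by (intro power_mono) auto
    also have "\<dots> = (C ^ 10 * B)\<^sup>2 * K ^ 20"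
      by (simp add: power_mult_distrib mult_ac flip: power_mult)
    finally show "norm (\<Theta> z) * ((norm (x z) + norm (y z)) * (norm (x z) + norm (y z))) ^ 1 \<le> (C ^ 10 * B)\<^sup>2 * K ^ 20" .
  qed auto
qed

text \<open>For order 0 the loss of one order in \<open>ordge_deriv\<close> does not occur, because
  the leading term is multiplied by the exponent 0.\<close>

lemma ordge_deriv_0:
  assumes "ordge h z 0"
  shows "ordge (deriv h) z 0"
proof -
  from assms obtain k where k: "k analytic_on {z}" "\<forall>\<^sub>F w in at z. h w = k w * (w - z) powi 0"
    by (auto simp: ordge_def)
  note d = deriv_local_form[OF k]
  from d(2) eventually_neq have "\<forall>\<^sub>F w in at z. deriv h w = deriv k w * (w - z) powi 0"
    by eventually_elim (simp add: power_int_minus)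
  with d(1) show ?thesis unfolding ordge_def by blast
qed

lemma ordeq_zorder_eq:
  assumes "ordeq h z i"
  shows "zorder h z = i"
proof -
  from assms obtain k where k: "k analytic_on {z}" "k z \<noteq> 0" "\<forall>\<^sub>F w in at z. h w = k w * (w - z) powi i"
    by (auto simp: ordeq_def)
  from k(1) obtain A where A: "open A" "z \<in> A" "k holomorphic_on A" by (auto simp: analytic_at)
  from k(3) obtain B where B: "open B" "z \<in> B" "\<And>w. w \<in> B \<Longrightarrow> w \<noteq> z \<Longrightarrow> h w = k w * (w - z) powi i"
    unfolding eventually_at_topological by blast
  show ?thesis
    by (rule zorder_eqI[of "A \<inter> B" z k]) (use A B k(2) in \<open>auto intro: holomorphic_on_subset\<close>)
qed

text \<open>Clearing denominators: \<open>l\<close> is the polynomial homogenised with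
  \<open>(w - z) ^ p\<close>, and at \<open>z\<close> only its leading term survives.\<close>

lemma ordeq_poly_pole:
  assumes f: "ordeq f z (- int p)" "p \<ge> 1" and P: "P \<noteq> 0"
  shows "ordeq (\<lambda>w. poly P (f w)) z (- int (degree P * p))"
proof -
  define n where "n = degree P"
  from f obtain k where k: "k analytic_on {z}" "k z \<noteq> 0" "\<forall>\<^sub>F w in at z. f w = k w * (w - z) powi (- int p)"
    by (auto simp: ordeq_def)
  define l where "l = (\<lambda>w. \<Sum>i\<le>n. coeff P i * (k w ^ i * (w - z) ^ ((n - i) * p)))"
  from k(3) eventually_neq have "\<forall>\<^sub>F w in at z. poly P (f w) = l w * (w - z) powi (- int (n * p))"
  proof eventually_elim
    case (elim w)
    define u where "u = w - z"
    have u: "u \<noteq> 0" using elim by (simp add: u_def)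
    have fw: "f w = k w / u ^ p" using elim u by (simp add: u_def power_int_minus field_simps)
    define N where "N = n * p"
    have pw: "u powi (- int N) = 1 / u ^ N"
      by (simp add: power_int_minus inverse_eq_divide)
    have "coeff P i * f w ^ i = coeff P i * (k w ^ i * u ^ ((n - i) * p)) * u powi (- int N)" if i: "i \<le> n" for i
    proof -
      obtain j where "n = i + j" using i le_Suc_ex by blast
      then have "N = (n - i) * p + p * i" by (simp add: N_def algebra_simps)
      then have "u ^ N = u ^ ((n - i) * p) * (u ^ p) ^ i" by (simp only: power_add power_mult)
      then show ?thesis unfolding pw fw power_divide using u by (simp add: field_simps)
    qed
    then have "(\<Sum>i\<le>n. coeff P i * f w ^ i) =
        (\<Sum>i\<le>n. coeff P i * (k w ^ i * u ^ ((n - i) * p)) * u powi (- int N))"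
      by (intro sum.cong) auto
    then show ?case by (simp only: poly_altdef l_def n_def[symmetric] u_def N_def sum_distrib_right)
  qed
  moreover have "l analytic_on {z}" unfolding l_def using k(1) by (intro analytic_intros)
  moreover have "l z = lead_coeff P * k z ^ n"
  proof -
    have "l z = (\<Sum>i\<le>n. if i = n then coeff P n * k z ^ n else 0)"
      unfolding l_def using f(2) by (intro sum.cong) auto
    then show ?thesis by (simp add: n_def)
  qed
  then have "l z \<noteq> 0" using P k(2) by simp
  ultimately show ?thesis unfolding ordeq_def n_def by blast
qed

text \<open>If \<open>h\<close> were not constant, \<open>h - h z0\<close> would have a zero of
  positive finite order at \<open>z0\<close>, and by \<open>ordeq_deriv\<close> its derivative would
  not vanish near \<open>z0\<close>.\<close>

lemma meromorphic_deriv_zero_imp_const: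
  assumes "h meromorphic_on UNIV" "\<forall>\<^sub>\<approx>z. deriv h z = 0"
  shows "\<exists>c. \<forall>\<^sub>\<approx>z. h z = c"
proof -
  have "\<forall>\<^sub>F z in at 0. h analytic_on {z}"
    using meromorphic_on_imp_analytic_cosparse[OF assms(1)] by (simp add: eventually_cosparse_UNIV_iff)
  then obtain z0 where z0: "h analytic_on {z0}" using eventually_happens'[OF at_neq_bot] by blast
  have "(\<forall>\<^sub>\<approx>z. h z = h z0) \<or> (\<forall>\<^sub>\<approx>z. h z \<noteq> h z0)"
    using assms(1) by (intro meromorphic_imp_constant_or_avoid) auto
  moreover have False if "\<forall>\<^sub>\<approx>z. h z \<noteq> h z0"
  proof -
    have an: "(\<lambda>w. h w - h z0) analytic_on {z0}" using z0 by (intro analytic_intros) auto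
    have ev: "\<forall>\<^sub>F w in at z0. h w - h z0 \<noteq> 0" using that by (simp add: eventually_cosparse_UNIV_iff)
    have "zorder (\<lambda>w. h w - h z0) z0 > 0"
      using zorder_pos_iff'[OF an] ev by (simp add: eventually_frequently)
    then have "zorder (\<lambda>w. h w - h z0) z0 \<noteq> 0" by simp
    from ordeq_eventually_neq_0[OF ordeq_deriv[OF ordeq_zorder[OF analytic_on_imp_meromorphic_on[OF an] ev] this]]
    have "\<forall>\<^sub>F w in at z0. deriv h w \<noteq> 0" by (simp only: deriv_minus_const)
    moreover have "\<forall>\<^sub>F w in at z0. deriv h w = 0" using assms(2) by (simp add: eventually_cosparse_UNIV_iff)
    ultimately have "\<forall>\<^sub>F w in at z0. False" by eventually_elim simp
    then show False by simp
  qed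
  ultimately show ?thesis by blast
qed

text \<open>The quotient p'/p is the sum of the \<open>degree p\<close> reciprocals of x - a over
  the roots a, each of modulus at most 1 / t. The multiplied form makes sense for
  \<open>t = 0\<close> and at roots of \<open>p\<close>.\<close>

lemma norm_pderiv_le:
  fixes p :: "complex poly"
  assumes "0 \<le> t" "\<And>a. poly p a = 0 \<Longrightarrow> t \<le> norm (x - a)"
  shows "norm (poly (pderiv p) x) * t \<le> real (degree p) * norm (poly p x)"
  using assms(2)
proof (induction "degree p" arbitrary: p)
  case 0
  then obtain c where "p = [:c:]" by (metis degree_eq_zeroE)
  then show ?case by simp
next
  case (Suc d)
  then have "\<not> constant (poly p)" by (simp add: constant_degree)
  then obtain a where a: "poly p a = 0" using fundamental_theorem_of_algebra by blast
  then obtain q where q: "p = [:- a, 1:] * q" by (metis poly_eq_0_iff_dvd dvdE)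
  have q0: "q \<noteq> 0" using Suc.hyps(2) q by auto
  have deg: "degree p = Suc (degree q)" unfolding q using q0 by (subst degree_mult_eq) auto
  have IH: "norm (poly (pderiv q) x) * t \<le> real (degree q) * norm (poly q x)"
    using Suc.hyps deg Suc.prems by (intro Suc.hyps(1)) (auto simp: q)
  have ta: "t \<le> norm (x - a)" using Suc.prems a by blast
  have "poly (pderiv p) x = poly q x + (x - a) * poly (pderiv q) x"
    unfolding q pderiv_mult by (simp add: pderiv_pCons algebra_simps)
  then have "norm (poly (pderiv p) x) * t \<le> (norm (poly q x) + norm (x - a) * norm (poly (pderiv q) x)) * t"
    using assms(1) by (metis mult_right_mono norm_mult norm_triangle_ineq)
  also have "\<dots> = norm (poly q x) * t + norm (x - a) * (norm (poly (pderiv q) x) * t)"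
    by (simp add: algebra_simps)
  also have "\<dots> \<le> norm (poly q x) * norm (x - a) + norm (x - a) * (real (degree q) * norm (poly q x))"
    using IH ta by (intro add_mono mult_left_mono) auto
  also have "\<dots> = real (degree p) * norm (poly p x)"
  proof -
    have "poly p x = (x - a) * poly q x" by (simp add: q algebra_simps)
    then have "norm (poly p x) = norm (x - a) * norm (poly q x)" by (simp only: norm_mult)
    then show ?thesis unfolding deg by (simp add: distrib_left mult_ac)
  qed
  finally show ?case .
qed

section \<open>Critically injective polynomials\<close>

locale critically_injective =
  fixes P :: "complex poly" and S1 S2 :: "complex set" and n k :: nat
  assumes deg: "degree P = n" and S1: "S1 = {z. poly P z = 0}" and S2: "S2 = {z. poly (pderiv P) z = 0}"
    and card_S1: "card S1 = n" and card_S2: "card S2 = k" and k2: "k \<ge> 2"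
    and simple: "a \<in> S1 \<Longrightarrow> poly (pderiv P) a \<noteq> 0"
    and multiple: "b \<in> S2 \<Longrightarrow> order b (pderiv P) \<ge> 2"
    and sum_order: "(\<Sum>b\<in>S2. order b (pderiv P)) = n - 1"
    and inj: "b \<in> S2 \<Longrightarrow> b' \<in> S2 \<Longrightarrow> poly P b = poly P b' \<Longrightarrow> b = b'"
begin

text \<open>Each of the \<open>k\<close> critical points takes at least 2 of the total order
  \<open>n - 1\<close>.\<close>

lemma n_ge: "2 * k + 1 \<le> n" "5 \<le> n"
proof -
  have "2 * k \<le> n - 1"
    using sum_bounded_below[of S2 2 "\<lambda>b. order b (pderiv P)"] multiple sum_order card_S2
    by (simp add: mult.commute)
  then show "2 * k + 1 \<le> n" "5 \<le> n" using k2 by linarith+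
qed

lemma P0: "P \<noteq> 0" "pderiv P \<noteq> 0"
  using n_ge deg by (auto simp: pderiv_eq_0_iff)

lemma finite_S: "finite S1" "finite S2"
  unfolding S1 S2 using P0 by (auto intro: poly_roots_finite)

lemma disjoint: "S1 \<inter> S2 = {}"
  using simple S2 by auto

definition D :: "(complex \<Rightarrow> complex) \<Rightarrow> complex \<Rightarrow> complex" where
  "D f w = deriv (\<lambda>w. poly P (f w)) w / poly P (f w)"

text \<open>\<open>LD f - D f\<close> is the logarithmic derivative of \<open>D f\<close> divided by
  P(f), and that quotient is minus the derivative of 1/P(f). The function \<open>H\<close> compares
  these expressions for \<open>f\<close> and \<open>g\<close>.\<close>

definition LD :: "(complex \<Rightarrow> complex) \<Rightarrow> complex \<Rightarrow> complex" where
  "LD f w = deriv (D f) w / D f w"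

lemma D_fun: "D f = (\<lambda>w. deriv (\<lambda>w. poly P (f w)) w / poly P (f w))"
  by (rule ext) (rule D_def)

lemma LD_fun: "LD f = (\<lambda>w. deriv (D f) w / D f w)"
  by (rule ext) (rule LD_def)

lemma analytic_poly:
  assumes "f analytic_on {z}"
  shows "(\<lambda>w. poly Q (f w)) analytic_on {z}"
  unfolding poly_altdef using assms by (intro analytic_intros)

lemma D_eq:
  assumes "f analytic_on {w}"
  shows "D f w = poly (pderiv P) (f w) * deriv f w / poly P (f w)"
proof -
  have "(f has_field_derivative deriv f w) (at w)"
    using assms analytic_on_imp_differentiable_at[of f "{w}" w] by (simp add: DERIV_deriv_iff_field_differentiable)
  then have "((\<lambda>w. poly P (f w)) has_field_derivative poly (pderiv P) (f w) * deriv f w) (at w)"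
    using DERIV_chain2[OF poly_DERIV] by blast
  then show ?thesis by (simp add: D_def DERIV_imp_deriv)
qed

lemma D_eq_eventually:
  assumes "f analytic_on {z}"
  shows "\<forall>\<^sub>F w in nhds z. D f w = poly (pderiv P) (f w) * deriv f w / poly P (f w)"
proof -
  from assms obtain A where A: "open A" "z \<in> A" "f holomorphic_on A" by (auto simp: analytic_at)
  have "\<forall>\<^sub>F w in nhds z. w \<in> A" using A by (intro eventually_nhds_in_open)
  then show ?thesis
    by eventually_elim (use A in \<open>auto intro!: D_eq simp: analytic_at\<close>)
qed

text \<open>P'/P and P''/P' are sums of reciprocals of distances to \<open>S1\<close> and
  \<open>S2\<close>, and these distances are at least \<open>norm (deriv f w) / K\<close>. As
  \<open>LD f\<close> contains f''/f', it is bounded only after multiplication by f'.\<close>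

lemma norm_D_le:
  assumes an: "f analytic_on {w}" and nV: "f w \<notin> S1 \<union> S2" and K: "K \<ge> 1"
    and small: "\<And>a. a \<in> S1 \<union> S2 \<Longrightarrow> norm (deriv f w) \<le> K * norm (f w - a) \<and>
      norm (deriv (deriv f) w) \<le> K * norm (f w - a)"
  shows "norm (D f w) \<le> real n * K"
    and "norm (deriv f w * LD f w) \<le> (2 * real n * K + 1) * max (norm (deriv f w)) (norm (deriv (deriv f) w))"
proof -
  define t where "t = norm (deriv f w)"
  have Pw: "poly P (f w) \<noteq> 0" "poly (pderiv P) (f w) \<noteq> 0" using nV S1 S2 by auto
  have le: "t / K \<le> norm (f w - a)" if "a \<in> S1 \<union> S2" for a
    using small[OF that] K by (simp add: t_def field_simps)
  have "norm (poly (pderiv P) (f w)) * (t / K) \<le> real (degree P) * norm (poly P (f w))"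
    using le S1 K by (intro norm_pderiv_le) (auto simp: t_def)
  then have 1: "norm (poly (pderiv P) (f w)) * t \<le> real n * K * norm (poly P (f w))"
    using K deg by (simp add: field_simps)
  show Dle: "norm (D f w) \<le> real n * K"
    using 1 Pw by (simp add: D_eq[OF an] norm_mult norm_divide t_def field_simps)
  have "norm (poly (pderiv (pderiv P)) (f w)) * (t / K) \<le> real (degree (pderiv P)) * norm (poly (pderiv P) (f w))"
    using le S2 K by (intro norm_pderiv_le) (auto simp: t_def)
  also have "\<dots> \<le> real n * norm (poly (pderiv P) (f w))"
    using deg by (intro mult_right_mono) (auto simp: degree_pderiv)
  finally have 2: "norm (poly (pderiv (pderiv P)) (f w)) * t \<le> real n * K * norm (poly (pderiv P) (f w))"
    using K by (simp add: field_simps)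
  define T where "T = max (norm (deriv f w)) (norm (deriv (deriv f) w))"
  have T: "t \<le> T" "norm (deriv (deriv f) w) \<le> T" "0 \<le> T" by (auto simp: T_def t_def le_max_iff_disj)
  show "norm (deriv f w * LD f w) \<le> (2 * real n * K + 1) * max (norm (deriv f w)) (norm (deriv (deriv f) w))"
  proof (cases "deriv f w = 0")
    case True
    then show ?thesis using K T(3) by (simp add: T_def)
  next
    case False
    have f': "(f has_field_derivative deriv f w) (at w)"
      using an analytic_on_imp_differentiable_at[of f "{w}" w] by (simp add: DERIV_deriv_iff_field_differentiable)
    have "deriv f analytic_on {w}" using an by (rule analytic_deriv)
    then have f'': "(deriv f has_field_derivative deriv (deriv f) w) (at w)"
      using analytic_on_imp_differentiable_at[of "deriv f" "{w}" w] by (simp add: DERIV_deriv_iff_field_differentiable)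
    define a b c d e where "a = poly P (f w)" and "b = poly (pderiv P) (f w)"
      and "c = poly (pderiv (pderiv P)) (f w)" and "d = deriv f w" and "e = deriv (deriv f) w"
    have nz: "a \<noteq> 0" "b \<noteq> 0" "d \<noteq> 0" using Pw False by (auto simp: a_def b_def d_def)
    have dP: "((\<lambda>w. poly Q (f w)) has_field_derivative poly (pderiv Q) (f w) * deriv f w) (at w)" for Q
      using DERIV_chain2[OF poly_DERIV f'] .
    have "((\<lambda>w. poly (pderiv P) (f w) * deriv f w / poly P (f w)) has_field_derivative
        ((c * d * d + e * b) * a - b * d * (b * d)) / (a * a)) (at w)"
      unfolding a_def b_def c_def d_def e_def using Pw
      by (intro DERIV_divide DERIV_mult dP f'') auto
    moreover have "deriv (D f) w = deriv (\<lambda>w. poly (pderiv P) (f w) * deriv f w / poly P (f w)) w"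
      using D_eq_eventually[OF an] by (rule deriv_cong_ev) simp
    ultimately have dD: "deriv (D f) w = ((c * d * d + e * b) * a - b * d * (b * d)) / (a * a)"
      by (simp add: DERIV_imp_deriv)
    have Dw: "D f w = b * d / a" by (simp add: D_eq[OF an] a_def b_def d_def)
    have eq: "deriv f w * LD f w = (c * d / b) * d + e - d * D f w"
      unfolding LD_def dD Dw d_def[symmetric] using nz by (simp add: field_simps)
    have "norm (c * d / b) \<le> real n * K"
      using 2 nz by (simp add: norm_mult norm_divide t_def b_def c_def d_def field_simps)
    then have "norm ((c * d / b) * d) \<le> real n * K * T" "norm (d * D f w) \<le> T * (real n * K)"
      unfolding norm_mult[of "c * d / b"] norm_mult[of d] using Dle T K
      by (intro mult_mono; simp add: t_def d_def)+
    then have "norm (deriv f w * LD f w) \<le> real n * K * T + T + T * (real n * K)"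
      unfolding eq using T(2) by (intro norm_triangle_le_diff norm_triangle_le add_mono) (auto simp: e_def)
    then show ?thesis by (simp add: T_def[symmetric] algebra_simps)
  qed
qed

text \<open>Squaring the bound of \<open>norm_prod_diff_ge\<close> for the \<open>n + k\<close>
  points produces one product over \<open>S1\<close> too many. It costs
  \<open>(1 + norm z) ^ n\<close>, and 2 (n + k - 1) is at least n + 1, so one power remains for the
  pair norm.\<close>

lemma weight_le:
  "\<exists>C\<ge>1. \<forall>z T K. z \<notin> S1 \<union> S2 \<longrightarrow> K \<ge> 1 \<longrightarrow> 0 \<le> T \<longrightarrow> (\<forall>a\<in>S1 \<union> S2. T \<le> K * norm (z - a)) \<longrightarrow>
    (1 + norm z) * (T\<^sup>2 / ((\<Prod>a\<in>S1. norm (z - a)) * (\<Prod>a\<in>S2. norm (z - a))\<^sup>2)) \<le> C * K\<^sup>2"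
proof -
  define V where "V = S1 \<union> S2"
  have cardV: "card V = n + k"
    unfolding V_def using finite_S disjoint card_S1 card_S2 by (simp add: card_Un_disjoint)
  then have V: "finite V" "V \<noteq> {}" using finite_S k2 by (auto simp: V_def)
  from norm_prod_diff_ge[OF V] obtain C where C: "C \<ge> 1" and
    low: "\<And>z t. 0 \<le> t \<Longrightarrow> (\<forall>a\<in>V. t \<le> norm (z - a)) \<Longrightarrow>
      (1 + norm z) ^ (card V - 1) * t \<le> C * (\<Prod>a\<in>V. norm (z - a))" by blast
  define B where "B = (\<Prod>a\<in>S1. 1 + norm a)"
  have B: "B \<ge> 1" unfolding B_def by (intro prod_ge_1) auto
  show ?thesis
  proof (intro exI[of _ "C\<^sup>2 * B"] conjI allI impI)
    show "1 \<le> C\<^sup>2 * B" using C B by (intro mult_ge1_I one_le_power)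
    fix z T K assume z: "z \<notin> S1 \<union> S2" and K: "K \<ge> (1::real)" and T: "0 \<le> T" "\<forall>a\<in>S1 \<union> S2. T \<le> K * norm (z - a)"
    define u p q where "u = 1 + norm z" and "p = (\<Prod>a\<in>S1. norm (z - a))" and "q = (\<Prod>a\<in>S2. norm (z - a))"
    have u: "u \<ge> 1" by (simp add: u_def)
    have pq: "p > 0" "q > 0" unfolding p_def q_def using z by (auto intro!: prod_pos)
    have "\<forall>a\<in>V. T / K \<le> norm (z - a)" using T(2) K by (auto simp: V_def field_simps)
    from low[OF _ this] T(1) K have "u ^ (n + k - 1) * (T / K) \<le> C * (p * q)"
      using finite_S disjoint cardV by (simp add: u_def p_def q_def V_def prod.union_disjoint)
    then have "u ^ (n + k - 1) * T \<le> C * K * (p * q)" using K by (simp add: field_simps)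
    then have "(u ^ (n + k - 1) * T)\<^sup>2 \<le> (C * K * (p * q))\<^sup>2" using u T by (intro power_mono) auto
    then have "(u ^ (n + k - 1))\<^sup>2 * T\<^sup>2 \<le> (C * K)\<^sup>2 * p * (p * q\<^sup>2)"
      by (simp add: power_mult_distrib power2_eq_square mult_ac)
    then have 1: "(u ^ (n + k - 1))\<^sup>2 * (T\<^sup>2 / (p * q\<^sup>2)) \<le> (C * K)\<^sup>2 * p"
      using pq by (simp add: field_simps)
    have "p \<le> (\<Prod>a\<in>S1. (1 + norm a) * u)"
      unfolding p_def u_def by (intro prod_mono) (auto simp: norm_diff_le)
    also have "\<dots> = B * u ^ n" by (simp add: B_def prod.distrib card_S1)
    finally have "(u ^ (n + k - 1))\<^sup>2 * (T\<^sup>2 / (p * q\<^sup>2)) \<le> (C * K)\<^sup>2 * (B * u ^ n)"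
      using 1 C K by (meson mult_left_mono order_trans zero_le_power2)
    moreover have "u ^ n * u \<le> (u ^ (n + k - 1))\<^sup>2"
    proof -
      have "u ^ n * u = u ^ (n + 1)" by simp
      also have "\<dots> \<le> u ^ ((n + k - 1) * 2)" using u n_ge k2 by (intro power_increasing) auto
      finally show ?thesis by (simp add: power_mult)
    qed
    then have "(u ^ n * u) * (T\<^sup>2 / (p * q\<^sup>2)) \<le> (u ^ (n + k - 1))\<^sup>2 * (T\<^sup>2 / (p * q\<^sup>2))"
      using pq by (intro mult_right_mono) auto
    ultimately have "u ^ n * (u * (T\<^sup>2 / (p * q\<^sup>2))) \<le> u ^ n * (C\<^sup>2 * B * K\<^sup>2)"
      by (simp only: power_mult_distrib mult_ac)
    moreover have "u ^ n > 0" using u by simp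
    ultimately show "(1 + norm z) * (T\<^sup>2 / ((\<Prod>a\<in>S1. norm (z - a)) * (\<Prod>a\<in>S2. norm (z - a))\<^sup>2)) \<le> C\<^sup>2 * B * K\<^sup>2"
      unfolding u_def[symmetric] p_def[symmetric] q_def[symmetric] by (rule mult_left_le_imp_le)
  qed
qed

lemma ordeq_poly_f_diff:
  assumes an: "f analytic_on {z}" and m: "ordeq (\<lambda>w. f w - f z) z m" and "poly P (f z) = c" "poly (pderiv P) (f z) \<noteq> 0"
  shows "ordeq (\<lambda>w. poly P (f w) - c) z m"
proof -
  define Q where "Q = P - [:c:]"
  have "poly Q (f z) = 0" using assms(3) by (simp add: Q_def)
  then obtain R where R: "Q = [:- f z, 1:] * R" by (metis poly_eq_0_iff_dvd dvdE)
  have "poly (pderiv Q) (f z) = poly R (f z)" unfolding R pderiv_mult by (simp add: pderiv_pCons)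
  then have "poly R (f z) \<noteq> 0" using assms(4) by (simp add: Q_def pderiv_diff pderiv_pCons)
  then have "ordeq (\<lambda>w. poly R (f w)) z 0" using an by (intro ordeq_analytic analytic_poly)
  from ordeq_mult[OF m this] have "ordeq (\<lambda>w. (f w - f z) * poly R (f w)) z m" by simp
  moreover have "poly P (f w) - c = (f w - f z) * poly R (f w)" for w
  proof -
    have "poly P (f w) - c = poly Q (f w)" by (simp add: Q_def)
    then show ?thesis by (simp add: R algebra_simps)
  qed
  ultimately show ?thesis by simp
qed

context
  fixes f x y assumes "mero_quotient f x y"
begin

interpretation mero_quotient f x y by fact

lemma poly_f_meromorphic: "(\<lambda>w. poly Q (f w)) meromorphic_on A"
  unfolding poly_altdef by (intro meromorphic_intros mero)

lemma poly_f_eventually_neq_0: "\<forall>\<^sub>F w in at z. poly Q (f w) \<noteq> 0" if "Q \<noteq> 0"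
proof -
  have "finite {a. poly Q a = 0}" using that by (rule poly_roots_finite)
  then have "\<forall>\<^sub>F w in at z. \<forall>a\<in>{a. poly Q a = 0}. f w \<noteq> a"
    using eventually_neq_at by (intro eventually_ball_finite) auto
  then show ?thesis by eventually_elim auto
qed

lemma P_f_order: "ordeq (\<lambda>w. poly P (f w)) z (zorder (\<lambda>w. poly P (f w)) z)"
  using poly_f_eventually_neq_0 P0 by (intro ordeq_zorder poly_f_meromorphic) auto

lemma D_meromorphic: "D f meromorphic_on A" "LD f meromorphic_on A"
  unfolding LD_fun D_fun by (intro meromorphic_intros poly_f_meromorphic)+

lemma f_analytic_eventually: "\<forall>\<^sub>F w in at z. f analytic_on {w}"
  using meromorphic_on_imp_analytic_cosparse[OF mero[of UNIV]] by (simp add: eventually_cosparse_UNIV_iff)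

lemma D_eventually_neq_0: "\<forall>\<^sub>F w in at z. D f w \<noteq> 0"
  using f_analytic_eventually poly_f_eventually_neq_0[OF P0(1)] poly_f_eventually_neq_0[OF P0(2)] deriv_eventually_neq_0
  by eventually_elim (simp add: D_eq)

lemma D_order: "ordeq (D f) z (zorder (D f) z)"
  by (intro ordeq_zorder D_meromorphic D_eventually_neq_0)

lemma D_ge: "ordge (D f) z (-1)" "ordge (LD f) z (-1)"
  using ordge_log_deriv[OF P_f_order] ordge_log_deriv[OF D_order] unfolding D_fun LD_fun .

lemma D_at_S1:
  assumes np: "\<not> is_pole f z" "f z \<in> S1" and m: "ordeq (\<lambda>w. f w - f z) z m"
  obtains l where "l analytic_on {z}" "l z = of_int m" "\<forall>\<^sub>F w in at z. D f w = l w / (w - z)"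
proof -
  have "ordeq (\<lambda>w. poly P (f w) - 0) z m"
    using value_order(1)[OF np(1)] m np(2) simple S1 by (intro ordeq_poly_f_diff) auto
  then have "ordeq (\<lambda>w. poly P (f w)) z m" by simp
  from log_deriv_expansion[OF this] show ?thesis using that unfolding D_fun by blast
qed

text \<open>P'(f) vanishes to order at least 2 m and f' to order at least m - 1, where m is the
  multiplicity of \<open>f\<close> at \<open>z\<close>, while P(f) does not vanish at
  \<open>z\<close>.\<close>

lemma D_at_S2:
  assumes np: "\<not> is_pole f z" "f z \<in> S2"
  shows "ordge (D f) z 2"
proof -
  define m where "m = int (nat (zorder (\<lambda>w. f w - f z) z))"
  note v = value_order[OF np(1), folded m_def]
  have m: "m \<ge> 1" unfolding m_def using value_order(2)[OF np(1)] by linarith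
  have "[:- f z, 1:] ^ 2 dvd pderiv P"
    using multiple[OF np(2)] order_1 power_le_dvd by blast
  then obtain R where R: "pderiv P = [:- f z, 1:] ^ 2 * R" unfolding dvd_def by blast
  have "ordge (\<lambda>w. (f w - f z) ^ 2) z (int 2 * m)"
    by (intro ordge_power ordeq_imp_ordge v)
  moreover have "ordge (\<lambda>w. poly R (f w) * (1 / poly P (f w))) z 0"
    using v(1) np(2) disjoint S1 by (intro ordge_analytic analytic_intros analytic_poly) auto
  ultimately have "ordge (\<lambda>w. (f w - f z) ^ 2 * (deriv f w * (poly R (f w) * (1 / poly P (f w))))) z
      (int 2 * m + ((m - 1) + 0))"
    by (intro ordge_mult deriv_order_value v(3))
  then have "ordge (\<lambda>w. (f w - f z) ^ 2 * (deriv f w * (poly R (f w) * (1 / poly P (f w))))) z 2"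
    by (rule ordge_mono) (use m in auto)
  moreover have "\<forall>\<^sub>F w in at z. D f w = (f w - f z) ^ 2 * (deriv f w * (poly R (f w) * (1 / poly P (f w))))"
    using D_eq_eventually[OF v(1)] unfolding eventually_at_filter
    by eventually_elim (simp add: R)
  ultimately show ?thesis by (rule ordge_cong[rotated])
qed

text \<open>Here \<open>D f\<close> is f' times a nonvanishing analytic function, so
  \<open>deriv f * LD f\<close> is regular although \<open>LD f\<close> has poles at the zeros of
  f'.\<close>

lemma D_elsewhere:
  assumes np: "\<not> is_pole f z" "f z \<notin> S1 \<union> S2"
  shows "ordge (D f) z 0" "ordge (\<lambda>w. deriv f w * LD f w) z 0"
proof -
  note v = value_order[OF np(1)]
  define u where "u = (\<lambda>w. poly (pderiv P) (f w) * (1 / poly P (f w)))"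
  have u: "u analytic_on {z}" "u z \<noteq> 0"
    unfolding u_def using v(1) np S1 S2 by (auto intro!: analytic_intros analytic_poly)
  have an': "deriv f analytic_on {z}" using v(1) by (rule analytic_deriv)
  have ev: "\<forall>\<^sub>F w in at z. D f w = u w * deriv f w"
    using D_eq_eventually[OF v(1)] unfolding eventually_at_filter by eventually_elim (simp add: u_def)
  have "ordge (\<lambda>w. u w * deriv f w) z 0" by (intro ordge_analytic analytic_on_mult u an')
  then show D0: "ordge (D f) z 0" by (rule ordge_cong[OF ev])
  have "ordge (\<lambda>w. deriv (D f) w * (1 / u w)) z (0 + 0)"
    using u by (intro ordge_mult ordge_deriv_0 D0 ordge_analytic analytic_intros) auto
  moreover have "\<forall>\<^sub>F w in at z. deriv f w * LD f w = deriv (D f) w * (1 / u w)"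
    using ev deriv_eventually_neq_0 analytic_eventually_neq_0[OF u]
    by eventually_elim (simp add: LD_def)
  ultimately show "ordge (\<lambda>w. deriv f w * LD f w) z 0" using ordge_cong by force
qed

end

end

lemma truncate_mult_3: "truncate_mult 3 m = (if m \<le> 3 then m else 4)"
  by (simp add: truncate_mult_def numeral_eq_enat)

definition mult_at :: "(complex \<Rightarrow> complex) \<Rightarrow> complex \<Rightarrow> nat" where
  "mult_at f z = nat (zorder (\<lambda>w. f w - f z) z)"

lemma preimage_mset_3:
  assumes "finite S"
  shows "preimage_mset f S 3 z =
    (if \<not> is_pole f z \<and> f z \<in> S then (if mult_at f z \<le> 3 then mult_at f z else 4) else 0)"
proof (cases "is_pole f z")
  case True
  then show ?thesis by (simp add: preimage_mset_def apoints_def is_apoint_def)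
next
  case False
  have "preimage_mset f S 3 z = (\<Sum>a\<in>S. if f z = a then truncate_mult 3 (mult_at f z) else 0)"
    unfolding preimage_mset_def using False
    by (intro sum.cong) (auto simp: apoints_def is_apoint_def mult_at_def)
  then show ?thesis using False assms by (simp add: sum.delta' truncate_mult_3)
qed

text \<open>The value at \<open>z\<close> is recorded because \<open>equal_multiplicity\<close>
  evaluates \<open>H\<close> there.\<close>

lemma ordge_simple_quotient:
  assumes "d analytic_on {z}" "d z = 0"
  obtains e where "e analytic_on {z}" "\<forall>\<^sub>F w in at z. d w / (w - z) = e w" "e z = deriv d z"
proof -
  from ordge_analytic_zero[OF assms] obtain e where
    e: "e analytic_on {z}" "\<forall>\<^sub>F w in at z. d w = e w * (w - z) powi 1" by (auto simp: ordge_def)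
  from e(2) have "\<forall>\<^sub>F w in at z. d w = e w * (w - z)" by eventually_elim simp
  then have nh: "\<forall>\<^sub>F w in nhds z. d w = e w * (w - z)"
    using assms(2) by (auto simp: eventually_at_filter elim!: eventually_mono)
  have "(e has_field_derivative deriv e z) (at z)"
    using e(1) analytic_on_imp_differentiable_at[of e "{z}" z] by (simp add: DERIV_deriv_iff_field_differentiable)
  then have "((\<lambda>w. e w * (w - z)) has_field_derivative deriv e z * (z - z) + (1 - 0) * e z) (at z)"
    by (intro DERIV_mult DERIV_diff DERIV_ident DERIV_const)
  then have "deriv (\<lambda>w. e w * (w - z)) z = e z" by (simp add: DERIV_imp_deriv)
  moreover have "deriv d z = deriv (\<lambda>w. e w * (w - z)) z" using nh by (rule deriv_cong_ev) simp
  moreover from e(2) eventually_neq have "\<forall>\<^sub>F w in at z. d w / (w - z) = e w"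
    by eventually_elim simp
  ultimately show thesis using that[of e] e(1) by simp
qed

context critically_injective
begin

context
  fixes f x y assumes mq: "mero_quotient f x y"
begin

interpretation mero_quotient f x y by (rule mq)

lemma orders_at_pole:
  assumes "is_pole f z"
  obtains p where "p \<ge> (1::int)" "ordge (deriv f) z (- p - 1)" "ordge (invprod S1 f) z (int n * p)"
    "ordge (invprod S2 f) z (int k * p)" "ordge (\<lambda>w. 1 / y w) z (- p)"
proof -
  from pole_order[OF assms] obtain p where p: "p \<ge> 1" "ordeq f z (- int p)" "ordeq y z (int p)" by blast
  show thesis
  proof (rule that[of "int p"])
    show "ordge (deriv f) z (- int p - 1)" using ordge_deriv[OF ordeq_imp_ordge[OF p(2)]] .
    show "ordge (\<lambda>w. 1 / y w) z (- int p)" using ordeq_imp_ordge[OF ordeq_inverse[OF p(3)]] .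
  qed (use p ordge_invprod_pole[OF p(2,1)] finite_S card_S1 card_S2 in auto)
qed

lemma orders_at_value:
  assumes "\<not> is_pole f z"
  shows "int (mult_at f z) \<ge> 1" "ordeq (\<lambda>w. f w - f z) z (int (mult_at f z))"
    "ordge (deriv f) z (int (mult_at f z) - 1)"
    "ordge (invprod S1 f) z (if f z \<in> S1 then - int (mult_at f z) else 0)"
    "ordge (invprod S2 f) z (if f z \<in> S2 then - int (mult_at f z) else 0)"
    "ordge (\<lambda>w. 1 / y w) z 0"
proof -
  note v = value_order[OF assms, folded mult_at_def]
  show "int (mult_at f z) \<ge> 1" using v(2) by simp
  show "ordeq (\<lambda>w. f w - f z) z (int (mult_at f z))" by (rule v(3))
  show "ordge (deriv f) z (int (mult_at f z) - 1)" by (rule deriv_order_value[OF v(3)])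
  show "ordge (\<lambda>w. 1 / y w) z 0" by (rule inverse_y_order[OF assms])
qed (intro ordge_invprod_value value_order[OF assms, folded mult_at_def] finite_S)+

end

end

section \<open>Functions sharing the zeros and the critical points\<close>

text \<open>The bound on \<open>n\<close> is imposed at poles only, so entire functions satisfy it
  vacuously and both statements come from one argument.\<close>

locale sharing_pair = critically_injective P S1 S2 n k + f: mero_quotient f x y + g: mero_quotient g \<xi> \<eta>
  for P S1 S2 n k f x y g \<xi> \<eta> +
  assumes share1: "share_set_weight f g S1 3" and share2: "share_set_IM f g S2"
    and poles: "is_pole f z \<or> is_pole g z \<Longrightarrow> n + 2 * k \<ge> 10"
begin

lemmas mqf = f.mero_quotient_axioms and mqg = g.mero_quotient_axioms

text \<open>Equal counts below 4 are equal multiplicities; the count 4 records only that both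
  multiplicities are at least 4.\<close>

lemma share_S1:
  "\<not> is_pole f z \<and> f z \<in> S1 \<longleftrightarrow> \<not> is_pole g z \<and> g z \<in> S1"
  "\<not> is_pole f z \<and> f z \<in> S1 \<Longrightarrow> mult_at f z = mult_at g z \<or> (mult_at f z \<ge> 4 \<and> mult_at g z \<ge> 4)"
proof -
  have eq: "preimage_mset f S1 3 z = preimage_mset g S1 3 z"
    using share1 by (simp add: share_set_weight_def)
  have "\<not> is_pole f z \<Longrightarrow> mult_at f z \<ge> 1" "\<not> is_pole g z \<Longrightarrow> mult_at g z \<ge> 1"
    using orders_at_value(1)[OF mqf] orders_at_value(1)[OF mqg] by force+
  then show "\<not> is_pole f z \<and> f z \<in> S1 \<longleftrightarrow> \<not> is_pole g z \<and> g z \<in> S1"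
    "\<not> is_pole f z \<and> f z \<in> S1 \<Longrightarrow> mult_at f z = mult_at g z \<or> (mult_at f z \<ge> 4 \<and> mult_at g z \<ge> 4)"
    using eq unfolding preimage_mset_3[OF finite_S(1)] by (auto split: if_splits)
qed

lemma share_S2: "\<not> is_pole f z \<and> f z \<in> S2 \<longleftrightarrow> \<not> is_pole g z \<and> g z \<in> S2"
proof -
  have "z \<in> {z. \<exists>a\<in>S2. is_apoint f a z} \<longleftrightarrow> z \<in> {z. \<exists>a\<in>S2. is_apoint g a z}"
    using share2 unfolding share_set_IM_def by (rule arg_cong)
  then show ?thesis by (auto simp: is_apoint_def)
qed

text \<open>The factors of \<open>F\<close> balance at the shared points. Over \<open>S1\<close>, where \<open>\<Phi>\<close> is regular for equal
  multiplicities, \<open>H\<close> vanishes if both are 1 and \<open>f' g'\<close> suffices if they are larger; distinct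
  multiplicities are at least 4, which leaves room for the poles of \<open>\<Phi>\<close> and \<open>H\<close>. Over \<open>S2\<close>, \<open>\<Phi>\<close> has
  a double zero because \<open>P'\<close> has no simple zeros.\<close>
definition \<Phi> where "\<Phi> w = D f w - D g w"
definition H where "H w = (LD f w - D f w) - (LD g w - D g w)"
definition W where "W w = deriv f w * deriv g w * H w"
definition F where "F w = W w ^ 2 * (\<Phi> w ^ 3 * (invprod S1 f w * (invprod S1 g w *
  (invprod S2 f w ^ 2 * (invprod S2 g w ^ 2 * (1 / y w * (1 / \<eta> w)))))))"

lemma \<Phi>_ge: "ordge \<Phi> z (-1)" and H_ge: "ordge H z (-1)"
  unfolding \<Phi>_def[abs_def] H_def[abs_def]
  by (intro ordge_add(2) D_ge[OF mqf] D_ge[OF mqg])+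

lemma F_ge:
  assumes "ordge W z t" "ordge \<Phi> z \<phi>" "ordge (invprod S1 f) z i" "ordge (invprod S1 g) z i'"
    "ordge (invprod S2 f) z j" "ordge (invprod S2 g) z j'" "ordge (\<lambda>w. 1 / y w) z e" "ordge (\<lambda>w. 1 / \<eta> w) z e'"
    and "2 * t + 3 * \<phi> + i + i' + 2 * j + 2 * j' + e + e' \<ge> 0"
  shows "ordge F z 0"
proof -
  have "ordge F z (int 2 * t + (int 3 * \<phi> + (i + (i' + (int 2 * j + (int 2 * j' + (e + e')))))))"
    unfolding F_def[abs_def] by (intro ordge_mult ordge_power assms)
  then show ?thesis by (rule ordge_mono) (use assms(9) in auto)
qed

lemma W_ge: "ordge (deriv f) z a \<Longrightarrow> ordge (deriv g) z a' \<Longrightarrow> ordge H z h \<Longrightarrow> ordge W z (a + a' + h)"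
  unfolding W_def[abs_def] by (intro ordge_mult)

text \<open>Write \<open>D f\<close> and \<open>D g\<close> as p/(w - z) and q/(w - z) with p(z) =
  q(z) = m. Then \<open>\<Phi>\<close> is the regular function e = (p - q)/(w - z) and
  \<open>H\<close> equals p'/p - q'/q - e. At \<open>z\<close> this is (p' - q')/m - (p' - q'),
  which vanishes for m = 1.\<close>

lemma equal_multiplicity:
  assumes np: "\<not> is_pole f z" "f z \<in> S1" "\<not> is_pole g z" "g z \<in> S1" and m: "mult_at f z = mult_at g z"
  shows "ordge \<Phi> z 0" "ordge H z 0" "mult_at f z = 1 \<Longrightarrow> ordge H z 1"
proof -
  define m where "m = int (mult_at f z)"
  note vf = orders_at_value[OF mqf np(1), folded m_def] and vg = orders_at_value[OF mqg np(3), folded m, folded m_def]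
  obtain p where p: "p analytic_on {z}" "p z = of_int m" "\<forall>\<^sub>F w in at z. D f w = p w / (w - z)"
    using D_at_S1[OF mqf np(1,2) vf(2)] .
  obtain q where q: "q analytic_on {z}" "q z = of_int m" "\<forall>\<^sub>F w in at z. D g w = q w / (w - z)"
    using D_at_S1[OF mqg np(3,4) vg(2)] .
  have pq0: "p z \<noteq> 0" "q z \<noteq> 0" using p(2) q(2) vf(1) by auto
  have "(\<lambda>w. p w - q w) analytic_on {z}" using p(1) q(1) by (intro analytic_intros)
  from ordge_simple_quotient[OF this] obtain e where
    e: "e analytic_on {z}" "\<forall>\<^sub>F w in at z. (p w - q w) / (w - z) = e w" "e z = deriv (\<lambda>w. p w - q w) z"
    using p(2) q(2) by auto
  have diff: "p field_differentiable at z" "q field_differentiable at z"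
    using p(1) q(1) analytic_on_imp_differentiable_at by blast+
  have dp: "deriv p analytic_on {z}" "deriv q analytic_on {z}" using p(1) q(1) by (auto intro: analytic_deriv)
  from p(3) q(3) e(2) have "\<forall>\<^sub>F w in at z. \<Phi> w = e w"
    by eventually_elim (simp add: \<Phi>_def diff_divide_distrib)
  then show "ordge \<Phi> z 0" by (rule ordge_cong[OF _ ordge_analytic[OF e(1)]])
  define r where "r = (\<lambda>w. deriv p w / p w - deriv q w / q w - e w)"
  have r: "r analytic_on {z}" unfolding r_def using p(1) q(1) e(1) dp pq0 by (intro analytic_intros) auto
  from log_deriv_simple_pole[OF p(1) pq0(1) p(3)] log_deriv_simple_pole[OF q(1) pq0(2) q(3)] p(3) q(3) e(2)
  have Hr: "\<forall>\<^sub>F w in at z. H w = r w"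
  proof eventually_elim
    case (elim w)
    show ?case
      unfolding H_def LD_def elim(1,2) unfolding elim(3,4) r_def elim(5)[symmetric]
      by (simp add: diff_divide_distrib)
  qed
  show "ordge H z 0" by (rule ordge_cong[OF Hr ordge_analytic[OF r]])
  show "ordge H z 1" if "mult_at f z = 1"
  proof -
    have "m = 1" using that by (simp add: m_def)
    then have "r z = 0" using p(2) q(2) e(3) diff by (simp add: r_def)
    then show ?thesis by (rule ordge_cong[OF Hr ordge_analytic_zero[OF r]])
  qed
qed

lemma F_order: "ordge F z 0"
proof -
  consider (S1) "\<not> is_pole f z" "f z \<in> S1" "\<not> is_pole g z" "g z \<in> S1"
    | (S2) "\<not> is_pole f z" "f z \<in> S2" "\<not> is_pole g z" "g z \<in> S2"
    | (other) "is_pole f z \<or> f z \<notin> S1 \<union> S2" "is_pole g z \<or> g z \<notin> S1 \<union> S2"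
    using share_S1(1)[of z] share_S2[of z] by blast
  then show ?thesis
  proof cases
    case S1
    define m m' where "m = int (mult_at f z)" and "m' = int (mult_at g z)"
    note vf = orders_at_value[OF mqf S1(1), folded m_def] and vg = orders_at_value[OF mqg S1(3), folded m'_def]
    have nS2: "f z \<notin> S2" "g z \<notin> S2" using S1 disjoint by auto
    note I = vf(4)[simplified S1 if_True] vg(4)[simplified S1 if_True] vf(5)[simplified nS2 if_False] vg(5)[simplified nS2 if_False]
    show ?thesis
    proof (cases "mult_at f z = mult_at g z")
      case True
      note eq = equal_multiplicity[OF S1 True]
      have mm: "m' = m" using True by (simp add: m_def m'_def)
      show ?thesis
      proof (cases "m = 1")
        case True
        then have "ordge H z 1" using eq(3) by (simp add: m_def)
        \<comment> \<open>The total is 2 - 1 - 1 = 0: the squared zero of \<open>H\<close> pays for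
          the simple poles of both \<open>invprod S1\<close> factors.\<close>
        from F_ge[OF W_ge[OF vf(3) vg(3) this] eq(1) I vf(6) vg(6)] show ?thesis
          using True mm by simp
      next
        case False
        \<comment> \<open>The total is \<open>2 * (2 * m - 2) - 2 * m = 2 * m - 4\<close>, with
          \<open>m\<close> at least 2.\<close>
        from F_ge[OF W_ge[OF vf(3) vg(3) eq(2)] eq(1) I vf(6) vg(6)] show ?thesis
          using False mm vf(1) by simp
      qed
    next
      case False
      \<comment> \<open>The total is \<open>m + m' - 9\<close>, and distinct integers that are at
        least 4 have sum at least 9. This is where weight 3 enters.\<close>
      then have "m \<noteq> m'" "m \<ge> 4" "m' \<ge> 4" using share_S1(2)[of z] S1 by (auto simp: m_def m'_def)
      then show ?thesis
        by (intro F_ge[OF W_ge[OF vf(3) vg(3) H_ge] \<Phi>_ge I vf(6) vg(6)]) presburger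
    qed
  next
    case S2
    define m m' where "m = int (mult_at f z)" and "m' = int (mult_at g z)"
    note vf = orders_at_value[OF mqf S2(1), folded m_def] and vg = orders_at_value[OF mqg S2(3), folded m'_def]
    have nS1: "f z \<notin> S1" "g z \<notin> S1" using S2 disjoint by auto
    note I = vf(4)[simplified nS1 if_False] vg(4)[simplified nS1 if_False] vf(5)[simplified S2 if_True] vg(5)[simplified S2 if_True]
    have "ordge \<Phi> z 2" unfolding \<Phi>_def[abs_def]
      by (intro ordge_add(2) D_at_S2[OF mqf S2(1,2)] D_at_S2[OF mqg S2(3,4)])
    \<comment> \<open>The multiplicities cancel and leave -6 + 6 = 0: the double zero of
      \<open>\<Phi>\<close>, cubed, is just enough.\<close>
    from F_ge[OF W_ge[OF vf(3) vg(3) H_ge] this I vf(6) vg(6)] show ?thesis by simp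
  next
    case other
    consider "is_pole f z" "is_pole g z" | "is_pole f z" "\<not> is_pole g z" | "\<not> is_pole f z" "is_pole g z"
      | "\<not> is_pole f z" "\<not> is_pole g z" by blast
    then show ?thesis
    proof cases
      case 1
      obtain p where p: "p \<ge> 1" "ordge (deriv f) z (- p - 1)" "ordge (invprod S1 f) z (int n * p)"
        "ordge (invprod S2 f) z (int k * p)" "ordge (\<lambda>w. 1 / y w) z (- p)"
        using orders_at_pole[OF mqf 1(1)] .
      obtain q where q: "q \<ge> 1" "ordge (deriv g) z (- q - 1)" "ordge (invprod S1 g) z (int n * q)"
        "ordge (invprod S2 g) z (int k * q)" "ordge (\<lambda>w. 1 / \<eta> w) z (- q)"
        using orders_at_pole[OF mqg 1(2)] .
      \<comment> \<open>The total is \<open>(n + 2 * k - 3) * (p + q) - 9\<close>, with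
        \<open>p + q\<close> at least 2.\<close>
      have "int n + 2 * int k \<ge> 10" using poles 1 by force
      then have "10 * (p + q) \<le> (int n + 2 * int k) * (p + q)" using p(1) q(1) by (intro mult_right_mono) auto
      then have "2 * (- p - 1 + (- q - 1) + - 1) + 3 * - 1 + int n * p + int n * q + 2 * (int k * p) + 2 * (int k * q) + - p + - q \<ge> 0"
        using p(1) q(1) by (simp add: algebra_simps)
      then show ?thesis by (rule F_ge[OF W_ge[OF p(2) q(2) H_ge] \<Phi>_ge p(3) q(3) p(4) q(4) p(5) q(5)])
    next
      case 2
      obtain p where p: "p \<ge> 1" "ordge (deriv f) z (- p - 1)" "ordge (invprod S1 f) z (int n * p)"
        "ordge (invprod S2 f) z (int k * p)" "ordge (\<lambda>w. 1 / y w) z (- p)"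
        using orders_at_pole[OF mqf 2(1)] .
      have nS: "g z \<notin> S1" "g z \<notin> S2" using other 2 by auto
      note vg = orders_at_value[OF mqg 2(2), simplified nS if_False]
      \<comment> \<open>The total is \<open>(n + 2 * k - 3) * p - 9\<close> plus twice the
        multiplicity of \<open>g\<close>. For \<open>p = 1\<close> and multiplicity 1 it equals
        \<open>n + 2 * k - 10\<close>, the case that dictates the bound on \<open>n\<close>.\<close>
      have "int n + 2 * int k \<ge> 10" using poles 2 by force
      then have "10 * p \<le> (int n + 2 * int k) * p" using p(1) by (intro mult_right_mono) auto
      then have "2 * (- p - 1 + (int (mult_at g z) - 1) + - 1) + 3 * - 1 + int n * p + 0 + 2 * (int k * p) + 2 * 0 + - p + 0 \<ge> 0"
        using p(1) vg(1) by (simp add: algebra_simps)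
      then show ?thesis by (rule F_ge[OF W_ge[OF p(2) vg(3) H_ge] \<Phi>_ge p(3) vg(4) p(4) vg(5) p(5) vg(6)])
    next
      case 3
      obtain q where q: "q \<ge> 1" "ordge (deriv g) z (- q - 1)" "ordge (invprod S1 g) z (int n * q)"
        "ordge (invprod S2 g) z (int k * q)" "ordge (\<lambda>w. 1 / \<eta> w) z (- q)"
        using orders_at_pole[OF mqg 3(2)] .
      have nS: "f z \<notin> S1" "f z \<notin> S2" using other 3 by auto
      note vf = orders_at_value[OF mqf 3(1), simplified nS if_False]
      have "int n + 2 * int k \<ge> 10" using poles 3 by force
      then have "10 * q \<le> (int n + 2 * int k) * q" using q(1) by (intro mult_right_mono) auto
      then have "2 * (int (mult_at f z) - 1 + (- q - 1) + - 1) + 3 * - 1 + 0 + int n * q + 2 * 0 + 2 * (int k * q) + 0 + - q \<ge> 0"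
        using q(1) vf(1) by (simp add: algebra_simps)
      then show ?thesis by (rule F_ge[OF W_ge[OF vf(3) q(2) H_ge] \<Phi>_ge vf(4) q(3) vf(5) q(4) vf(6) q(5)])
    next
      case 4
      have nS: "f z \<notin> S1 \<union> S2" "g z \<notin> S1 \<union> S2" using other 4 by auto
      then have nS': "f z \<notin> S1" "f z \<notin> S2" "g z \<notin> S1" "g z \<notin> S2" by auto
      note vf = orders_at_value[OF mqf 4(1), simplified nS' if_False]
      note vg = orders_at_value[OF mqg 4(2), simplified nS' if_False]
      note Df = D_elsewhere[OF mqf 4(1) nS(1)] and Dg = D_elsewhere[OF mqg 4(2) nS(2)]
      have f'0: "ordge (deriv f) z 0" using vf(3) by (rule ordge_mono) (use vf(1) in simp)
      have g'0: "ordge (deriv g) z 0" using vg(3) by (rule ordge_mono) (use vg(1) in simp)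
      \<comment> \<open>\<open>H\<close> may have poles at zeros of f' or g'. Expanding
        \<open>W\<close> leaves \<open>LD f\<close> and \<open>LD g\<close> only in the regular
        products with their own derivatives.\<close>
      have "ordge (\<lambda>w. deriv g w * (deriv f w * LD f w) - deriv f w * (deriv g w * LD g w)
          - deriv f w * (deriv g w * (D f w - D g w))) z 0"
        using ordge_mult[OF g'0 Df(2)] ordge_mult[OF f'0 Dg(2)]
          ordge_mult[OF f'0 ordge_mult[OF g'0 ordge_add(2)[OF Df(1) Dg(1)]]]
        by (intro ordge_add(2)) simp_all
      then have "ordge W z 0"
        by (rule ordge_cong[rotated]) (simp add: W_def H_def algebra_simps)
      moreover have "ordge \<Phi> z 0" unfolding \<Phi>_def[abs_def] by (intro ordge_add(2) Df Dg)
      ultimately show ?thesis by (rule F_ge[OF _ _ vf(4) vg(4) vf(5) vg(5) vf(6) vg(6)]) simp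
    qed
  qed
qed

lemma F_meromorphic: "F meromorphic_on UNIV"
proof -
  have "y meromorphic_on UNIV" "\<eta> meromorphic_on UNIV"
    using f.pair g.pair unfolding entire_pair_def
    by (auto intro!: analytic_on_imp_meromorphic_on simp: analytic_on_open)
  then show ?thesis
    unfolding F_def[abs_def] W_def \<Phi>_def H_def invprod_def
    by (intro meromorphic_intros f.mero g.mero D_meromorphic[OF mqf] D_meromorphic[OF mqg])
qed

text \<open>In the expansion of \<open>W\<close> each \<open>LD\<close> meets its own derivative,
  which is the combination that \<open>norm_D_le\<close> controls.\<close>

lemma W_bound:
  assumes an: "f analytic_on {w}" "g analytic_on {w}" and nV: "f w \<notin> S1 \<union> S2" "g w \<notin> S1 \<union> S2" and K: "K \<ge> 1"
    and small: "\<And>a. a \<in> S1 \<union> S2 \<Longrightarrow> norm (deriv f w) \<le> K * norm (f w - a) \<and>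
      norm (deriv (deriv f) w) \<le> K * norm (f w - a) \<and> norm (deriv g w) \<le> K * norm (g w - a) \<and>
      norm (deriv (deriv g) w) \<le> K * norm (g w - a)"
  shows "norm (\<Phi> w) \<le> 2 * real n * K"
    and "norm (W w) \<le> (6 * real n + 2) * K * (max (norm (deriv f w)) (norm (deriv (deriv f) w)) *
      max (norm (deriv g w)) (norm (deriv (deriv g) w)))"
proof -
  define T U where "T = max (norm (deriv f w)) (norm (deriv (deriv f) w))"
    and "U = max (norm (deriv g w)) (norm (deriv (deriv g) w))"
  have TU: "0 \<le> T" "0 \<le> U" "norm (deriv f w) \<le> T" "norm (deriv g w) \<le> U"
    by (auto simp: T_def U_def le_max_iff_disj)
  note bf = norm_D_le[OF an(1) nV(1) K, folded T_def] and bg = norm_D_le[OF an(2) nV(2) K, folded U_def]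
  have Df: "norm (D f w) \<le> real n * K" and Lf: "norm (deriv f w * LD f w) \<le> (2 * real n * K + 1) * T"
    using bf small by blast+
  have Dg: "norm (D g w) \<le> real n * K" and Lg: "norm (deriv g w * LD g w) \<le> (2 * real n * K + 1) * U"
    using bg small by blast+
  show \<Phi>: "norm (\<Phi> w) \<le> 2 * real n * K"
    unfolding \<Phi>_def using norm_triangle_ineq4[of "D f w" "D g w"] Df Dg by linarith
  have eq: "W w = deriv g w * (deriv f w * LD f w) - deriv f w * (deriv g w * LD g w)
      - deriv f w * deriv g w * \<Phi> w"
    by (simp add: W_def H_def \<Phi>_def algebra_simps)
  have "norm (deriv g w * (deriv f w * LD f w)) \<le> U * ((2 * real n * K + 1) * T)"
    unfolding norm_mult[of "deriv g w"] using Lf TU by (intro mult_mono) auto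
  moreover have "norm (deriv f w * (deriv g w * LD g w)) \<le> T * ((2 * real n * K + 1) * U)"
    unfolding norm_mult[of "deriv f w"] using Lg TU by (intro mult_mono) auto
  moreover have "norm (deriv f w * deriv g w * \<Phi> w) \<le> T * U * (2 * real n * K)"
    unfolding norm_mult using \<Phi> TU by (intro mult_mono mult_nonneg_nonneg) auto
  ultimately have "norm (W w) \<le> U * ((2 * real n * K + 1) * T) + T * ((2 * real n * K + 1) * U) + T * U * (2 * real n * K)"
    unfolding eq by (intro order_trans[OF norm_triangle_ineq4] add_mono)
  also have "\<dots> = (6 * real n * K + 2) * (T * U)" by (simp add: algebra_simps)
  also have "\<dots> \<le> (6 * real n * K + 2 * K) * (T * U)" using K TU by (intro mult_right_mono) auto
  finally show "norm (W w) \<le> (6 * real n + 2) * K * (T * U)" by (simp add: algebra_simps)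
qed

theorem \<Phi>_or_H_vanishes:
  assumes "\<forall>\<^sub>F w in at 0. \<Phi> w \<noteq> 0" "\<forall>\<^sub>F w in at 0. H w \<noteq> 0"
  shows False
proof -
  define \<Theta> where "\<Theta> = remove_sings F"
  have hol: "\<Theta> holomorphic_on UNIV"
    unfolding \<Theta>_def using F_meromorphic F_order by (rule ordge_0_everywhere_imp_entire)
  have cos: "\<forall>\<^sub>\<approx>z. \<Theta> z = F z" unfolding \<Theta>_def using F_meromorphic by (rule eventually_remove_sings_eq)
  define V where "V = S1 \<union> S2"
  have finV: "finite V" using finite_S by (simp add: V_def)
  have Vf: "\<forall>\<^sub>F w in at z. f w \<notin> V" and Vg: "\<forall>\<^sub>F w in at z. g w \<notin> V" for z
  proof -
    have "\<forall>\<^sub>F w in at z. \<forall>a\<in>V. f w \<noteq> a" "\<forall>\<^sub>F w in at z. \<forall>a\<in>V. g w \<noteq> a"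
      by (intro eventually_ball_finite finV ballI f.eventually_neq_at g.eventually_neq_at)+
    then show "\<forall>\<^sub>F w in at z. f w \<notin> V" "\<forall>\<^sub>F w in at z. g w \<notin> V"
      by (eventually_elim, blast)+
  qed
  define X where "X = {z. \<not> (\<Theta> z = F z \<and> f z \<notin> V \<and> g z \<notin> V)}"
  have X: "countable X" unfolding X_def
    by (intro eventually_cosparse_countable eventually_conj cos) (simp_all add: eventually_cosparse_UNIV_iff Vf Vg)
  have nz: "\<exists>z. \<Theta> z \<noteq> 0"
  proof -
    have "\<forall>\<^sub>F z in at 0. \<Theta> z = F z" using cos by (simp add: eventually_cosparse_UNIV_iff)
    moreover have "\<forall>\<^sub>F z in at 0. y z \<noteq> 0" "\<forall>\<^sub>F z in at 0. \<eta> z \<noteq> 0"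
      using non_zero_neighbour_alt[of y UNIV 0] f.y_nonzero non_zero_neighbour_alt[of \<eta> UNIV 0] g.y_nonzero
        f.pair g.pair connected_UNIV unfolding entire_pair_def by auto
    moreover have "\<forall>\<^sub>F z in at 0. deriv f z \<noteq> 0" "\<forall>\<^sub>F z in at 0. deriv g z \<noteq> 0"
      by (rule f.deriv_eventually_neq_0 g.deriv_eventually_neq_0)+
    ultimately have "\<forall>\<^sub>F z in at 0. \<Theta> z \<noteq> 0"
      using assms Vf[of 0] Vg[of 0]
      by eventually_elim (auto simp: F_def W_def invprod_def V_def finite_S)
    then show ?thesis using eventually_happens'[OF at_neq_bot] by blast
  qed
  from weight_le obtain C where C: "C \<ge> 1" and
    wt: "\<And>z T K. z \<notin> S1 \<union> S2 \<Longrightarrow> K \<ge> 1 \<Longrightarrow> 0 \<le> T \<Longrightarrow> (\<forall>a\<in>S1 \<union> S2. T \<le> K * norm (z - a)) \<Longrightarrow>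
      (1 + norm z) * (T\<^sup>2 / ((\<Prod>a\<in>S1. norm (z - a)) * (\<Prod>a\<in>S2. norm (z - a))\<^sup>2)) \<le> C * K\<^sup>2" by blast
  show False
  \<comment> \<open>The exponent 9 of \<open>K\<close> collects 2 from the square of
    \<open>W\<close>, 3 from the cube of \<open>\<Phi>\<close> and 2 from each of the two
    weights.\<close>
  proof (rule no_decaying_entire_function[OF f.pair g.pair finV f.x_neq f.y_nonzero g.x_neq g.y_nonzero hol nz X,
        where j = 1 and D = "(6 * real n + 2)\<^sup>2 * (2 * real n) ^ 3 * C\<^sup>2" and \<kappa> = 9])
    fix z K assume z: "z \<notin> X" and K: "K \<ge> 1" and yz: "y z \<noteq> 0" "\<eta> z \<noteq> 0"
      and sm: "\<And>a. a \<in> V \<Longrightarrow> norm (deriv (\<lambda>z. x z / y z) z) \<le> K * norm (x z / y z - a) \<and>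
        norm (deriv (deriv (\<lambda>z. x z / y z)) z) \<le> K * norm (x z / y z - a) \<and>
        norm (deriv (\<lambda>z. \<xi> z / \<eta> z) z) \<le> K * norm (\<xi> z / \<eta> z - a) \<and>
        norm (deriv (deriv (\<lambda>z. \<xi> z / \<eta> z)) z) \<le> K * norm (\<xi> z / \<eta> z - a)"
    have small: "norm (deriv f z) \<le> K * norm (f z - a) \<and> norm (deriv (deriv f) z) \<le> K * norm (f z - a) \<and>
        norm (deriv g z) \<le> K * norm (g z - a) \<and> norm (deriv (deriv g) z) \<le> K * norm (g z - a)" if "a \<in> S1 \<union> S2" for a
      using sm[of a] that unfolding V_def f.quot[symmetric] g.quot[symmetric]
        fun_cong[OF f.quot, symmetric] fun_cong[OF g.quot, symmetric] by blast
    have an: "f analytic_on {z}" "g analytic_on {z}"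
      using f.value_order(1) g.value_order(1) f.y_zero g.y_zero yz by auto
    have nV: "f z \<notin> S1 \<union> S2" "g z \<notin> S1 \<union> S2" and \<Theta>F: "\<Theta> z = F z" using z by (auto simp: X_def V_def)
    define T U where "T = max (norm (deriv f z)) (norm (deriv (deriv f) z))"
      and "U = max (norm (deriv g z)) (norm (deriv (deriv g) z))"
    have TU: "0 \<le> T" "0 \<le> U" by (auto simp: T_def U_def le_max_iff_disj)
    note WB = W_bound[OF an nV K small, folded T_def U_def]
    define u u' p p' q q' where "u = 1 + norm (f z)" and "u' = 1 + norm (g z)"
      and "p = (\<Prod>a\<in>S1. norm (f z - a))" and "p' = (\<Prod>a\<in>S1. norm (g z - a))"
      and "q = (\<Prod>a\<in>S2. norm (f z - a))" and "q' = (\<Prod>a\<in>S2. norm (g z - a))"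
    have wf: "u * (T\<^sup>2 / (p * q\<^sup>2)) \<le> C * K\<^sup>2"
      unfolding u_def p_def q_def using wt[OF nV(1) K TU(1)] small by (simp add: T_def)
    have wg: "u' * (U\<^sup>2 / (p' * q'\<^sup>2)) \<le> C * K\<^sup>2"
      unfolding u'_def p'_def q'_def using wt[OF nV(2) K TU(2)] small by (simp add: U_def)
    have pos: "u > 0" "u' > 0" "p > 0" "p' > 0" "q > 0" "q' > 0"
      unfolding u_def u'_def p_def p'_def q_def q'_def using nV by (auto intro!: prod_pos add_pos_nonneg)
    have "norm (\<Theta> z) = norm (W z) ^ 2 * (norm (\<Phi> z) ^ 3 * (1 / p * (1 / p' * ((1 / q) ^ 2 * ((1 / q') ^ 2 *
        (1 / norm (y z) * (1 / norm (\<eta> z))))))))"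
      by (simp add: \<Theta>F F_def norm_mult norm_power norm_divide invprod_def p_def p'_def q_def q'_def
          prod_dividef flip: prod_norm)
    moreover have "norm (x z) + norm (y z) = norm (y z) * u" "norm (\<xi> z) + norm (\<eta> z) = norm (\<eta> z) * u'"
      using f.norm_pair g.norm_pair yz by (auto simp: u_def u'_def)
    ultimately have "norm (\<Theta> z) * ((norm (x z) + norm (y z)) * (norm (\<xi> z) + norm (\<eta> z))) ^ 1 =
        norm (W z) ^ 2 * norm (\<Phi> z) ^ 3 * (u / (p * q\<^sup>2) * (u' / (p' * q'\<^sup>2)))"
      using yz by (simp add: field_simps)
    also have "\<dots> \<le> ((6 * real n + 2) * K * (T * U)) ^ 2 * (2 * real n * K) ^ 3 * (u / (p * q\<^sup>2) * (u' / (p' * q'\<^sup>2)))"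
      using WB pos K TU by (intro mult_right_mono mult_mono power_mono) auto
    also have "\<dots> = (6 * real n + 2)\<^sup>2 * (2 * real n) ^ 3 * K ^ 5 *
        ((u * (T\<^sup>2 / (p * q\<^sup>2))) * (u' * (U\<^sup>2 / (p' * q'\<^sup>2))))"
    proof -
      have "K ^ 5 = K\<^sup>2 * K ^ 3" by (simp flip: power_add)
      then show ?thesis by (simp add: power_mult_distrib mult_ac)
    qed
    also have "\<dots> \<le> (6 * real n + 2)\<^sup>2 * (2 * real n) ^ 3 * K ^ 5 * ((C * K\<^sup>2) * (C * K\<^sup>2))"
      using pos K C by (intro mult_left_mono mult_mono[OF wf wg] mult_nonneg_nonneg) auto
    also have "\<dots> = (6 * real n + 2)\<^sup>2 * (2 * real n) ^ 3 * C\<^sup>2 * K ^ 9"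
    proof -
      have "K ^ 9 = K ^ 5 * (K\<^sup>2 * K\<^sup>2)" by (simp flip: power_add)
      then show ?thesis by (simp add: power2_eq_square[of C] mult_ac)
    qed
    finally show "norm (\<Theta> z) * ((norm (x z) + norm (y z)) * (norm (\<xi> z) + norm (\<eta> z))) ^ 1 \<le>
        (6 * real n + 2)\<^sup>2 * (2 * real n) ^ 3 * C\<^sup>2 * K ^ 9" .
  qed auto
qed

end

lemma ordeq_power:
  assumes "ordeq f z i"
  shows "ordeq (\<lambda>w. f w ^ n) z (int n * i)"
proof (induction n)
  case 0
  show ?case by (simp add: ordeq_analytic)
next
  case (Suc n)
  from ordeq_mult[OF assms Suc] show ?case by (simp add: algebra_simps)
qed

section \<open>Proportional derivatives and the uniqueness property\<close>

lemma log_deriv_eq_imp_proportional: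
  assumes p: "p meromorphic_on UNIV" "\<And>z. \<forall>\<^sub>F w in at z. p w \<noteq> 0"
    and r: "r meromorphic_on UNIV" "\<And>z. \<forall>\<^sub>F w in at z. r w \<noteq> 0"
    and eq: "\<forall>\<^sub>\<approx>w. deriv p w / p w = deriv r w / r w"
  shows "\<exists>c. c \<noteq> 0 \<and> (\<forall>\<^sub>\<approx>w. p w = c * r w)"
proof -
  have an: "\<forall>\<^sub>\<approx>w. p analytic_on {w}" "\<forall>\<^sub>\<approx>w. r analytic_on {w}"
    using p(1) r(1) meromorphic_on_imp_analytic_cosparse by blast+
  have nz: "\<forall>\<^sub>\<approx>w. p w \<noteq> 0" "\<forall>\<^sub>\<approx>w. r w \<noteq> 0"
    using p(2) r(2) by (simp_all add: eventually_cosparse_UNIV_iff)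
  from an nz eq have "\<forall>\<^sub>\<approx>w. deriv (\<lambda>w. p w / r w) w = 0"
  proof eventually_elim
    case (elim w)
    have "(p has_field_derivative deriv p w) (at w)" "(r has_field_derivative deriv r w) (at w)"
      using elim(1,2) analytic_on_imp_differentiable_at DERIV_deriv_iff_field_differentiable by blast+
    then have "((\<lambda>w. p w / r w) has_field_derivative (deriv p w * r w - p w * deriv r w) / (r w * r w)) (at w)"
      using elim(4) by (rule DERIV_divide)
    moreover have "deriv p w * r w - p w * deriv r w = 0" using elim(3-5) by (simp add: field_simps)
    ultimately show ?case by (simp add: DERIV_imp_deriv)
  qed
  moreover have "(\<lambda>w. p w / r w) meromorphic_on UNIV" by (intro meromorphic_intros p r)
  ultimately obtain c where c: "\<forall>\<^sub>\<approx>w. p w / r w = c"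
    using meromorphic_deriv_zero_imp_const by blast
  from c nz have cr: "\<forall>\<^sub>\<approx>w. p w = c * r w \<and> c \<noteq> 0" by eventually_elim (auto simp: field_simps)
  have "c \<noteq> 0"
    using eventually_happens'[OF at_neq_bot cr[unfolded eventually_cosparse_UNIV_iff, rule_format, of 0]]
    by blast
  moreover from cr have "\<forall>\<^sub>\<approx>w. p w = c * r w" by eventually_elim simp
  ultimately show ?thesis by blast
qed

context critically_injective
begin

text \<open>By critical injectivity a level of \<open>P\<close> contains at most one critical point,
  here \<open>\<omega>0\<close>. Its order is at most \<open>n - 2\<close>, so at least two further
  roots remain, all of them simple.\<close>

lemma roots_of_shift:
  defines "Q \<equiv> \<lambda>c. P - [:c:]"
  obtains \<omega>0 \<omega>1 \<omega>2 where "\<omega>0 \<noteq> \<omega>1" "\<omega>0 \<noteq> \<omega>2" "\<omega>1 \<noteq> \<omega>2"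
    "poly P \<omega>0 = c" "poly P \<omega>1 = c" "poly P \<omega>2 = c"
    "order \<omega>0 (Q c) < n" "order \<omega>1 (Q c) = 1" "order \<omega>2 (Q c) = 1"
proof -
  define q where "q = Q c"
  have pd: "pderiv q = pderiv P" by (simp add: q_def Q_def pderiv_diff pderiv_pCons)
  have q0: "q \<noteq> 0" using pd P0(2) by auto
  have degq: "degree q = n"
  proof -
    have "degree (- [:c:]) < degree P" using n_ge deg by simp
    then have "degree (P + - [:c:]) = degree P" by (rule degree_add_eq_left)
    then show ?thesis by (simp only: q_def Q_def deg diff_conv_add_uminus)
  qed
  have root: "poly q \<omega> = 0 \<longleftrightarrow> poly P \<omega> = c" for \<omega> by (simp add: q_def Q_def)
  have ord: "order \<omega> q = Suc (order \<omega> (pderiv P))" if "poly P \<omega> = c" for \<omega>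
    using order_pderiv[OF q0, of \<omega>] that root pd by simp
  have ord1: "order \<omega> q = 1" if "poly P \<omega> = c" "poly (pderiv P) \<omega> \<noteq> 0" for \<omega>
    using ord[OF that(1)] that(2) by (simp add: order_0I)
  have "\<exists>\<omega>0. poly P \<omega>0 = c \<and> (\<forall>\<omega>. poly P \<omega> = c \<longrightarrow> \<omega> \<noteq> \<omega>0 \<longrightarrow> poly (pderiv P) \<omega> \<noteq> 0) \<and>
      order \<omega>0 q + 2 \<le> n"
  proof (cases "\<exists>b\<in>S2. poly P b = c")
    case True
    then obtain b where b: "b \<in> S2" "poly P b = c" by blast
    have "S2 \<noteq> {b}" using card_S2 k2 by auto
    then obtain b' where b': "b' \<in> S2" "b' \<noteq> b" using b by blast
    have "order b (pderiv P) + order b' (pderiv P) = (\<Sum>a\<in>{b, b'}. order a (pderiv P))"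
      using b' by simp
    also have "\<dots> \<le> n - 1" unfolding sum_order[symmetric] using b b' finite_S by (intro sum_mono2) auto
    \<comment> \<open>The other critical point takes at least 2 of \<open>n - 1\<close>, so
      \<open>pderiv P\<close> has order at most \<open>n - 3\<close> at \<open>b\<close>, and
      \<open>q\<close> has one more.\<close>
    finally have "order b q + 2 \<le> n" using ord[OF b(2)] multiple[OF b'(1)] n_ge by linarith
    moreover have "\<forall>\<omega>. poly P \<omega> = c \<longrightarrow> \<omega> \<noteq> b \<longrightarrow> poly (pderiv P) \<omega> \<noteq> 0"
      using inj[OF _ b(1)] b(2) S2 by auto
    ultimately show ?thesis using b(2) by blast
  next
    case False
    have "\<not> constant (poly q)" using degq n_ge by (simp add: constant_degree)
    then obtain \<omega>0 where w: "poly P \<omega>0 = c" using fundamental_theorem_of_algebra root by blast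
    have "poly (pderiv P) \<omega> \<noteq> 0" if "poly P \<omega> = c" for \<omega> using False that S2 by auto
    then show ?thesis using w ord1[OF w] n_ge by (intro exI[of _ \<omega>0]) auto
  qed
  then obtain \<omega>0 where w0: "poly P \<omega>0 = c" "order \<omega>0 q + 2 \<le> n"
    and simple': "\<And>\<omega>. poly P \<omega> = c \<Longrightarrow> \<omega> \<noteq> \<omega>0 \<Longrightarrow> poly (pderiv P) \<omega> \<noteq> 0" by blast
  from order_decomp[OF q0] obtain R where R: "q = [:- \<omega>0, 1:] ^ order \<omega>0 q * R" "\<not> [:- \<omega>0, 1:] dvd R" by blast
  have R0: "R \<noteq> 0" using R(2) by auto
  have "degree q = order \<omega>0 q + degree R"
    by (subst R(1), subst degree_mult_eq) (use R0 in \<open>auto simp: degree_power_eq\<close>)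
  then have degR: "degree R \<ge> 2" using w0(2) degq by simp
  then have "\<not> constant (poly R)" by (simp add: constant_degree)
  then obtain \<omega>1 where w1: "poly R \<omega>1 = 0" using fundamental_theorem_of_algebra by blast
  then obtain R1 where R1: "R = [:- \<omega>1, 1:] * R1" by (metis poly_eq_0_iff_dvd dvdE)
  have "degree R = Suc (degree R1)" unfolding R1 using R0 R1 by (subst degree_mult_eq) auto
  then have "\<not> constant (poly R1)" using degR by (simp add: constant_degree)
  then obtain \<omega>2 where w2: "poly R1 \<omega>2 = 0" using fundamental_theorem_of_algebra by blast
  have Rw2: "poly R \<omega>2 = 0" using w2 by (simp add: R1)
  have rootR: "\<omega> \<noteq> \<omega>0 \<and> poly P \<omega> = c" if "poly R \<omega> = 0" for \<omega>
  proof
    show "\<omega> \<noteq> \<omega>0" using that R(2) by (auto simp: poly_eq_0_iff_dvd)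
    have "poly q \<omega> = 0" by (subst R(1)) (simp add: that)
    then show "poly P \<omega> = c" using root by simp
  qed
  note r1 = rootR[OF w1] and r2 = rootR[OF Rw2]
  have o1: "order \<omega>1 q = 1" and o2: "order \<omega>2 q = 1"
    using ord1 simple' r1 r2 by blast+
  have "\<omega>1 \<noteq> \<omega>2"
  proof
    assume eq: "\<omega>1 = \<omega>2"
    then have "[:- \<omega>1, 1:] dvd R1" using w2 by (simp add: poly_eq_0_iff_dvd)
    then have "[:- \<omega>1, 1:] * [:- \<omega>1, 1:] dvd R" unfolding R1 by (rule mult_dvd_mono[OF dvd_refl])
    then have "[:- \<omega>1, 1:] ^ 2 dvd q" by (subst R(1)) (simp add: power2_eq_square)
    then show False using o1 q0 by (simp add: order_divides)
  qed
  then show thesis using that[of \<omega>0 \<omega>1 \<omega>2] r1 r2 w0 o1 o2 by (auto simp: q_def)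
qed

text \<open>Where P(g) takes the value -A/B the right-hand side vanishes, so P(f) has a pole and
  hence so does \<open>f\<close>, of some order p. Both sides of the conclusion are the order of
  that pole of P(f).\<close>

lemma ramified_over_shift:
  assumes mqf: "mero_quotient f x y" and mqg: "mero_quotient g \<xi> \<eta>" and AB: "A \<noteq> 0" "B \<noteq> 0"
    and eq: "\<forall>\<^sub>\<approx>w. 1 / poly P (f w) = A / poly P (g w) + B"
    and \<omega>: "poly P \<omega> = - A / B" and z: "\<not> is_pole g z" "g z = \<omega>"
  shows "\<exists>p\<ge>1. int (order \<omega> (P - [:- A / B:])) * zorder (\<lambda>w. g w - \<omega>) z = int (n * p)"
proof -
  interpret f: mero_quotient f x y by (rule mqf)
  interpret g: mero_quotient g \<xi> \<eta> by (rule mqg)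
  define q where "q = P - [:- A / B:]"
  define \<mu> where "\<mu> = order \<omega> q"
  define m where "m = zorder (\<lambda>w. g w - \<omega>) z"
  note v = g.value_order[OF z(1), unfolded z(2)]
  have m: "m \<ge> 1" "ordeq (\<lambda>w. g w - \<omega>) z m" using v(2,3) by (auto simp: m_def split: if_splits)
  have pd: "pderiv q = pderiv P" by (simp add: q_def pderiv_diff pderiv_pCons)
  have q0: "q \<noteq> 0" using pd P0(2) by auto
  have \<mu>: "\<mu> \<ge> 1"
  proof -
    have "poly q \<omega> = 0" using \<omega> by (simp add: q_def)
    then show ?thesis using q0 by (simp add: \<mu>_def order_root)
  qed
  from order_decomp[OF q0] obtain R where R: "q = [:- \<omega>, 1:] ^ \<mu> * R" "\<not> [:- \<omega>, 1:] dvd R"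
    unfolding \<mu>_def by blast
  have Rw: "poly R \<omega> \<noteq> 0" using R(2) by (simp add: poly_eq_0_iff_dvd)
  have c0: "poly P (g z) \<noteq> 0" using \<omega> z AB by simp
  have u: "ordeq (\<lambda>w. B * poly R (g w) * (1 / poly P (g w))) z 0"
    using v(1) c0 Rw z AB by (intro ordeq_analytic analytic_intros analytic_poly) auto
  have "ordeq (\<lambda>w. (g w - \<omega>) ^ \<mu> * (B * poly R (g w) * (1 / poly P (g w)))) z (int \<mu> * m + 0)"
    by (intro ordeq_mult ordeq_power m u)
  moreover have "\<forall>\<^sub>F w in at z. 1 / poly P (f w) = (g w - \<omega>) ^ \<mu> * (B * poly R (g w) * (1 / poly P (g w)))"
  proof -
    have "\<forall>\<^sub>F w in at z. 1 / poly P (f w) = A / poly P (g w) + B"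
      using eq by (simp add: eventually_cosparse_UNIV_iff)
    moreover have "\<forall>\<^sub>F w in at z. poly P (g w) \<noteq> 0" by (rule poly_f_eventually_neq_0[OF mqg P0(1)])
    ultimately show ?thesis
    proof eventually_elim
      case (elim w)
      have "poly q (g w) = (g w - \<omega>) ^ \<mu> * poly R (g w)"
        by (subst R(1)) simp
      moreover have "poly q (g w) = poly P (g w) + A / B" by (simp add: q_def)
      ultimately have "(g w - \<omega>) ^ \<mu> * poly R (g w) = poly P (g w) + A / B" by simp
      moreover have "A / poly P (g w) + B = B * (poly P (g w) + A / B) * (1 / poly P (g w))"
        using AB elim by (simp add: field_simps)
      ultimately show ?case using elim(1) by (simp add: mult_ac)
    qed
  qed
  ultimately have "ordeq (\<lambda>w. 1 / poly P (f w)) z (int \<mu> * m)" using ordeq_cong by force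
  from ordeq_inverse[OF this] have Pf: "ordeq (\<lambda>w. poly P (f w)) z (- (int \<mu> * m))" by simp
  have neg: "- (int \<mu> * m) < 0" using \<mu> m(1) by simp
  have "is_pole f z"
  proof (rule ccontr)
    assume "\<not> is_pole f z"
    then have "(\<lambda>w. poly P (f w)) analytic_on {z}" by (intro analytic_poly f.value_order)
    moreover have "\<exists>\<^sub>F w in at z. poly P (f w) \<noteq> 0"
      using poly_f_eventually_neq_0[OF mqf P0(1)] by (simp add: eventually_frequently)
    ultimately have "zorder (\<lambda>w. poly P (f w)) z \<ge> 0" by (rule zorder_ge_0)
    then show False using ordeq_zorder_eq[OF Pf] neg by simp
  qed
  then obtain p where p: "p \<ge> 1" "ordeq f z (- int p)" using f.pole_order by blast
  from ordeq_zorder_eq[OF ordeq_poly_pole[OF p(2,1) P0(1)]] ordeq_zorder_eq[OF Pf]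
  have "int \<mu> * m = int (n * p)" by (simp add: deg)
  then show ?thesis using p(1) by (auto simp: \<mu>_def m_def q_def)
qed

text \<open>The product of root order and ramification index is a positive multiple of
  \<open>n\<close>, and \<open>n\<close> is at least 5. A simple root therefore has index at least
  5, and a root of order below \<open>n\<close> has index at least 2.\<close>

lemma no_nonlinear_relation:
  assumes mqf: "mero_quotient f x y" and mqg: "mero_quotient g \<xi> \<eta>" and AB: "A \<noteq> 0" "B \<noteq> 0"
    and eq: "\<forall>\<^sub>\<approx>w. 1 / poly P (f w) = A / poly P (g w) + B"
  shows False
proof -
  obtain \<omega>0 \<omega>1 \<omega>2 where w: "\<omega>0 \<noteq> \<omega>1" "\<omega>0 \<noteq> \<omega>2" "\<omega>1 \<noteq> \<omega>2"
    "poly P \<omega>0 = - A / B" "poly P \<omega>1 = - A / B" "poly P \<omega>2 = - A / B"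
    "order \<omega>0 (P - [:- A / B:]) < n" "order \<omega>1 (P - [:- A / B:]) = 1" "order \<omega>2 (P - [:- A / B:]) = 1"
    using roots_of_shift[of "- A / B"] .
  note ram = ramified_over_shift[OF mqf mqg AB eq]
  have g: "nonconst_meromorphic g" using mqg by (rule mero_quotient.f)
  have five: "5 \<le> int (n * p)" if "p \<ge> 1" for p
    using n_ge that mult_mono[of 5 n 1 p] by (simp flip: of_nat_mult)
  show False
  proof (rule no_2_5_5_ramification[OF g w(1,2,3)])
    fix z assume "\<not> is_pole g z" "g z = \<omega>0"
    from ram[OF w(4) this] obtain p where p: "p \<ge> 1"
      "int (order \<omega>0 (P - [:- A / B:])) * zorder (\<lambda>w. g w - \<omega>0) z = int (n * p)" by blast
    show "2 \<le> zorder (\<lambda>w. g w - \<omega>0) z"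
    proof (rule ccontr)
      assume "\<not> ?thesis"
      then have "int (order \<omega>0 (P - [:- A / B:])) * zorder (\<lambda>w. g w - \<omega>0) z \<le>
          int (order \<omega>0 (P - [:- A / B:])) * 1" by (intro mult_left_mono) auto
      then have "int (n * p) \<le> int (order \<omega>0 (P - [:- A / B:]))" using p(2) by simp
      moreover have "n * 1 \<le> n * p" using p(1) by (intro mult_left_mono) auto
      ultimately show False using w(7) by linarith
    qed
  next
    fix z assume "\<not> is_pole g z" "g z = \<omega>1"
    from ram[OF w(5) this] show "5 \<le> zorder (\<lambda>w. g w - \<omega>1) z" using five w(8) by auto
  next
    fix z assume "\<not> is_pole g z" "g z = \<omega>2"
    from ram[OF w(6) this] show "5 \<le> zorder (\<lambda>w. g w - \<omega>2) z" using five w(9) by auto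
  qed
qed

end

context sharing_pair
begin

theorem eq_if_uniqueness_polynomial:
  assumes up: "uniqueness_polynomial P"
  shows "f = g"
proof -
  have uniq: "f = g" if "c \<noteq> 0" "\<forall>\<^sub>\<approx>z. poly P (f z) = c * poly P (g z)" for c
    using up f.f g.f that unfolding uniqueness_polynomial_def by blast
  have Pf: "(\<lambda>w. poly P (f w)) meromorphic_on UNIV" "(\<lambda>w. poly P (g w)) meromorphic_on UNIV"
    using poly_f_meromorphic[OF mqf] poly_f_meromorphic[OF mqg] by auto
  have nzP: "\<forall>\<^sub>F w in at z. poly P (f w) \<noteq> 0" "\<forall>\<^sub>F w in at z. poly P (g w) \<noteq> 0" for z
    using poly_f_eventually_neq_0[OF mqf P0(1)] poly_f_eventually_neq_0[OF mqg P0(1)] by auto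
  have nzD: "\<forall>\<^sub>F w in at z. D f w \<noteq> 0" "\<forall>\<^sub>F w in at z. D g w \<noteq> 0" for z
    using D_eventually_neq_0[OF mqf] D_eventually_neq_0[OF mqg] by auto
  have mero: "\<Phi> meromorphic_on UNIV" "H meromorphic_on UNIV"
    unfolding \<Phi>_def[abs_def] H_def[abs_def]
    by (intro meromorphic_intros D_meromorphic[OF mqf] D_meromorphic[OF mqg])+
  have "(\<forall>\<^sub>\<approx>z. \<Phi> z = 0) \<or> (\<forall>\<^sub>\<approx>z. \<Phi> z \<noteq> 0)" "(\<forall>\<^sub>\<approx>z. H z = 0) \<or> (\<forall>\<^sub>\<approx>z. H z \<noteq> 0)"
    by (intro meromorphic_imp_constant_or_avoid mero open_UNIV connected_UNIV)+
  then consider "\<forall>\<^sub>\<approx>z. \<Phi> z = 0" | "\<forall>\<^sub>\<approx>z. H z = 0"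
    using \<Phi>_or_H_vanishes by (auto simp: eventually_cosparse_UNIV_iff)
  then show ?thesis
  proof cases
    case 1
    then have "\<forall>\<^sub>\<approx>w. deriv (\<lambda>w. poly P (f w)) w / poly P (f w) = deriv (\<lambda>w. poly P (g w)) w / poly P (g w)"
      by eventually_elim (simp add: \<Phi>_def D_def)
    then show ?thesis
      using log_deriv_eq_imp_proportional[OF Pf(1) nzP(1) Pf(2) nzP(2)] uniq by blast
  next
    case 2
    \<comment> \<open>Up to sign these are the derivatives of 1/P(f) and 1/P(g);
      \<open>H = 0\<close> says that their logarithmic derivatives agree.\<close>
    define u v where "u = (\<lambda>w. D f w / poly P (f w))" and "v = (\<lambda>w. D g w / poly P (g w))"
    have uv: "u meromorphic_on UNIV" "v meromorphic_on UNIV"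
      unfolding u_def v_def by (intro meromorphic_intros Pf D_meromorphic[OF mqf] D_meromorphic[OF mqg])+
    have nzuv: "\<forall>\<^sub>F w in at z. u w \<noteq> 0" "\<forall>\<^sub>F w in at z. v w \<noteq> 0" for z
    proof -
      from nzD(1)[of z] nzP(1)[of z] show "\<forall>\<^sub>F w in at z. u w \<noteq> 0"
        unfolding u_def by eventually_elim simp
      from nzD(2)[of z] nzP(2)[of z] show "\<forall>\<^sub>F w in at z. v w \<noteq> 0"
        unfolding v_def by eventually_elim simp
    qed
    have an: "\<forall>\<^sub>\<approx>w. D f analytic_on {w}" "\<forall>\<^sub>\<approx>w. D g analytic_on {w}"
      "\<forall>\<^sub>\<approx>w. (\<lambda>w. poly P (f w)) analytic_on {w}" "\<forall>\<^sub>\<approx>w. (\<lambda>w. poly P (g w)) analytic_on {w}"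
      using meromorphic_on_imp_analytic_cosparse D_meromorphic[OF mqf] D_meromorphic[OF mqg] Pf by blast+
    have nz: "\<forall>\<^sub>\<approx>w. D f w \<noteq> 0" "\<forall>\<^sub>\<approx>w. D g w \<noteq> 0" "\<forall>\<^sub>\<approx>w. poly P (f w) \<noteq> 0" "\<forall>\<^sub>\<approx>w. poly P (g w) \<noteq> 0"
      using nzD nzP by (simp_all add: eventually_cosparse_UNIV_iff)
    have ld: "deriv (\<lambda>w. a w / b w) w / (a w / b w) = deriv a w / a w - deriv b w / b w"
      if "a analytic_on {w}" "b analytic_on {w}" "a w \<noteq> 0" "b w \<noteq> 0" for a b :: "complex \<Rightarrow> complex" and w
    proof -
      have "(a has_field_derivative deriv a w) (at w)" "(b has_field_derivative deriv b w) (at w)"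
        using that(1,2) analytic_on_imp_differentiable_at DERIV_deriv_iff_field_differentiable by blast+
      then have "((\<lambda>w. a w / b w) has_field_derivative (deriv a w * b w - a w * deriv b w) / (b w * b w)) (at w)"
        using that(4) by (rule DERIV_divide)
      then have "deriv (\<lambda>w. a w / b w) w = (deriv a w * b w - a w * deriv b w) / (b w * b w)"
        by (rule DERIV_imp_deriv)
      then show ?thesis using that(3,4) by (simp add: field_simps)
    qed
    from an nz 2 have "\<forall>\<^sub>\<approx>w. deriv u w / u w = deriv v w / v w"
    proof eventually_elim
      case (elim w)
      have "deriv u w / u w = LD f w - D f w"
        unfolding u_def using ld[OF elim(1,3,5,7)] by (simp add: LD_def D_def[symmetric])
      moreover have "deriv v w / v w = LD g w - D g w"
        unfolding v_def using ld[OF elim(2,4,6,8)] by (simp add: LD_def D_def[symmetric])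
      ultimately show ?case using elim(9) by (simp add: H_def)
    qed
    from log_deriv_eq_imp_proportional[OF uv(1) nzuv(1) uv(2) nzuv(2) this] obtain A where
      A: "A \<noteq> 0" "\<forall>\<^sub>\<approx>w. u w = A * v w" by blast
    \<comment> \<open>Integrates the proportionality \<open>u = A * v\<close>: the derivative of
      \<open>h\<close> is \<open>- u + A * v\<close>.\<close>
    define h where "h = (\<lambda>w. 1 / poly P (f w) - A * (1 / poly P (g w)))"
    have "\<forall>\<^sub>\<approx>w. deriv h w = 0"
      using an(3,4) nz(3,4) A(2)
    proof eventually_elim
      case (elim w)
      have d: "((\<lambda>w. 1 / p w) has_field_derivative - (deriv p w / p w / p w)) (at w)"
        if "p analytic_on {w}" "p w \<noteq> 0" for p :: "complex \<Rightarrow> complex"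
      proof -
        have "(p has_field_derivative deriv p w) (at w)"
          using that(1) analytic_on_imp_differentiable_at DERIV_deriv_iff_field_differentiable by blast
        then have "((\<lambda>w. 1 / p w) has_field_derivative (0 * p w - 1 * deriv p w) / (p w * p w)) (at w)"
          using that(2) by (intro DERIV_divide DERIV_const)
        then show ?thesis by simp
      qed
      have "(h has_field_derivative - u w - A * (- v w)) (at w)"
        unfolding h_def u_def v_def D_def
        by (intro DERIV_diff DERIV_cmult d elim)
      then show ?case using elim(5) by (simp add: DERIV_imp_deriv)
    qed
    moreover have "h meromorphic_on UNIV" unfolding h_def by (intro meromorphic_intros Pf)
    ultimately obtain B where B: "\<forall>\<^sub>\<approx>w. h w = B" using meromorphic_deriv_zero_imp_const by blast
    then have rel: "\<forall>\<^sub>\<approx>w. 1 / poly P (f w) = A / poly P (g w) + B"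
      by eventually_elim (simp add: h_def algebra_simps)
    show ?thesis
    proof (cases "B = 0")
      case True
      from rel nz(3,4) have "\<forall>\<^sub>\<approx>w. poly P (f w) = (1 / A) * poly P (g w)"
        by eventually_elim (use A True in \<open>auto simp: field_simps\<close>)
      then show ?thesis using A(1) by (intro uniq[of "1 / A"]) auto
    next
      case False
      then show ?thesis using no_nonlinear_relation[OF mqf mqg A(1) _ rel] by blast
    qed
  qed
qed

end

section \<open>From the given factorisations to the theorem\<close>

lemma order_prod_powers:
  fixes \<beta> :: "nat \<Rightarrow> complex"
  assumes "b0 \<noteq> 0" "inj_on \<beta> I" "finite I" "j \<in> I"
  shows "order (\<beta> j) (smult b0 (\<Prod>j\<in>I. [:- \<beta> j, 1:] ^ q j)) = q j"
proof -
  define R where "R = (\<Prod>i\<in>I - {j}. [:- \<beta> i, 1:] ^ q i)"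
  have split: "(\<Prod>j\<in>I. [:- \<beta> j, 1:] ^ q j) = [:- \<beta> j, 1:] ^ q j * R"
    unfolding R_def using assms by (intro prod.remove) auto
  have "poly R (\<beta> j) \<noteq> 0"
    unfolding R_def using assms by (auto simp: poly_prod inj_on_def)
  then have "order (\<beta> j) R = 0" "R \<noteq> 0" by (auto simp: order_0I)
  then show ?thesis
    unfolding split using assms(1) by (simp add: order_smult order_mult order_power_n_n)
qed

theorem theorem4p3:
  fixes P :: "complex poly"
    and n k :: nat
    and a0 b0 :: complex
    and \<alpha> \<beta> :: "nat \<Rightarrow> complex"
    and q :: "nat \<Rightarrow> nat"
    and S1 S2 :: "complex set"
  assumes "a0 \<noteq> 0"
    and "P = smult a0 (\<Prod>i=1..n. [:- \<alpha> i, 1:])"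
    and "inj_on \<alpha> {1..n}"
    and "b0 \<noteq> 0"
    and "pderiv P = smult b0 (\<Prod>j=1..k. [:- \<beta> j, 1:] ^ q j)"
    and "inj_on \<beta> {1..k}"
    and "\<forall>j\<in>{1..k}. q j \<ge> 1"
    and "uniqueness_polynomial P"
    and "\<forall>s t. 1 \<le> s \<and> s < t \<and> t \<le> k \<longrightarrow> poly P (\<beta> s) \<noteq> poly P (\<beta> t)"
    and "S1 = \<alpha> ` {1..n}"
    and "S2 = \<beta> ` {1..k}"
    and "k \<ge> 2"
    and "\<forall>z. order z (pderiv P) \<noteq> 1"
  shows
    "(int n \<ge> max (10 - 2 * int k) 5 \<longrightarrow>
        (\<forall>f g. nonconst_meromorphic f \<longrightarrow> nonconst_meromorphic g \<longrightarrow>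
               share_set_weight f g S1 3 \<longrightarrow> share_set_IM f g S2 \<longrightarrow> f = g)) \<and>
     (n \<ge> 5 \<longrightarrow>
        (\<forall>f g. nonconst_entire f \<longrightarrow> nonconst_entire g \<longrightarrow>
               share_set_weight f g S1 3 \<longrightarrow> share_set_IM f g S2 \<longrightarrow> f = g))"
proof -
  have degP: "degree P = n"
    unfolding assms(2) using assms(1) by (simp add: degree_prod_eq_sum_degree)
  have S1: "S1 = {z. poly P z = 0}"
    unfolding assms(2,10) using assms(1) by (auto simp: poly_prod)
  have "q j > 0" if "Suc 0 \<le> j" "j \<le> k" for j using assms(7) that by force
  then have "poly (pderiv P) z = 0 \<longleftrightarrow> (\<exists>j\<in>{1..k}. z = \<beta> j)" for z
    unfolding assms(5) using assms(4) by (auto simp: poly_prod)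
  then have S2: "S2 = {z. poly (pderiv P) z = 0}" unfolding assms(11) by auto
  have ord: "order (\<beta> j) (pderiv P) = q j" if "j \<in> {1..k}" for j
    unfolding assms(5) using that assms(4,6) by (intro order_prod_powers) auto
  interpret critically_injective P S1 S2 n k
  proof
    show "degree P = n" by (rule degP)
    show "S1 = {z. poly P z = 0}" by (rule S1)
    show "S2 = {z. poly (pderiv P) z = 0}" by (rule S2)
    show "card S1 = n" unfolding assms(10) using assms(3) by (simp add: card_image)
    show "card S2 = k" unfolding assms(11) using assms(6) by (simp add: card_image)
    show "k \<ge> 2" by (rule assms)
  next
    fix a assume "a \<in> S1"
    then obtain i where i: "i \<in> {1..n}" "a = \<alpha> i" using assms(10) by blast
    define R where "R = smult a0 (\<Prod>j\<in>{1..n} - {i}. [:- \<alpha> j, 1:])"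
    have "(\<Prod>i=1..n. [:- \<alpha> i, 1:]) = [:- \<alpha> i, 1:] * (\<Prod>j\<in>{1..n} - {i}. [:- \<alpha> j, 1:])"
      using i by (intro prod.remove) auto
    then have P: "P = [:- \<alpha> i, 1:] * R" by (simp only: assms(2) R_def mult_smult_right)
    have "poly R a \<noteq> 0"
      unfolding R_def using assms(1) i inj_on_eq_iff[OF assms(3), of i] by (auto simp: poly_prod)
    moreover have "poly (pderiv P) a = poly R a"
      unfolding P pderiv_mult by (simp add: pderiv_pCons i)
    ultimately show "poly (pderiv P) a \<noteq> 0" by simp
  next
    fix b assume "b \<in> S2"
    then obtain j where j: "j \<in> {1..k}" "b = \<beta> j" using assms(11) by blast
    then have "q j \<ge> 1" "q j \<noteq> 1" using assms(7,13) ord by metis+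
    then show "order b (pderiv P) \<ge> 2" using ord j by simp
  next
    have "(\<Sum>b\<in>S2. order b (pderiv P)) = (\<Sum>j=1..k. q j)"
      unfolding assms(11) using assms(6) ord by (simp add: sum.reindex)
    also have "\<dots> = degree (pderiv P)"
      unfolding assms(5) using assms(4) by (simp add: degree_prod_eq_sum_degree degree_power_eq)
    also have "\<dots> = n - 1" by (simp add: degree_pderiv degP)
    finally show "(\<Sum>b\<in>S2. order b (pderiv P)) = n - 1" .
  next
    fix b b' assume "b \<in> S2" "b' \<in> S2" and eq: "poly P b = poly P b'"
    then obtain s t where st: "s \<in> {1..k}" "t \<in> {1..k}" "b = \<beta> s" "b' = \<beta> t" using assms(11) by blast
    have "s = t"
    proof (rule ccontr)
      assume "s \<noteq> t"
      then have "s < t \<or> t < s" by linarith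
      then show False using assms(9) eq st by (metis atLeastAtMost_iff)
    qed
    then show "b = b'" using st by simp
  qed
  show ?thesis
  proof (intro conjI impI allI)
    fix f g assume n: "max (10 - 2 * int k) 5 \<le> int n" and fg: "nonconst_meromorphic f" "nonconst_meromorphic g"
      and share: "share_set_weight f g S1 3" "share_set_IM f g S2"
    obtain x y \<xi> \<eta> where "mero_quotient f x y" "mero_quotient g \<xi> \<eta>"
      using mero_quotient_exists fg by blast
    then interpret sharing_pair P S1 S2 n k f x y g \<xi> \<eta>
      using n share by (auto simp: sharing_pair_def sharing_pair_axioms_def critically_injective_axioms)
    show "f = g" using assms(8) by (rule eq_if_uniqueness_polynomial)
  next
    fix f g assume fg: "nonconst_entire f" "nonconst_entire g"
      and share: "share_set_weight f g S1 3" "share_set_IM f g S2"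
    note mq = mero_quotient_entire[OF fg(1)] mero_quotient_entire[OF fg(2)]
    have "\<not> is_pole f z" "\<not> is_pole g z" for z
      using mero_quotient.y_zero[OF mq(1), of z] mero_quotient.y_zero[OF mq(2), of z] by auto
    \<comment> \<open>Without poles the locale assumption \<open>poles\<close> is vacuous.\<close>
    with mq interpret sharing_pair P S1 S2 n k f f "\<lambda>_. 1" g g "\<lambda>_. 1"
      using share by (auto simp: sharing_pair_def sharing_pair_axioms_def critically_injective_axioms)
    show "f = g" using assms(8) by (rule eq_if_uniqueness_polynomial)
  qed
qed

end
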